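(* Let $D\subset\mathbb C$ be a disc centered at $0$ and let $f:D\to\mathbb R^4$ be a branched disc with leading exponent $N\ge2$. Assume that $f$ is a topological embedding in a neighbourhood of the origin. Then there exists a number $R$, $0<R<1$, such that for every small enough $\epsilon>0$ the curve $$K^\epsilon=\mathbb S_\epsilon\cap f(D(0,R))$$ is a closed braid (with respect to some great circle of $\mathbb S_\epsilon$ as axis) with braid index $N$. For different (small enough) values of $\epsilon$ the $K^\epsilon$'s have the same transverse knot type.
   Context: All maps are smooth; $D(0,R)$ is the disc of radius $R$ centered at $0$ in $\mathbb C$. Branched disc: a map $f:D\to\mathbb R^4$ which is an immersion except at $0$ and which, in a neighbourhood of $0$, in some chart $(x_1,\dots,x_4)$ of $\mathbb R^4$ around $f(0)$ (centered at $f(0)$), is written $f^1(z)=\mathrm{Re}(z^N)+o_1(|z|^N)$, $f^2(z)=\mathrm{Im}(z^N)+o_1(|z|^N)$, $f^3(z)=o_1(|z|^N)$, $f^4(z)=o_1(|z|^N)$, where $z$ is a local holomorphic coordinate and $N\ge2$ is an integer (the leading exponent). Here $o_1(|z|^N)$ means a function that is $o(|z|^N)$ and whose first derivatives are $o(|z|^{N-1})$. Let $e_i$ be the value of $\partial/\partial x_i$ at $f(0)$; after possibly changing the sign of $x_4$, the basis $(e_1,e_2,e_3,e_4)$ is positive for the orientation of $\mathbb R^4$. Let $g_0$ be the scalar product on $\mathbb R^4$ for which $(e_1,\dots,e_4)$ is orthonormal and let $J_0$ be the complex structure with $J_0e_1=e_2$, $J_0e_3=e_4$. $\mathbb S_\epsilon$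 is the sphere of radius $\epsilon$ (for $g_0$) centered at $f(0)$, oriented as the boundary of the ball. It carries the contact structure $\xi$ whose plane at $q$ consists of the vectors tangent to $\mathbb S_\epsilon$ and $g_0$-orthogonal to $J_0(q-f(0))$; rescaling identifies these contact structures for different $\epsilon$. A knot in $\mathbb S_\epsilon$ is transverse if its tangent vectors never belong to $\xi$. Two transverse knots have the same transverse knot type if they are isotopic through transverse knots. $K^\epsilon$ is oriented as the image of the boundary of the corresponding neighbourhood of $0$ in $D$. Closed braid in $\mathbb S_\epsilon$: taking $f(0)$ as the origin, an oriented great circle $\Gamma=P\cap\mathbb S_\epsilon$ ($P$ a $2$-plane) is an axis for an oriented knot $K$ if $K$ is disjoint from $\Gamma$ and the angular coordinate of the projection of $K$ to $P^\perp$ (oriented so that $P\oplus P^\perp$ is positively oriented, with $P$ oriented by $\Gamma$) has everywhere positive derivative along $K$. The braid index is the linking number of $K$ with the oriented axis. *)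

theory Defs
  imports "HOL-Analysis.Analysis" "HOL-Library.Landau_Symbols"
begin

text \<open>
  In finite dimension, \<open>ck_on k S f\<close> for open \<open>S\<close> is the usual notion "of class \<open>C^k\<close> on \<open>S\<close>".
\<close>

primrec ck_on ::
  "nat \<Rightarrow> 'a::real_normed_vector set \<Rightarrow> ('a \<Rightarrow> 'b::real_normed_vector) \<Rightarrow> bool" where
  "ck_on 0 S f \<longleftrightarrow> continuous_on S f"
| "ck_on (Suc k) S f \<longleftrightarrow>
     (\<forall>x\<in>S. f differentiable (at x)) \<and> (\<forall>v. ck_on k S (\<lambda>x. frechet_derivative f (at x) v))"

definition smooth_on ::
  "'a::real_normed_vector set \<Rightarrow> ('a \<Rightarrow> 'b::real_normed_vector) \<Rightarrow> bool" where
  "smooth_on S f \<longleftrightarrow> (\<forall>k. ck_on k S f)"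

definition smooth_chart :: "(real^4) set \<Rightarrow> (real^4 \<Rightarrow> real^4) \<Rightarrow> bool" where
  "smooth_chart U X \<longleftrightarrow> open U \<and> open (X ` U) \<and> inj_on X U
     \<and> smooth_on U X \<and> smooth_on (X ` U) (inv_into U X)"

definition little_o1 :: "nat \<Rightarrow> (complex \<Rightarrow> real) \<Rightarrow> bool" where
  "little_o1 N h \<longleftrightarrow>
     h \<in> o[at 0](\<lambda>z. cmod z ^ N)
     \<and> (\<forall>\<^sub>F z in at 0. h differentiable (at z))
     \<and> (\<forall>v. (\<lambda>z. frechet_derivative h (at z) v) \<in> o[at 0](\<lambda>z. cmod z ^ (N - 1)))"

text \<open>
  The holomorphic coordinate \<open>z\<close> near the branch point is given through its inverse \<open>\<psi>\<close>, which maps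
  the coordinate \<open>z \<in> V\<close> to the point of \<open>D\<close> having this coordinate.
\<close>

definition branched_in_chart ::
  "complex set \<Rightarrow> (complex \<Rightarrow> real^4) \<Rightarrow> nat \<Rightarrow> (real^4) set \<Rightarrow> (real^4 \<Rightarrow> real^4) \<Rightarrow> bool" where
  "branched_in_chart D f N U X \<longleftrightarrow>
     smooth_chart U X \<and> f 0 \<in> U \<and> X (f 0) = 0 \<and>
     (\<exists>V \<psi>. open V \<and> 0 \<in> V \<and> \<psi> holomorphic_on V \<and> inj_on \<psi> V \<and> \<psi> 0 = 0
        \<and> \<psi> ` V \<subseteq> D \<and> f ` \<psi> ` V \<subseteq> U
        \<and> little_o1 N (\<lambda>z. X (f (\<psi> z)) $ 1 - Re (z ^ N))
        \<and> little_o1 N (\<lambda>z. X (f (\<psi> z)) $ 2 - Im (z ^ N))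
        \<and> little_o1 N (\<lambda>z. X (f (\<psi> z)) $ 3)
        \<and> little_o1 N (\<lambda>z. X (f (\<psi> z)) $ 4))"

definition branched_disc :: "complex set \<Rightarrow> (complex \<Rightarrow> real^4) \<Rightarrow> nat \<Rightarrow> bool" where
  "branched_disc D f N \<longleftrightarrow>
     N \<ge> 2 \<and> smooth_on D f
     \<and> (\<forall>z\<in>D - {0}. inj (frechet_derivative f (at z)))
     \<and> (\<exists>U X. branched_in_chart D f N U X)"

definition orient4 :: "real^4 \<Rightarrow> real^4 \<Rightarrow> real^4 \<Rightarrow> real^4 \<Rightarrow> real" where
  "orient4 a b c d =
     det (\<chi> i. if i = 1 then a else if i = 2 then b else if i = 3 then c else d)"

text \<open>
  A basis \<open>(e\<^sub>1, e\<^sub>2, e\<^sub>3, e\<^sub>4)\<close> is encoded as the matrix \<open>E\<close> with columns \<open>e\<^sub>i\<close>. The \<open>i\<close>-th column of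
  \<open>coord_basis U X p\<close> is the value at \<open>p\<close> of the \<open>i\<close>-th coordinate vector field of the chart \<open>X\<close>;
  \<open>positive_basis\<close> replaces \<open>e\<^sub>4\<close> by \<open>- e\<^sub>4\<close> (as the change of sign of the fourth coordinate does)
  if the basis is negative.
\<close>

definition coord_basis :: "(real^4) set \<Rightarrow> (real^4 \<Rightarrow> real^4) \<Rightarrow> real^4 \<Rightarrow> real^4^4" where
  "coord_basis U X p = matrix (frechet_derivative (inv_into U X) (at (X p)))"

definition positive_basis :: "real^4^4 \<Rightarrow> real^4^4" where
  "positive_basis E =
     (if det E > 0 then E else (\<chi> i j. if j = 4 then - (E $ i $ j) else E $ i $ j))"

definition adapted_basis :: "(real^4) set \<Rightarrow> (real^4 \<Rightarrow> real^4) \<Rightarrow> real^4 \<Rightarrow> real^4^4" where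
  "adapted_basis U X p = positive_basis (coord_basis U X p)"

definition g0 :: "real^4^4 \<Rightarrow> real^4 \<Rightarrow> real^4 \<Rightarrow> real" where
  "g0 E u v = (matrix_inv E *v u) \<bullet> (matrix_inv E *v v)"

definition J_std :: "real^4 \<Rightarrow> real^4" where
  "J_std x =
     (\<chi> i. if i = 1 then - (x $ 2) else if i = 2 then x $ 1 else if i = 3 then - (x $ 4) else x $ 3)"

definition J0 :: "real^4^4 \<Rightarrow> real^4 \<Rightarrow> real^4" where
  "J0 E v = E *v J_std (matrix_inv E *v v)"

definition g0_ball :: "real^4^4 \<Rightarrow> real^4 \<Rightarrow> real \<Rightarrow> (real^4) set" where
  "g0_ball E p \<epsilon> = {q. sqrt (g0 E (q - p) (q - p)) < \<epsilon>}"

definition g0_sphere :: "real^4^4 \<Rightarrow> real^4 \<Rightarrow> real \<Rightarrow> (real^4) set" where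
  "g0_sphere E p \<epsilon> = {q. sqrt (g0 E (q - p) (q - p)) = \<epsilon>}"

definition contact_plane :: "real^4^4 \<Rightarrow> real^4 \<Rightarrow> real^4 \<Rightarrow> (real^4) set" where
  "contact_plane E p q = {v. g0 E v (q - p) = 0 \<and> g0 E v (J0 E (q - p)) = 0}"

text \<open>
  Oriented knots are represented by smooth regular parametrizations of period 1. The properties of
  \<open>\<gamma>\<close> defined below do not change under orientation-preserving reparametrization.
\<close>

definition smooth_knot :: "(real \<Rightarrow> 'a::real_normed_vector) \<Rightarrow> bool" where
  "smooth_knot \<gamma> \<longleftrightarrow> smooth_on UNIV \<gamma> \<and> (\<forall>t. \<gamma> (t + 1) = \<gamma> t) \<and> inj_on \<gamma> {0..<1}
     \<and> (\<forall>t. vector_derivative \<gamma> (at t) \<noteq> 0)"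

definition knot_in_sphere :: "real^4^4 \<Rightarrow> real^4 \<Rightarrow> real \<Rightarrow> (real \<Rightarrow> real^4) \<Rightarrow> bool" where
  "knot_in_sphere E p \<epsilon> \<gamma> \<longleftrightarrow> smooth_knot \<gamma> \<and> range \<gamma> \<subseteq> g0_sphere E p \<epsilon>"

definition transverse_knot :: "real^4^4 \<Rightarrow> real^4 \<Rightarrow> real \<Rightarrow> (real \<Rightarrow> real^4) \<Rightarrow> bool" where
  "transverse_knot E p \<epsilon> \<gamma> \<longleftrightarrow> knot_in_sphere E p \<epsilon> \<gamma>
     \<and> (\<forall>t. vector_derivative \<gamma> (at t) \<notin> contact_plane E p (\<gamma> t))"

definition rescale_knot :: "real^4 \<Rightarrow> real \<Rightarrow> (real \<Rightarrow> real^4) \<Rightarrow> real \<Rightarrow> real^4" where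
  "rescale_knot p \<epsilon> \<gamma> t = p + (1 / \<epsilon>) *\<^sub>R (\<gamma> t - p)"

definition transverse_isotopic ::
  "real^4^4 \<Rightarrow> real^4 \<Rightarrow> real \<Rightarrow> (real \<Rightarrow> real^4) \<Rightarrow> (real \<Rightarrow> real^4) \<Rightarrow> bool" where
  "transverse_isotopic E p \<epsilon> \<gamma> \<gamma>' \<longleftrightarrow>
     (\<exists>(W :: (real \<times> real) set) H.
        open W \<and> {0..1} \<times> UNIV \<subseteq> W \<and> smooth_on W (\<lambda>(s, t). H s t)
        \<and> (\<forall>s\<in>{0..1}. transverse_knot E p \<epsilon> (H s)) \<and> H 0 = \<gamma> \<and> H 1 = \<gamma>')"

definition same_transverse_type ::
  "real^4^4 \<Rightarrow> real^4 \<Rightarrow> real \<Rightarrow> (real \<Rightarrow> real^4) \<Rightarrow> real \<Rightarrow> (real \<Rightarrow> real^4) \<Rightarrow> bool" where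
  "same_transverse_type E p \<epsilon> \<gamma> \<epsilon>' \<gamma>' \<longleftrightarrow>
     transverse_isotopic E p 1 (rescale_knot p \<epsilon> \<gamma>) (rescale_knot p \<epsilon>' \<gamma>')"

text \<open>
  The linking number in a 3-sphere, oriented as the boundary of the ball (outward normal first), is
  the intersection number of \<open>\<gamma>\<close> with an oriented surface bounded by \<open>\<delta>\<close> and transverse to \<open>\<gamma>\<close>. Loops
  in the 3-sphere are null-homotopic, so (singular) discs \<open>u\<close> suffice as bounding surfaces; the
  intersection number does not depend on the choice of \<open>u\<close>.
\<close>

definition crossing_det ::
  "real^4 \<Rightarrow> (real \<Rightarrow> real^4) \<Rightarrow> (complex \<Rightarrow> real^4) \<Rightarrow> real \<Rightarrow> complex \<Rightarrow> real" where
  "crossing_det p \<gamma> u t z =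
     orient4 (\<gamma> t - p) (frechet_derivative u (at z) 1) (frechet_derivative u (at z) \<i>)
       (vector_derivative \<gamma> (at t))"

definition has_linking_number ::
  "real^4^4 \<Rightarrow> real^4 \<Rightarrow> real \<Rightarrow> (real \<Rightarrow> real^4) \<Rightarrow> (real \<Rightarrow> real^4) \<Rightarrow> real \<Rightarrow> bool" where
  "has_linking_number E p \<epsilon> \<gamma> \<delta> n \<longleftrightarrow>
     knot_in_sphere E p \<epsilon> \<gamma> \<and> knot_in_sphere E p \<epsilon> \<delta> \<and> range \<gamma> \<inter> range \<delta> = {} \<and>
     (\<exists>T u. open T \<and> cball 0 1 \<subseteq> T \<and> smooth_on T u \<and> u ` cball 0 1 \<subseteq> g0_sphere E p \<epsilon>
        \<and> (\<forall>t. u (cis (2 * pi * t)) = \<delta> t)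
        \<and> (let I = {(t, z). t \<in> {0..<1} \<and> z \<in> cball 0 1 \<and> \<gamma> t = u z} in
             finite I \<and> (\<forall>(t, z)\<in>I. crossing_det p \<gamma> u t z \<noteq> 0)
             \<and> n = (\<Sum>(t, z)\<in>I. sgn (crossing_det p \<gamma> u t z))))"

text \<open>
  An oriented 2-plane \<open>P\<close> is given by a positive \<open>g\<^sub>0\<close>-orthonormal basis \<open>(a, b)\<close>; the curve
  \<open>great_circle p \<epsilon> a b\<close> then runs once through the great circle cut out by \<open>P\<close>.
\<close>

definition great_circle ::
  "real^4 \<Rightarrow> real \<Rightarrow> real^4 \<Rightarrow> real^4 \<Rightarrow> real \<Rightarrow> real^4" where
  "great_circle p \<epsilon> a b t = p + \<epsilon> *\<^sub>R (cos (2 * pi * t) *\<^sub>R a + sin (2 * pi * t) *\<^sub>R b)"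

definition g0_orthonormal :: "real^4^4 \<Rightarrow> (real^4) list \<Rightarrow> bool" where
  "g0_orthonormal E vs \<longleftrightarrow>
     (\<forall>i<length vs. \<forall>j<length vs. g0 E (vs ! i) (vs ! j) = (if i = j then 1 else 0))"

text \<open>
  \<open>(c, d)\<close> is a positive orthonormal basis of the orthogonal complement of \<open>P\<close>, identifying it with
  the complex plane, and \<open>\<theta>\<close> is an angular coordinate along the projected knot.
\<close>

definition braid_axis ::
  "real^4^4 \<Rightarrow> real^4 \<Rightarrow> real \<Rightarrow> real^4 \<Rightarrow> real^4 \<Rightarrow> (real \<Rightarrow> real^4) \<Rightarrow> bool" where
  "braid_axis E p \<epsilon> a b \<gamma> \<longleftrightarrow>
     range \<gamma> \<inter> range (great_circle p \<epsilon> a b) = {} \<and>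
     (\<exists>c d. g0_orthonormal E [a, b, c, d] \<and> orient4 a b c d > 0 \<and>
        (\<exists>\<rho> \<theta> \<theta>'. \<forall>t. \<rho> t > 0
           \<and> Complex (g0 E (\<gamma> t - p) c) (g0 E (\<gamma> t - p) d) = rcis (\<rho> t) (\<theta> t)
           \<and> (\<theta> has_real_derivative \<theta>' t) (at t) \<and> \<theta>' t > 0))"

definition closed_braid_of_index ::
  "real^4^4 \<Rightarrow> real^4 \<Rightarrow> real \<Rightarrow> (real \<Rightarrow> real^4) \<Rightarrow> nat \<Rightarrow> bool" where
  "closed_braid_of_index E p \<epsilon> \<gamma> N \<longleftrightarrow>
     knot_in_sphere E p \<epsilon> \<gamma> \<and>
     (\<exists>a b. g0_orthonormal E [a, b] \<and> braid_axis E p \<epsilon> a b \<gamma>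
        \<and> has_linking_number E p \<epsilon> \<gamma> (great_circle p \<epsilon> a b) (real N))"

text \<open>
  Boundary orientation: the domain \<open>\<Omega>\<close> lies on the left of \<open>c\<close>, that is, the normal
  \<open>\<i> * c' t\<close> points into \<open>\<Omega>\<close> and its opposite points out of it.
\<close>

definition oriented_boundary :: "complex set \<Rightarrow> (real \<Rightarrow> complex) \<Rightarrow> bool" where
  "oriented_boundary \<Omega> c \<longleftrightarrow> smooth_knot c \<and> range c = frontier \<Omega>
     \<and> (\<forall>t. (\<forall>\<^sub>F s in at_right 0. c t + of_real s * \<i> * vector_derivative c (at t) \<in> \<Omega>)
          \<and> (\<forall>\<^sub>F s in at_right 0. c t - of_real s * \<i> * vector_derivative c (at t) \<notin> closure \<Omega>))"

definition branch_knot_set ::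
  "real^4^4 \<Rightarrow> (complex \<Rightarrow> real^4) \<Rightarrow> real \<Rightarrow> real \<Rightarrow> (real^4) set" where
  "branch_knot_set E f R \<epsilon> = g0_sphere E (f 0) \<epsilon> \<inter> f ` ball 0 R"

definition is_branch_knot ::
  "real^4^4 \<Rightarrow> (complex \<Rightarrow> real^4) \<Rightarrow> real \<Rightarrow> real \<Rightarrow> (real \<Rightarrow> real^4) \<Rightarrow> bool" where
  "is_branch_knot E f R \<epsilon> \<gamma> \<longleftrightarrow>
     smooth_knot \<gamma> \<and> range \<gamma> = branch_knot_set E f R \<epsilon> \<and>
     (\<exists>c. range c \<subseteq> ball 0 R \<and> \<gamma> = f \<circ> c
        \<and> oriented_boundary {z \<in> ball 0 R. f z \<in> g0_ball E (f 0) \<epsilon>} c)"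

end

theory Submission
  imports Defs "HOL-Complex_Analysis.Conformal_Mappings"
begin

text \<open>
  In the coordinates of the adapted frame \<open>E\<close>, and after identifying \<open>\<real>\<^sup>4\<close> with \<open>\<complex> \<times> \<complex>\<close> so that the complex
  structure becomes multiplication by \<open>\<i>\<close>, the map \<open>f\<close> becomes a map \<open>F\<close> with \<open>F 0 = 0\<close> whose differential
  differs from that of \<open>w \<mapsto> (a w\<^sup>N, 0)\<close> by \<open>o(\<bar>w\<bar>\<^bsup>N-1\<^esup>)\<close>, for some \<open>a \<noteq> 0\<close> (lemma \<open>leading_term\<close>). Replacing
  the holomorphic coordinate by its linear part only affects the remainder, so the original
  coordinate \<open>w\<close> of the disc can be used throughout.

  For \<open>w\<close> small, each of the three bilinear forms \<open>x \<bullet> y\<close>, \<open>\<i>x \<bullet> y\<close> and \<open>Im (cnj x\<^sub>1 y\<^sub>1)\<close>, evaluated at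
  \<open>F w\<close> and \<open>DF w (\<zeta> w)\<close> with \<open>\<zeta> \<in> {1, \<i>}\<close>, is therefore within a quarter of \<open>N \<bar>a\<bar>\<^sup>2 \<bar>w\<bar>\<^bsup>2N\<^esup>\<close> of its value for the
  monomial (lemma \<open>form_near\<close>). This has the following consequences.

  \<^item> The distance \<open>\<bar>F\<bar>\<close> increases strictly along every ray. Hence \<open>\<bar>F w\<bar> = \<epsilon>\<close> is a star-shaped curve
    \<open>loop \<epsilon>\<close> around the origin, which depends smoothly on \<open>\<epsilon>\<close> and on the angle by the implicit function
    theorem. It is the oriented boundary of the domain \<open>\<bar>F w\<bar> < \<epsilon>\<close>.
  \<^item> The velocity of this curve is \<open>2 \<pi> (\<kappa> + \<i>)\<close> times its position with \<open>\<bar>\<kappa>\<bar> \<le> 1/3\<close>. Along its image the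
    second form is positive, which is transversality to the contact planes, and so is the third, which says that the
    argument of the first complex coordinate increases. The circle in the second
    coordinate plane is thus a braid axis.
  \<^item> The argument of the first coordinate grows by \<open>2 \<pi> N\<close> in one period. Hence the knot meets a half
    great sphere bounded by the axis exactly \<open>N\<close> times, always positively, and \<open>N\<close> is the linking number.
  \<^item> All rescaled knots are transverse and depend smoothly on \<open>\<epsilon>\<close>; the family joining two values of \<open>\<epsilon>\<close> is a
    transverse isotopy.

  Injectivity of \<open>f\<close> is what makes the image curves embedded.
\<close>

section \<open>Calculus of smooth maps\<close>

lemma frechet_derivative_eqI:
  "(f has_derivative f') (at x) \<Longrightarrow> frechet_derivative f (at x) = f'"
  using frechet_derivative_at by metis

lemma ck_on_cong:
  assumes "open S" "\<And>x. x \<in> S \<Longrightarrow> f x = g x" "ck_on k S f"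
  shows "ck_on k S g"
  using assms(2,3)
proof (induction k arbitrary: f g)
  case 0
  then show ?case by (metis ck_on.simps(1) continuous_on_cong)
next
  case (Suc k)
  have D: "(g has_derivative frechet_derivative f (at x)) (at x)" if "x \<in> S" for x
  proof -
    have "(f has_derivative frechet_derivative f (at x)) (at x)"
      using Suc.prems that by (simp add: frechet_derivative_works)
    then show ?thesis
      by (rule has_derivative_transform_within_open[OF _ \<open>open S\<close> that]) (use Suc.prems in auto)
  qed
  have "ck_on k S (\<lambda>x. frechet_derivative g (at x) v)" for v
  proof (rule Suc.IH)
    show "ck_on k S (\<lambda>x. frechet_derivative f (at x) v)" using Suc.prems by simp
  qed (simp add: frechet_derivative_eqI[OF D])
  then show ?case using D by (auto simp: differentiable_def)
qed

lemma ck_on_subset: "ck_on k S f \<Longrightarrow> T \<subseteq> S \<Longrightarrow> ck_on k T f"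
  by (induction k arbitrary: f) (auto intro: continuous_on_subset)

lemma ck_on_SucI:
  assumes "open S" and D: "\<And>x. x \<in> S \<Longrightarrow> (f has_derivative f' x) (at x)"
    and C: "\<And>v. ck_on k S (\<lambda>x. f' x v)"
  shows "ck_on (Suc k) S f"
proof -
  have "ck_on k S (\<lambda>x. frechet_derivative f (at x) v)" for v
    by (rule ck_on_cong[OF \<open>open S\<close> _ C[of v]]) (simp add: frechet_derivative_eqI[OF D])
  then show ?thesis using D by (auto simp: differentiable_def)
qed

lemma ck_on_has_derivative:
  "ck_on (Suc k) S f \<Longrightarrow> x \<in> S \<Longrightarrow> (f has_derivative frechet_derivative f (at x)) (at x)"
  by (simp add: frechet_derivative_works)

lemma ck_on_SucD: "ck_on (Suc k) S f \<Longrightarrow> ck_on k S f"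
proof (induction k arbitrary: f)
  case 0
  then show ?case
    by (simp add: continuous_at_imp_continuous_on differentiable_imp_continuous_within)
next
  case (Suc k)
  then show ?case by simp
qed

lemma ck_on_const: "ck_on k S (\<lambda>x. c)"
  by (induction k arbitrary: c) auto

lemma ck_on_bounded_linear:
  assumes L: "bounded_linear L" and S: "open S" and f: "ck_on k S f"
  shows "ck_on k S (\<lambda>x. L (f x))"
  using f
proof (induction k arbitrary: f)
  case 0
  then show ?case by (simp add: bounded_linear.continuous_on[OF L])
next
  case (Suc k)
  show ?case
  proof (rule ck_on_SucI[OF S])
    show "((\<lambda>x. L (f x)) has_derivative (\<lambda>v. L (frechet_derivative f (at x) v))) (at x)" if "x \<in> S" for x
      by (rule bounded_linear.has_derivative[OF L ck_on_has_derivative[OF Suc.prems that]])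
    show "ck_on k S (\<lambda>x. L (frechet_derivative f (at x) v))" for v
      by (rule Suc.IH) (use Suc.prems in simp)
  qed
qed

lemma ck_on_id: "open S \<Longrightarrow> ck_on k S (\<lambda>x. x)"
proof (cases k)
  case (Suc n)
  assume "open S"
  then show ?thesis unfolding Suc
    by (rule ck_on_SucI[where f' = "\<lambda>x v. v"]) (auto intro: ck_on_const)
qed auto

lemma ck_on_add:
  assumes S: "open S" and "ck_on k S f" "ck_on k S g"
  shows "ck_on k S (\<lambda>x. f x + g x)"
  using assms(2,3)
proof (induction k arbitrary: f g)
  case 0
  then show ?case by (simp add: continuous_on_add)
next
  case (Suc k)
  show ?case
  proof (rule ck_on_SucI[OF S])
    show "((\<lambda>x. f x + g x) has_derivative
        (\<lambda>v. frechet_derivative f (at x) v + frechet_derivative g (at x) v)) (at x)" if "x \<in> S" for x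
      using Suc.prems by (intro has_derivative_add ck_on_has_derivative[OF _ that])
    show "ck_on k S (\<lambda>x. frechet_derivative f (at x) v + frechet_derivative g (at x) v)" for v
      by (rule Suc.IH) (use Suc.prems in simp_all)
  qed
qed

lemma ck_on_sum:
  assumes S: "open S" and "finite I" "\<And>i. i \<in> I \<Longrightarrow> ck_on k S (f i)"
  shows "ck_on k S (\<lambda>x. \<Sum>i\<in>I. f i x)"
  using assms(2,3) by (induction I rule: finite_induct) (auto intro: ck_on_const ck_on_add[OF S])

lemma ck_on_bilinear:
  assumes B: "bounded_bilinear B" and S: "open S" and "ck_on k S f" "ck_on k S g"
  shows "ck_on k S (\<lambda>x. B (f x) (g x))"
  using assms(3,4)
proof (induction k arbitrary: f g)
  case 0
  then show ?case by (simp add: bounded_bilinear.continuous_on[OF B])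
next
  case (Suc k)
  show ?case
  proof (rule ck_on_SucI[OF S])
    show "((\<lambda>x. B (f x) (g x)) has_derivative
        (\<lambda>v. B (f x) (frechet_derivative g (at x) v) + B (frechet_derivative f (at x) v) (g x))) (at x)"
      if "x \<in> S" for x
      using Suc.prems by (intro bounded_bilinear.FDERIV[OF B] ck_on_has_derivative[OF _ that])
    show "ck_on k S (\<lambda>x. B (f x) (frechet_derivative g (at x) v) + B (frechet_derivative f (at x) v) (g x))" for v
      using Suc.prems by (intro ck_on_add[OF S] Suc.IH) (simp_all add: ck_on_SucD[OF Suc.prems(1)] ck_on_SucD[OF Suc.prems(2)] del: ck_on.simps(2), simp_all)
  qed
qed

text \<open>
  The chain rule gives \<open>D(g \<circ> f)(x)(v) = Dg(f x)(Df(x)(v))\<close>, in which the direction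
  \<open>Df(x)(v)\<close> varies with \<open>x\<close>; expanding it in a basis reduces to the fixed directions used by \<open>ck_on\<close>.
\<close>

lemma ck_on_compose:
  fixes f :: "'a::real_normed_vector \<Rightarrow> 'b::euclidean_space" and g :: "'b \<Rightarrow> 'c::real_normed_vector"
  assumes S: "open S" and "ck_on k S f" and fS: "f ` S \<subseteq> T" and "ck_on k T g"
  shows "ck_on k S (\<lambda>x. g (f x))"
  using assms(2,4)
proof (induction k arbitrary: g)
  case 0
  then show ?case using fS by (auto intro: continuous_on_compose2)
next
  case (Suc k)
  show ?case
  proof (rule ck_on_SucI[OF S])
    fix x assume x: "x \<in> S"
    then have fx: "f x \<in> T" using fS by auto
    let ?f = "frechet_derivative f (at x)" and ?g = "frechet_derivative g (at (f x))"
    have g: "(g has_derivative ?g) (at (f x))" by (rule ck_on_has_derivative[OF Suc.prems(2) fx])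
    interpret bounded_linear ?g using g by (rule has_derivative_bounded_linear)
    have "(\<lambda>v. ?g (?f v)) = (\<lambda>v. \<Sum>b\<in>Basis. (?f v \<bullet> b) *\<^sub>R ?g b)"
    proof
      fix v
      have "?g (?f v) = ?g (\<Sum>b\<in>Basis. (?f v \<bullet> b) *\<^sub>R b)" by (simp add: euclidean_representation)
      then show "?g (?f v) = (\<Sum>b\<in>Basis. (?f v \<bullet> b) *\<^sub>R ?g b)" by (simp add: sum scaleR)
    qed
    then show "((\<lambda>x. g (f x)) has_derivative (\<lambda>v. \<Sum>b\<in>Basis. (?f v \<bullet> b) *\<^sub>R ?g b)) (at x)"
      using has_derivative_compose[OF ck_on_has_derivative[OF Suc.prems(1) x] g] by simp
  next
    fix v
    show "ck_on k S (\<lambda>x. \<Sum>b\<in>Basis. (frechet_derivative f (at x) v \<bullet> b) *\<^sub>R frechet_derivative g (at (f x)) b)"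
    proof (intro ck_on_sum[OF S] ck_on_bilinear[OF bounded_bilinear_scaleR S] finite_Basis)
      fix b :: 'b
      show "ck_on k S (\<lambda>x. frechet_derivative f (at x) v \<bullet> b)"
        by (intro ck_on_bilinear[OF bounded_bilinear_inner S] ck_on_const) (use Suc.prems in simp)
      show "ck_on k S (\<lambda>x. frechet_derivative g (at (f x)) b)"
        by (rule Suc.IH) (use ck_on_SucD[OF Suc.prems(1)] Suc.prems(2) in simp_all)
    qed
  qed
qed

lemma open_nonzero: "open (- {0::'a::real_normed_vector})"
  by (simp add: open_Compl)

lemma ck_on_inverse_aux: "ck_on k (- {0}) (inverse :: 'a::real_normed_field \<Rightarrow> 'a)"
proof (induction k)
  case 0
  then show ?case by (auto intro: continuous_intros)
next
  case (Suc k)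
  show ?case
  proof (rule ck_on_SucI)
    show "((inverse :: 'a \<Rightarrow> 'a) has_derivative (\<lambda>v. - (inverse x * v * inverse x))) (at x)" if "x \<in> - {0}" for x
      using that by (auto intro!: derivative_eq_intros)
    show "ck_on k (- {0}) (\<lambda>x::'a. - (inverse x * v * inverse x))" for v
      by (intro ck_on_bounded_linear[OF bounded_linear_minus[OF bounded_linear_ident]]
            ck_on_bilinear[OF bounded_bilinear_mult] ck_on_const Suc.IH) (auto simp: open_nonzero)
  qed (simp add: open_nonzero)
qed

lemma ck_on_exp: "ck_on k UNIV (exp :: complex \<Rightarrow> complex)"
proof (induction k)
  case 0
  then show ?case by (auto intro: continuous_intros)
next
  case (Suc k)
  show ?case
  proof (rule ck_on_SucI)
    show "((exp :: complex \<Rightarrow> complex) has_derivative (\<lambda>v. v * exp x)) (at x)" for x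
      by (auto intro!: derivative_eq_intros simp: ac_simps)
    show "ck_on k UNIV (\<lambda>x::complex. v * exp x)" for v
      by (intro ck_on_bilinear[OF bounded_bilinear_mult] ck_on_const) (simp_all add: Suc)
  qed simp
qed

text \<open>The rules for \<open>C\<^sup>k\<close> maps, restated for smooth maps.\<close>

lemma smooth_on_cong:
  "open S \<Longrightarrow> smooth_on S f \<Longrightarrow> (\<And>x. x \<in> S \<Longrightarrow> f x = g x) \<Longrightarrow> smooth_on S g"
  unfolding smooth_on_def using ck_on_cong by blast

lemma smooth_on_subset: "smooth_on S f \<Longrightarrow> T \<subseteq> S \<Longrightarrow> smooth_on T f"
  unfolding smooth_on_def using ck_on_subset by blast

lemma smooth_on_has_derivative:
  "smooth_on S f \<Longrightarrow> x \<in> S \<Longrightarrow> (f has_derivative frechet_derivative f (at x)) (at x)"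
  unfolding smooth_on_def using ck_on_has_derivative by blast

lemma smooth_on_derivative: "smooth_on S f \<Longrightarrow> smooth_on S (\<lambda>x. frechet_derivative f (at x) v)"
  unfolding smooth_on_def by (metis ck_on.simps(2))

lemma smooth_on_continuous: "smooth_on S f \<Longrightarrow> continuous_on S f"
  unfolding smooth_on_def by (metis ck_on.simps(1))

lemma smooth_on_const: "smooth_on S (\<lambda>x. c)"
  unfolding smooth_on_def using ck_on_const by blast

lemma smooth_on_id: "open S \<Longrightarrow> smooth_on S (\<lambda>x. x)"
  unfolding smooth_on_def using ck_on_id by blast

lemma smooth_on_bounded_linear:
  "bounded_linear L \<Longrightarrow> open S \<Longrightarrow> smooth_on S f \<Longrightarrow> smooth_on S (\<lambda>x. L (f x))"
  unfolding smooth_on_def using ck_on_bounded_linear by blast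

lemma smooth_on_linear:
  "bounded_linear L \<Longrightarrow> open S \<Longrightarrow> smooth_on S L"
  using smooth_on_bounded_linear[OF _ _ smooth_on_id] by blast

lemma smooth_on_add:
  "open S \<Longrightarrow> smooth_on S f \<Longrightarrow> smooth_on S g \<Longrightarrow> smooth_on S (\<lambda>x. f x + g x)"
  unfolding smooth_on_def using ck_on_add by blast

lemma smooth_on_minus:
  "open S \<Longrightarrow> smooth_on S f \<Longrightarrow> smooth_on S (\<lambda>x. - f x)"
  by (rule smooth_on_bounded_linear[OF bounded_linear_minus[OF bounded_linear_ident]])

lemma smooth_on_diff:
  "open S \<Longrightarrow> smooth_on S f \<Longrightarrow> smooth_on S g \<Longrightarrow> smooth_on S (\<lambda>x. f x - g x)"
  using smooth_on_add[OF _ _ smooth_on_minus, of S f g] by simp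

lemma smooth_on_bilinear:
  "bounded_bilinear B \<Longrightarrow> open S \<Longrightarrow> smooth_on S f \<Longrightarrow> smooth_on S g \<Longrightarrow> smooth_on S (\<lambda>x. B (f x) (g x))"
  unfolding smooth_on_def using ck_on_bilinear by blast

lemmas smooth_on_mult = smooth_on_bilinear[OF bounded_bilinear_mult]
lemmas smooth_on_scaleR = smooth_on_bilinear[OF bounded_bilinear_scaleR]
lemmas smooth_on_inner = smooth_on_bilinear[OF bounded_bilinear_inner]

lemma smooth_on_compose:
  fixes f :: "'a::real_normed_vector \<Rightarrow> 'b::euclidean_space" and g :: "'b \<Rightarrow> 'c::real_normed_vector"
  shows "open S \<Longrightarrow> smooth_on S f \<Longrightarrow> f ` S \<subseteq> T \<Longrightarrow> smooth_on T g \<Longrightarrow> smooth_on S (\<lambda>x. g (f x))"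
  unfolding smooth_on_def using ck_on_compose by blast

lemma smooth_on_inverse:
  fixes f :: "'a::real_normed_vector \<Rightarrow> real"
  assumes "open S" "smooth_on S f" "\<And>x. x \<in> S \<Longrightarrow> f x \<noteq> 0"
  shows "smooth_on S (\<lambda>x. inverse (f x))"
  by (rule smooth_on_compose[of S f "- {0}"]) (use assms in \<open>auto simp: smooth_on_def ck_on_inverse_aux\<close>)

lemma smooth_on_cis:
  fixes f :: "'a::real_normed_vector \<Rightarrow> real"
  assumes "open S" "smooth_on S f"
  shows "smooth_on S (\<lambda>x. cis (f x))"
proof -
  have "smooth_on S (\<lambda>x. exp (f x *\<^sub>R \<i>))"
    by (rule smooth_on_compose[of S _ UNIV])
       (use assms in \<open>auto simp: smooth_on_def ck_on_exp intro!: ck_on_bilinear[OF bounded_bilinear_scaleR] ck_on_const\<close>)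
  then show ?thesis by (simp add: cis_conv_exp scaleR_conv_of_real mult.commute)
qed

lemma smooth_on_scaleR_left: "open S \<Longrightarrow> smooth_on S f \<Longrightarrow> smooth_on S (\<lambda>x. c *\<^sub>R f x)"
  by (intro smooth_on_scaleR smooth_on_const)

section \<open>Four-dimensional linear algebra\<close>

lemma det_4:
  "det (A::'a::comm_ring_1^4^4) =
    A$1$1 * (A$2$2 * A$3$3 * A$4$4 + A$2$3 * A$3$4 * A$4$2 + A$2$4 * A$3$2 * A$4$3
           - A$2$2 * A$3$4 * A$4$3 - A$2$3 * A$3$2 * A$4$4 - A$2$4 * A$3$3 * A$4$2)
  - A$1$2 * (A$2$1 * A$3$3 * A$4$4 + A$2$3 * A$3$4 * A$4$1 + A$2$4 * A$3$1 * A$4$3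
           - A$2$1 * A$3$4 * A$4$3 - A$2$3 * A$3$1 * A$4$4 - A$2$4 * A$3$3 * A$4$1)
  + A$1$3 * (A$2$1 * A$3$2 * A$4$4 + A$2$2 * A$3$4 * A$4$1 + A$2$4 * A$3$1 * A$4$2
           - A$2$1 * A$3$4 * A$4$2 - A$2$2 * A$3$1 * A$4$4 - A$2$4 * A$3$2 * A$4$1)
  - A$1$4 * (A$2$1 * A$3$2 * A$4$3 + A$2$2 * A$3$3 * A$4$1 + A$2$3 * A$3$1 * A$4$2
           - A$2$1 * A$3$3 * A$4$2 - A$2$2 * A$3$1 * A$4$3 - A$2$3 * A$3$2 * A$4$1)"
proof -
  have f1: "finite {2::4, 3, 4}" "1 \<notin> {2::4, 3, 4}" by auto
  have f2: "finite {3::4, 4}" "2 \<notin> {3::4, 4}" by auto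
  have f3: "finite {4::4}" "3 \<notin> {4::4}" by auto
  show ?thesis
    unfolding det_def UNIV_4
    unfolding sum_over_permutations_insert[OF f1]
    unfolding sum_over_permutations_insert[OF f2]
    unfolding sum_over_permutations_insert[OF f3]
    unfolding permutes_sing
    by (simp add: sign_swap_id permutation_swap_id sign_compose sign_id swap_id_eq permutation_compose algebra_simps)
qed

lemma orient4_matrix_mult:
  "orient4 (A *v a) (A *v b) (A *v c) (A *v d) = det A * orient4 a b c d"
proof -
  let ?M = "(\<chi> i. if i = 1 then a else if i = 2 then b else if i = 3 then c else d) :: real^4^4"
  have "(\<chi> i. if i = 1 then A *v a else if i = 2 then A *v b else if i = 3 then A *v c else A *v d)
      = ?M ** transpose A"
    by (simp add: vec_eq_iff matrix_matrix_mult_def matrix_vector_mult_def transpose_def forall_4 sum_4 mult.commute)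
  then show ?thesis by (simp add: orient4_def det_mul mult.commute)
qed

lemma matrix_inv_mult_vector:
  fixes A :: "real^'n^'n"
  assumes "det A \<noteq> 0"
  shows "matrix_inv A *v (A *v x) = x"
proof -
  have "invertible A" using assms by (simp add: invertible_det_nz)
  then have "matrix_inv A ** A = mat 1"
    unfolding invertible_def matrix_inv_def by (rule someI2_ex) simp
  then show ?thesis by (simp add: matrix_vector_mul_assoc)
qed

text \<open>The identification of \<open>\<complex> \<times> \<complex>\<close> with \<open>\<real>\<^sup>4\<close> that turns \<open>J_std\<close> into multiplication by \<open>\<i>\<close>.\<close>

definition cpair :: "complex \<Rightarrow> complex \<Rightarrow> real^4" where
  "cpair u v = (\<chi> i. if i = 1 then Re u else if i = 2 then Im u else if i = 3 then Re v else Im v)"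

definition cfst :: "real^4 \<Rightarrow> complex" where "cfst x = Complex (x $ 1) (x $ 2)"

definition csnd :: "real^4 \<Rightarrow> complex" where "csnd x = Complex (x $ 3) (x $ 4)"

lemma cpair_nth [simp]:
  "cpair u v $ 1 = Re u" "cpair u v $ 2 = Im u" "cpair u v $ 3 = Re v" "cpair u v $ 4 = Im v"
  by (simp_all add: cpair_def)

lemma cfst_cpair [simp]: "cfst (cpair u v) = u" and csnd_cpair [simp]: "csnd (cpair u v) = v"
  by (simp_all add: cfst_def csnd_def complex_eq_iff)

lemma cpair_cfst_csnd [simp]: "cpair (cfst x) (csnd x) = x"
  by (simp add: vec_eq_iff forall_4 cfst_def csnd_def)

lemma real4_eq_iff: "x = y \<longleftrightarrow> cfst x = cfst y \<and> csnd x = csnd y"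
  by (metis cpair_cfst_csnd)

lemma inner_cfst_csnd: "x \<bullet> y = cfst x \<bullet> cfst y + csnd x \<bullet> csnd y"
  by (simp add: inner_vec_def sum_4 cfst_def csnd_def inner_complex_def)

lemma norm_cfst_csnd: "(norm x)\<^sup>2 = (cmod (cfst x))\<^sup>2 + (cmod (csnd x))\<^sup>2"
  by (simp add: power2_norm_eq_inner inner_cfst_csnd)

lemma norm_cfst_le: "cmod (cfst x) \<le> norm x"
  by (rule power2_le_imp_le) (simp_all add: norm_cfst_csnd)

lemma norm_cpair_0 [simp]: "norm (cpair u 0) = cmod u"
proof -
  have "(norm (cpair u 0))\<^sup>2 = (cmod u)\<^sup>2" by (simp add: norm_cfst_csnd)
  then show ?thesis by (simp add: power2_eq_iff_nonneg)
qed

lemma J_std_cpair: "J_std x = cpair (\<i> * cfst x) (\<i> * csnd x)"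
  by (simp add: vec_eq_iff forall_4 J_std_def cfst_def csnd_def)

lemma bounded_linear_cfst: "bounded_linear cfst" and bounded_linear_csnd: "bounded_linear csnd"
  and bounded_linear_cpair1: "bounded_linear (\<lambda>u. cpair u 0)"
  and bounded_linear_cpair2: "bounded_linear (\<lambda>v. cpair 0 v)"
  by (auto intro!: linear_conv_bounded_linear[THEN iffD1] linearI
      simp: vec_eq_iff forall_4 cfst_def csnd_def complex_eq_iff)

lemma linear_J_std: "linear J_std"
  by (auto intro!: linearI simp: vec_eq_iff forall_4 J_std_def)

lemma cpair_split: "cpair u v = cpair u 0 + cpair 0 v"
  by (simp add: real4_eq_iff bounded_linear.linear[OF bounded_linear_cfst, THEN linear_add]
      bounded_linear.linear[OF bounded_linear_csnd, THEN linear_add])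

lemma norm_J_std: "norm (J_std x) = norm x"
proof -
  have "(norm (J_std x))\<^sup>2 = (norm x)\<^sup>2" by (simp add: norm_cfst_csnd J_std_cpair norm_mult)
  then show ?thesis by (simp add: power2_eq_iff_nonneg)
qed

text \<open>
  The three bilinear forms that control the curve: \<open>x \<bullet> y\<close> measures the growth of the distance to the
  origin, \<open>J_std x \<bullet> y\<close> transversality to the contact planes, and \<open>angle_form x y\<close> the rotation of the
  first complex coordinate. All three are bounded by the product of the norms, which is what \<open>unit_form\<close>
  expresses.
\<close>

definition angle_form :: "real^4 \<Rightarrow> real^4 \<Rightarrow> real" where
  "angle_form x y = Im (cnj (cfst x) * cfst y)"

definition unit_form :: "(real^4 \<Rightarrow> real^4 \<Rightarrow> real) \<Rightarrow> bool" where
  "unit_form Q \<longleftrightarrow> bilinear Q \<and> (\<forall>x y. \<bar>Q x y\<bar> \<le> norm x * norm y)"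

lemma unit_form_inner: "unit_form (\<lambda>x y. x \<bullet> y)"
  by (simp add: unit_form_def bilinear_conv_bounded_bilinear bounded_bilinear_inner Cauchy_Schwarz_ineq2)

lemma unit_form_J: "unit_form (\<lambda>x y. J_std x \<bullet> y)"
proof -
  have "\<bar>J_std x \<bullet> y\<bar> \<le> norm x * norm y" for x y
    using Cauchy_Schwarz_ineq2[of "J_std x" y] by (simp add: norm_J_std)
  moreover have "bilinear (\<lambda>x y. J_std x \<bullet> y)"
    unfolding bilinear_def using linear_J_std
    by (auto intro!: linearI simp: linear_add linear_scale inner_add_left inner_add_right)
  ultimately show ?thesis by (simp add: unit_form_def)
qed

lemma unit_form_angle: "unit_form angle_form"
proof -
  have "\<bar>angle_form x y\<bar> \<le> norm x * norm y" for x y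
  proof -
    have "\<bar>angle_form x y\<bar> \<le> cmod (cfst x) * cmod (cfst y)"
      unfolding angle_form_def using abs_Im_le_cmod[of "cnj (cfst x) * cfst y"] by (simp add: norm_mult)
    also have "\<dots> \<le> norm x * norm y" by (intro mult_mono norm_cfst_le) auto
    finally show ?thesis .
  qed
  moreover have "bilinear angle_form"
    unfolding bilinear_def angle_form_def
    by (auto intro!: linearI simp: cfst_def algebra_simps)
  ultimately show ?thesis by (simp add: unit_form_def)
qed

section \<open>An implicit function theorem\<close>

lemma smooth_on_Pair:
  fixes f :: "'a::real_normed_vector \<Rightarrow> 'b::real_normed_vector" and g :: "'a \<Rightarrow> 'c::real_normed_vector"
  assumes "open S" "smooth_on S f" "smooth_on S g"
  shows "smooth_on S (\<lambda>x. (f x, g x))"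
proof -
  have "smooth_on S (\<lambda>x. (f x, 0) + (0, g x))"
    by (intro smooth_on_add smooth_on_bounded_linear[where L = "\<lambda>u. (u, 0)"]
          smooth_on_bounded_linear[where L = "\<lambda>u. (0, u)"]
          bounded_linear_Pair bounded_linear_ident bounded_linear_zero assms)
  then show ?thesis by simp
qed

text \<open>
  If \<open>m (q (y, t), t) = y\<close> and \<open>m\<close> has a nonvanishing derivative in its first variable, then \<open>q\<close> is smooth.
  The inverse function theorem applied to \<open>(r, t) \<mapsto> (m (r, t), t)\<close> yields the differential of \<open>q\<close>, whose
  formula is a smooth expression in \<open>q\<close> itself; hence the order of differentiability of \<open>q\<close>
  can be raised indefinitely.
\<close>

lemma smooth_implicit_solution:
  fixes m q :: "real \<times> real \<Rightarrow> real"
  assumes S: "open S" and m: "smooth_on S m" and P: "open P"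
    and nz: "\<And>x. x \<in> S \<Longrightarrow> frechet_derivative m (at x) (1, 0) \<noteq> 0"
    and left: "\<And>r t. (r, t) \<in> S \<Longrightarrow> q (m (r, t), t) = r"
    and right: "\<And>y t. (y, t) \<in> P \<Longrightarrow> (q (y, t), t) \<in> S \<and> m (q (y, t), t) = y"
  shows "smooth_on P q"
proof -
  define mr where "mr x = frechet_derivative m (at x) (1, 0)" for x
  define mt where "mt x = frechet_derivative m (at x) (0, 1)" for x
  define \<Phi> where "\<Phi> x = (m x, snd x)" for x
  define \<Psi> where "\<Psi> y = (q y, snd y)" for y
  have mr: "smooth_on S mr" and mt: "smooth_on S mt"
    unfolding mr_def mt_def by (rule smooth_on_derivative[OF m])+
  have Dm: "(m has_derivative (\<lambda>h. mr x * fst h + mt x * snd h)) (at x)" if "x \<in> S" for x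
  proof -
    have D: "(m has_derivative frechet_derivative m (at x)) (at x)"
      by (rule smooth_on_has_derivative[OF m that])
    interpret bounded_linear "frechet_derivative m (at x)" using D by (rule has_derivative_bounded_linear)
    have "frechet_derivative m (at x) h = mr x * fst h + mt x * snd h" for h
    proof -
      have "h = fst h *\<^sub>R (1, 0) + snd h *\<^sub>R (0, 1)" by (simp add: prod_eq_iff)
      then have "frechet_derivative m (at x) h = frechet_derivative m (at x) (fst h *\<^sub>R (1, 0) + snd h *\<^sub>R (0, 1))"
        by simp
      then show ?thesis unfolding add scaleR mr_def mt_def by simp
    qed
    then have "frechet_derivative m (at x) = (\<lambda>h. mr x * fst h + mt x * snd h)" by (rule ext)
    then show ?thesis using D by simp
  qed
  have \<Psi>S: "\<Psi> y \<in> S" and \<Phi>\<Psi>: "\<Phi> (\<Psi> y) = y" if "y \<in> P" for y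
    using right[of "fst y" "snd y"] that by (auto simp: \<Psi>_def \<Phi>_def prod_eq_iff)
  have D\<Psi>: "(\<Psi> has_derivative (\<lambda>h. ((fst h - mt (\<Psi> y) * snd h) * inverse (mr (\<Psi> y)), snd h))) (at y)"
    if y: "y \<in> P" for y
  proof (rule has_derivative_inverse_strong_x[OF S])
    show "continuous_on S \<Phi>"
      unfolding \<Phi>_def by (intro continuous_intros smooth_on_continuous m)
    show "(\<Phi> has_derivative (\<lambda>h. (mr (\<Psi> y) * fst h + mt (\<Psi> y) * snd h, snd h))) (at (\<Psi> y))"
      unfolding \<Phi>_def by (intro derivative_intros Dm \<Psi>S y)
    have "mr (\<Psi> y) \<noteq> 0" unfolding mr_def by (rule nz[OF \<Psi>S[OF y]])
    then show "(\<lambda>h. (mr (\<Psi> y) * fst h + mt (\<Psi> y) * snd h, snd h)) \<circ>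
        (\<lambda>h. ((fst h - mt (\<Psi> y) * snd h) * inverse (mr (\<Psi> y)), snd h)) = id"
      by (auto simp: fun_eq_iff field_simps)
  qed (use y \<Psi>S \<Phi>\<Psi> left in \<open>auto simp: \<Phi>_def \<Psi>_def\<close>)
  have Dq: "(q has_derivative (\<lambda>h. (fst h - mt (\<Psi> y) * snd h) * inverse (mr (\<Psi> y)))) (at y)" if "y \<in> P" for y
    using has_derivative_fst[OF D\<Psi>[OF that]] by (simp add: \<Psi>_def)
  have "ck_on k P q" for k
  proof (induction k)
    case 0
    have "isCont q y" if "y \<in> P" for y using Dq[OF that] by (rule has_derivative_continuous)
    then show ?case by (simp add: continuous_at_imp_continuous_on)
  next
    case (Suc k)
    have \<Psi>: "ck_on k P \<Psi>"
    proof -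
      have snd: "ck_on k P (snd :: real \<times> real \<Rightarrow> real)"
        by (rule ck_on_bounded_linear[OF bounded_linear_snd P ck_on_id[OF P]])
      have "ck_on k P (\<lambda>y. (q y, 0) + (0, snd y))"
        by (intro ck_on_add P ck_on_bounded_linear[where L = "\<lambda>u. (u, 0)"]
              ck_on_bounded_linear[where L = "\<lambda>u. (0, u)"]
              bounded_linear_Pair bounded_linear_ident bounded_linear_zero Suc snd)
      then show ?thesis by (simp add: \<Psi>_def[abs_def])
    qed
    have comp: "ck_on k P (\<lambda>y. g (\<Psi> y))" if "smooth_on S g" for g :: "real \<times> real \<Rightarrow> real"
      by (rule ck_on_compose[OF P \<Psi>, of S]) (use that \<Psi>S in \<open>auto simp: smooth_on_def\<close>)
    have inv: "smooth_on S (\<lambda>x. inverse (mr x))"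
      by (rule smooth_on_inverse[OF S mr]) (simp add: mr_def nz)
    show ?case
    proof (rule ck_on_SucI[OF P Dq])
      fix v :: "real \<times> real"
      have "smooth_on S (\<lambda>x. (fst v - mt x * snd v) * inverse (mr x))"
        by (intro smooth_on_mult smooth_on_diff smooth_on_const S mt inv)
      then show "ck_on k P (\<lambda>y. (fst v - mt (\<Psi> y) * snd v) * inverse (mr (\<Psi> y)))"
        by (rule comp)
    qed
  qed
  then show ?thesis by (simp add: smooth_on_def)
qed

section \<open>Germs close to a complex monomial\<close>

text \<open>
  A smooth injective map near \<open>0\<close> whose differential is close to that of \<open>w \<mapsto> (a w\<^sup>N, 0)\<close>; the relative error
  \<open>1/16\<close> is small enough for all the estimates below.
\<close>

locale branched_germ =
  fixes F :: "complex \<Rightarrow> real^4" and a :: complex and N :: nat and R :: real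
  assumes R_pos: "R > 0" and N_pos: "N \<ge> 1" and a_nz: "a \<noteq> 0"
    and smooth: "smooth_on (ball 0 R) F" and F_0: "F 0 = 0" and inj: "inj_on F (ball 0 R)"
    and deriv_near: "\<And>w v. w \<in> ball 0 R \<Longrightarrow> w \<noteq> 0 \<Longrightarrow>
      norm (frechet_derivative F (at w) v - cpair (of_nat N * a * w ^ (N - 1) * v) 0)
        \<le> cmod a / 16 * cmod w ^ (N - 1) * cmod v"
begin

abbreviation DF :: "complex \<Rightarrow> complex \<Rightarrow> real^4" where
  "DF w \<equiv> frechet_derivative F (at w)"

lemma F_deriv: "w \<in> ball 0 R \<Longrightarrow> (F has_derivative DF w) (at w)"
  by (rule smooth_on_has_derivative[OF smooth])

lemma DF_linear: "w \<in> ball 0 R \<Longrightarrow> linear (DF w)"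
  using F_deriv has_derivative_linear by blast

text \<open>The estimate on the derivative integrates along rays from the origin.\<close>

lemma value_near:
  assumes w: "w \<in> ball 0 R"
  shows "norm (F w - cpair (a * w ^ N) 0) \<le> cmod a / 16 * cmod w ^ N"
proof (cases "w = 0")
  case True
  have "cpair 0 0 = 0" by (simp add: real4_eq_iff cfst_def csnd_def complex_eq_iff)
  then show ?thesis using True N_pos F_0 by (simp add: power_0_left)
next
  case False
  define g where "g s = F (of_real s * w) - cpair (a * (of_real s * w) ^ N) 0" for s :: real
  define g' where "g' s h = h *\<^sub>R (DF (of_real s * w) w - cpair (of_nat N * a * (of_real s * w) ^ (N - 1) * w) 0)"
    for s h :: real
  have ball: "of_real s * w \<in> ball 0 R" if "0 \<le> s" "s \<le> 1" for s
  proof -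
    have "cmod (of_real s * w) \<le> 1 * cmod w" unfolding norm_mult using that by (intro mult_right_mono) auto
    then show ?thesis using w by simp
  qed
  have der: "(g has_derivative g' s) (at s)" if "0 \<le> s" "s \<le> 1" for s
  proof -
    have 1: "((\<lambda>s. of_real s * w) has_derivative (\<lambda>h. of_real h * w)) (at s)"
      by (auto intro!: derivative_eq_intros)
    have 2: "((\<lambda>s. F (of_real s * w)) has_derivative (\<lambda>h. DF (of_real s * w) (of_real h * w))) (at s)"
      by (rule has_derivative_compose[OF 1 F_deriv[OF ball[OF that]]])
    have 3: "((\<lambda>s. a * (of_real s * w) ^ N) has_derivative
        (\<lambda>h. of_nat N * a * (of_real s * w) ^ (N - 1) * (of_real h * w))) (at s)"
      by (rule has_derivative_eq_rhs, (rule derivative_intros 1)+) (auto simp: fun_eq_iff algebra_simps)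
    have 4: "((\<lambda>s. cpair (a * (of_real s * w) ^ N) 0) has_derivative
        (\<lambda>h. cpair (of_nat N * a * (of_real s * w) ^ (N - 1) * (of_real h * w)) 0)) (at s)"
      by (rule bounded_linear.has_derivative[OF bounded_linear_cpair1 3])
    have "DF (of_real s * w) (of_real h * w) - cpair (of_nat N * a * (of_real s * w) ^ (N - 1) * (of_real h * w)) 0 = g' s h" for h
    proof -
      have "of_real h * w = h *\<^sub>R w" "of_nat N * a * (of_real s * w) ^ (N - 1) * (of_real h * w)
         = h *\<^sub>R (of_nat N * a * (of_real s * w) ^ (N - 1) * w)" by (simp_all add: scaleR_conv_of_real)
      then show ?thesis unfolding g'_def
        by (simp only: linear_scale[OF DF_linear[OF ball[OF that]]]
            linear_scale[OF bounded_linear.linear[OF bounded_linear_cpair1]] scaleR_diff_right)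
    qed
    then show ?thesis using has_derivative_diff[OF 2 4] unfolding g_def by simp
  qed
  have "\<exists>s\<in>{0<..<1}. norm (g 1 - g 0) \<le> norm (g' s (1 - 0))"
  proof (rule mvt_general)
    show "continuous_on {0..1} g"
      by (rule continuous_at_imp_continuous_on) (use der has_derivative_continuous in force)
  qed (use der in auto)
  then obtain s where s: "0 < s" "s < 1" "norm (g 1 - g 0) \<le> norm (g' s 1)" by auto
  have "norm (g' s 1) \<le> cmod a / 16 * cmod (of_real s * w) ^ (N - 1) * cmod w"
    unfolding g'_def using deriv_near[OF ball, of s w] s False by simp
  also have "\<dots> \<le> cmod a / 16 * cmod w ^ (N - 1) * cmod w"
  proof -
    have "cmod (of_real s * w) \<le> 1 * cmod w" unfolding norm_mult using s by (intro mult_right_mono) auto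
    then show ?thesis by (intro mult_left_mono mult_right_mono power_mono) auto
  qed
  also have "\<dots> = cmod a / 16 * cmod w ^ N"
    using N_pos by (cases N) auto
  finally have "norm (g 1 - g 0) \<le> cmod a / 16 * cmod w ^ N" using s(3) by simp
  moreover have "g 0 = 0"
    using N_pos F_0 by (simp add: g_def power_0_left real4_eq_iff cfst_def csnd_def complex_eq_iff)
  ultimately show ?thesis by (simp add: g_def)
qed

lemma norm_F_bounds:
  assumes "w \<in> ball 0 R"
  shows "15/16 * cmod a * cmod w ^ N \<le> norm (F w)" "norm (F w) \<le> 17/16 * cmod a * cmod w ^ N"
proof -
  have "norm (cpair (a * w ^ N) 0) = cmod a * cmod w ^ N" by (simp add: norm_mult norm_power)
  then show "15/16 * cmod a * cmod w ^ N \<le> norm (F w)" "norm (F w) \<le> 17/16 * cmod a * cmod w ^ N"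
    using value_near[OF assms] norm_triangle_ineq2[of "cpair (a * w ^ N) 0" "F w"]
      norm_triangle_ineq2[of "F w" "cpair (a * w ^ N) 0"]
    by (simp_all add: norm_minus_commute)
qed

lemma F_nz: "w \<in> ball 0 R \<Longrightarrow> w \<noteq> 0 \<Longrightarrow> F w \<noteq> 0"
  using inj F_0 R_pos by (metis centre_in_ball inj_onD)

lemma cfst_F_near:
  assumes "w \<in> ball 0 R"
  shows "cmod (cfst (F w) - a * w ^ N) \<le> cmod a / 16 * cmod w ^ N"
proof -
  have "cfst (F w - cpair (a * w ^ N) 0) = cfst (F w) - a * w ^ N"
    by (simp add: linear_diff[OF bounded_linear.linear[OF bounded_linear_cfst]])
  then show ?thesis using norm_cfst_le[of "F w - cpair (a * w ^ N) 0"] value_near[OF assms] by simp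
qed

lemma cfst_F_nz: "w \<in> ball 0 R \<Longrightarrow> w \<noteq> 0 \<Longrightarrow> cfst (F w) \<noteq> 0"
  using cfst_F_near[of w] a_nz by (auto simp: norm_mult norm_power)

text \<open>
  The value, for the monomial, of the radial form in the direction \<open>w\<close> and of the other two forms in the
  direction \<open>\<i> w\<close>; the remaining values are \<open>0\<close>.
\<close>

definition scale :: "complex \<Rightarrow> real" where
  "scale w = of_nat N * (cmod a)\<^sup>2 * (cmod w ^ N)\<^sup>2"

lemma scale_pos: "w \<noteq> 0 \<Longrightarrow> scale w > 0"
  using N_pos a_nz by (simp add: scale_def)

lemma form_near:
  assumes Q: "unit_form Q" and w: "w \<in> ball 0 R" "w \<noteq> 0" and \<zeta>: "cmod \<zeta> = 1"
  shows "\<bar>Q (F w) (DF w (\<zeta> * w)) - Q (cpair (a * w ^ N) 0) (cpair (of_nat N * \<zeta> * (a * w ^ N)) 0)\<bar>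
      \<le> scale w / 4"
proof -
  define u where "u = cpair (a * w ^ N) 0"
  define v where "v = cpair (of_nat N * \<zeta> * (a * w ^ N)) 0"
  define k where "k = cmod a * cmod w ^ N"
  have k: "k > 0" using a_nz w by (simp add: k_def)
  have bil: "bilinear Q" and le: "\<And>x y. \<bar>Q x y\<bar> \<le> norm x * norm y" using Q by (auto simp: unit_form_def)
  have Fu: "norm (F w - u) \<le> k / 16" using value_near[OF w(1)] by (simp add: u_def k_def)
  have nu: "norm u = k" by (simp add: u_def k_def norm_mult norm_power)
  have Nk: "k \<le> of_nat N * k" using N_pos k by (simp add: mult_le_cancel_right1)
  have nv: "norm v = of_nat N * k" using \<zeta> by (simp add: v_def k_def norm_mult norm_power)
  have pow: "w ^ (N - 1) * w = w ^ N" "cmod w ^ (N - 1) * cmod w = cmod w ^ N"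
    using N_pos by (cases N; simp)+
  have "norm (DF w (\<zeta> * w) - v) \<le> k / 16"
  proof -
    have "cpair (of_nat N * a * w ^ (N - 1) * (\<zeta> * w)) 0 = v"
      unfolding v_def pow(1)[symmetric] by (simp add: ac_simps)
    moreover have "cmod a / 16 * cmod w ^ (N - 1) * cmod (\<zeta> * w) = k / 16"
      using \<zeta> unfolding k_def pow(2)[symmetric] by (simp add: norm_mult)
    ultimately show ?thesis using deriv_near[OF w, of "\<zeta> * w"] by simp
  qed
  note Dv = this
  have "Q (F w) (DF w (\<zeta> * w)) - Q u v = Q (F w - u) v + Q (F w) (DF w (\<zeta> * w) - v)"
    by (simp add: bilinear_lsub[OF bil] bilinear_rsub[OF bil])
  then have "\<bar>Q (F w) (DF w (\<zeta> * w)) - Q u v\<bar> \<le> norm (F w - u) * norm v + norm (F w) * norm (DF w (\<zeta> * w) - v)"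
    using le[of "F w - u" v] le[of "F w" "DF w (\<zeta> * w) - v"] by linarith
  also have "\<dots> \<le> k / 16 * (of_nat N * k) + (17/16 * k) * (k / 16)"
    unfolding nv using norm_F_bounds(2)[OF w(1)] Fu Dv k by (intro add_mono mult_mono) (auto simp: k_def)
  also have "\<dots> \<le> (of_nat N * k) * k / 4"
  proof -
    have "k * k \<le> (of_nat N * k) * k" using Nk k by (intro mult_right_mono) auto
    moreover have "(of_nat N * k) * k \<ge> 0" using k by simp
    ultimately show ?thesis by (simp add: field_simps)
  qed
  also have "\<dots> = scale w / 4" by (simp add: scale_def k_def power2_eq_square)
  finally show ?thesis by (simp add: u_def v_def)
qed

lemma radial_form:
  assumes "w \<in> ball 0 R" "w \<noteq> 0"
  shows "F w \<bullet> DF w w \<ge> 3/4 * scale w" "\<bar>F w \<bullet> DF w (\<i> * w)\<bar> \<le> scale w / 4"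
proof -
  have *: "cpair u 0 \<bullet> cpair (of_nat N * \<zeta> * u) 0 = of_nat N * Re \<zeta> * (cmod u)\<^sup>2" for u \<zeta>
    unfolding inner_cfst_csnd cmod_power2 by (simp add: inner_complex_def power2_eq_square algebra_simps)
  have "of_nat N * (cmod (a * w ^ N))\<^sup>2 = scale w" by (simp add: scale_def norm_mult norm_power power_mult_distrib)
  then have "\<bar>F w \<bullet> DF w w - scale w\<bar> \<le> scale w / 4" and 2: "\<bar>F w \<bullet> DF w (\<i> * w)\<bar> \<le> scale w / 4"
    using form_near[OF unit_form_inner assms, of 1] form_near[OF unit_form_inner assms, of \<i>]
    unfolding * by auto
  then show "F w \<bullet> DF w w \<ge> 3/4 * scale w" by linarith
  show "\<bar>F w \<bullet> DF w (\<i> * w)\<bar> \<le> scale w / 4" by (rule 2)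
qed

lemma turning_form:
  assumes w: "w \<in> ball 0 R" "w \<noteq> 0" and Q: "Q = (\<lambda>x y. J_std x \<bullet> y) \<or> Q = angle_form"
    and \<kappa>: "\<bar>\<kappa>\<bar> \<le> 1/3"
  shows "Q (F w) (DF w ((of_real \<kappa> + \<i>) * w)) > 0"
proof -
  have uQ: "unit_form Q" using Q unit_form_J unit_form_angle by auto
  have *: "Q (cpair u 0) (cpair (of_nat N * \<zeta> * u) 0) = of_nat N * Im \<zeta> * (cmod u)\<^sup>2" for u \<zeta>
    using Q unfolding inner_cfst_csnd cmod_power2 J_std_cpair angle_form_def
    by (auto simp: inner_complex_def power2_eq_square algebra_simps)
  have "of_nat N * (cmod (a * w ^ N))\<^sup>2 = scale w" by (simp add: scale_def norm_mult norm_power power_mult_distrib)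
  then have 1: "\<bar>Q (F w) (DF w w)\<bar> \<le> scale w / 4" and "\<bar>Q (F w) (DF w (\<i> * w)) - scale w\<bar> \<le> scale w / 4"
    using form_near[OF uQ w, of 1] form_near[OF uQ w, of \<i>] unfolding * by auto
  then have 2: "Q (F w) (DF w (\<i> * w)) \<ge> 3/4 * scale w" by linarith
  have "bilinear Q" using uQ by (simp add: unit_form_def)
  moreover have "(of_real \<kappa> + \<i>) * w = \<kappa> *\<^sub>R w + \<i> * w" by (simp add: scaleR_conv_of_real algebra_simps)
  ultimately have "Q (F w) (DF w ((of_real \<kappa> + \<i>) * w)) = \<kappa> * Q (F w) (DF w w) + Q (F w) (DF w (\<i> * w))"
    by (simp only: linear_add[OF DF_linear[OF w(1)]] linear_scale[OF DF_linear[OF w(1)]]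
        bilinear_radd bilinear_rmul real_scaleR_def)
  moreover have "\<bar>\<kappa> * Q (F w) (DF w w)\<bar> \<le> 1/3 * (scale w / 4)"
    unfolding abs_mult using 1 \<kappa> by (intro mult_mono) auto
  ultimately show ?thesis using 2 scale_pos[OF w(2)] by linarith
qed

section \<open>The level curves of the distance\<close>

text \<open>The ray with argument \<open>2 \<pi> t\<close>; angles are normalized so that closed curves have period \<open>1\<close>.\<close>

definition ray :: "real \<Rightarrow> real \<Rightarrow> complex" where
  "ray \<rho> t = of_real \<rho> * cis (2 * pi * t)"

text \<open>A lower bound for \<open>norm (F w)\<close> for \<open>R / 2 \<le> cmod w < R\<close>.\<close>

definition level_bound :: real where
  "level_bound = 15/16 * cmod a * (R / 2) ^ N"

text \<open>
  The radius at which the image under \<open>F\<close> of the ray with argument \<open>2 \<pi> t\<close> reaches distance \<open>\<epsilon>\<close> from the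
  origin, and the closed curve formed by these points.
\<close>

definition rad :: "real \<Rightarrow> real \<Rightarrow> real" where
  "rad \<epsilon> t = (THE \<rho>. 0 < \<rho> \<and> \<rho> < R \<and> norm (F (ray \<rho> t)) = \<epsilon>)"

definition loop :: "real \<Rightarrow> real \<Rightarrow> complex" where
  "loop \<epsilon> t = ray (rad \<epsilon> t) t"

text \<open>The squared distance of the image from the origin, as a function of radius and angle.\<close>

definition sqdist :: "real \<times> real \<Rightarrow> real" where
  "sqdist x = F (ray (fst x) (snd x)) \<bullet> F (ray (fst x) (snd x))"

lemma level_bound_pos: "level_bound > 0"
  using a_nz R_pos by (simp add: level_bound_def)

lemma cmod_ray: "0 \<le> \<rho> \<Longrightarrow> cmod (ray \<rho> t) = \<rho>"
  by (simp add: ray_def norm_mult)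

lemma ray_periodic: "ray \<rho> (t + 1) = ray \<rho> t"
  by (simp add: ray_def distrib_left cis_mult[symmetric])

lemma ray_polar: "\<exists>t. w = ray (cmod w) t"
proof -
  have "w = ray (cmod w) (Arg w / (2 * pi))"
    using rcis_cmod_Arg[of w] by (simp add: ray_def rcis_def)
  then show ?thesis by blast
qed

lemma smooth_on_ray: "smooth_on UNIV (\<lambda>x. ray (fst x) (snd x))"
proof -
  have "smooth_on UNIV (\<lambda>x::real\<times>real. fst x *\<^sub>R cis ((2 * pi) *\<^sub>R snd x))"
    by (intro smooth_on_scaleR smooth_on_cis smooth_on_scaleR_left smooth_on_linear
        bounded_linear_fst bounded_linear_snd open_UNIV)
  then show ?thesis by (simp add: ray_def scaleR_conv_of_real)
qed

lemma smooth_on_sqdist: "smooth_on ({0<..<R} \<times> UNIV) sqdist"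
proof -
  have "smooth_on ({0<..<R} \<times> UNIV) (\<lambda>x. F (ray (fst x) (snd x)))"
    by (rule smooth_on_compose[OF _ smooth_on_subset[OF smooth_on_ray] _ smooth])
       (auto simp: cmod_ray open_Times)
  then show ?thesis unfolding sqdist_def
    by (intro smooth_on_inner) (simp_all add: open_Times)
qed

lemma sqdist_radial_derivative:
  assumes \<rho>: "0 < \<rho>" "\<rho> < R"
  shows "((\<lambda>\<rho>. sqdist (\<rho>, t)) has_real_derivative (2 / \<rho> * (F (ray \<rho> t) \<bullet> DF (ray \<rho> t) (ray \<rho> t)))) (at \<rho>)"
proof -
  have w: "ray \<rho> t \<in> ball 0 R" using \<rho> by (simp add: cmod_ray)
  have 1: "((\<lambda>\<rho>. ray \<rho> t) has_derivative (\<lambda>h. (h / \<rho>) *\<^sub>R ray \<rho> t)) (at \<rho>)"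
    unfolding ray_def using \<rho> by (auto intro!: derivative_eq_intros simp: scaleR_conv_of_real)
  have 2: "((\<lambda>\<rho>. F (ray \<rho> t)) has_derivative (\<lambda>h. (h / \<rho>) *\<^sub>R DF (ray \<rho> t) (ray \<rho> t))) (at \<rho>)"
    using has_derivative_compose[OF 1 F_deriv[OF w]] by (simp add: linear_scale[OF DF_linear[OF w]])
  show ?thesis unfolding sqdist_def has_field_derivative_def
    by (rule has_derivative_eq_rhs, simp, rule has_derivative_inner[OF 2 2])
       (auto simp: fun_eq_iff inner_commute algebra_simps)
qed

lemma sqdist_strict_mono:
  assumes "0 < \<rho>" "\<rho> < \<rho>'" "\<rho>' < R"
  shows "sqdist (\<rho>, t) < sqdist (\<rho>', t)"
proof (rule DERIV_pos_imp_increasing[OF assms(2)])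
  fix x assume "\<rho> \<le> x" "x \<le> \<rho>'"
  then have x: "0 < x" "x < R" using assms by auto
  then have w: "ray x t \<in> ball 0 R" "ray x t \<noteq> 0" using cmod_ray[of x t] by auto
  have "0 < 2 / x * (F (ray x t) \<bullet> DF (ray x t) (ray x t))"
    using radial_form(1)[OF w] scale_pos[OF w(2)] x by (intro mult_pos_pos) auto
  then show "\<exists>y. ((\<lambda>\<rho>. sqdist (\<rho>, t)) has_real_derivative y) (at x) \<and> 0 < y"
    using sqdist_radial_derivative[OF x] by blast
qed

lemma norm_F_eq_iff: "\<epsilon> > 0 \<Longrightarrow> norm (F (ray \<rho> t)) = \<epsilon> \<longleftrightarrow> sqdist (\<rho>, t) = \<epsilon>\<^sup>2"
  unfolding sqdist_def fst_conv snd_conv power2_norm_eq_inner[symmetric]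
  by (auto simp: power2_eq_iff_nonneg)

lemma rad_unique:
  assumes "0 < \<rho>" "\<rho> < R" and "norm (F (ray \<rho> t)) = \<epsilon>"
  shows "rad \<epsilon> t = \<rho>"
proof -
  have "ray \<rho> t \<in> ball 0 R" "ray \<rho> t \<noteq> 0" using cmod_ray[of \<rho> t] assms by auto
  then have \<epsilon>: "\<epsilon> > 0" using F_nz assms(3) by auto
  show ?thesis unfolding rad_def
  proof (rule the_equality)
    fix \<rho>' assume "0 < \<rho>' \<and> \<rho>' < R \<and> norm (F (ray \<rho>' t)) = \<epsilon>"
    then show "\<rho>' = \<rho>"
      using assms sqdist_strict_mono[of \<rho> \<rho>' t] sqdist_strict_mono[of \<rho>' \<rho> t]
      unfolding norm_F_eq_iff[OF \<epsilon>] by (metis less_irrefl linorder_neqE_linordered_idom)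
  qed (use assms in auto)
qed

lemma rad_props:
  assumes \<epsilon>: "0 < \<epsilon>" "\<epsilon> < level_bound"
  shows "0 < rad \<epsilon> t" "rad \<epsilon> t < R" "norm (F (loop \<epsilon> t)) = \<epsilon>"
proof -
  have "\<exists>\<rho>. 0 \<le> \<rho> \<and> \<rho> \<le> R / 2 \<and> norm (F (ray \<rho> t)) = \<epsilon>"
  proof (rule IVT')
    show "norm (F (ray 0 t)) \<le> \<epsilon>" using \<epsilon> by (simp add: ray_def F_0)
    show "\<epsilon> \<le> norm (F (ray (R / 2) t))"
      using norm_F_bounds(1)[of "ray (R / 2) t"] R_pos \<epsilon> by (simp add: cmod_ray level_bound_def)
    show "continuous_on {0..R / 2} (\<lambda>\<rho>. norm (F (ray \<rho> t)))"
    proof (intro continuous_on_norm continuous_on_compose2[OF smooth_on_continuous[OF smooth]])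
      show "continuous_on {0..R / 2} (\<lambda>\<rho>. ray \<rho> t)" unfolding ray_def by (intro continuous_intros)
    qed (use R_pos in \<open>auto simp: cmod_ray\<close>)
  qed (use R_pos in simp)
  then obtain \<rho> where \<rho>: "0 \<le> \<rho>" "\<rho> \<le> R / 2" "norm (F (ray \<rho> t)) = \<epsilon>" by auto
  have "\<rho> \<noteq> 0" using \<rho>(3) \<epsilon> by (auto simp: ray_def F_0)
  then have "0 < \<rho>" "\<rho> < R" using \<rho> R_pos by auto
  then show "0 < rad \<epsilon> t" "rad \<epsilon> t < R" "norm (F (loop \<epsilon> t)) = \<epsilon>"
    using rad_unique[OF _ _ \<rho>(3)] \<rho>(3) by (simp_all add: loop_def)
qed

lemma cmod_loop: "0 < \<epsilon> \<Longrightarrow> \<epsilon> < level_bound \<Longrightarrow> cmod (loop \<epsilon> t) = rad \<epsilon> t"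
  using rad_props(1)[of \<epsilon> t] by (simp add: loop_def cmod_ray)

lemma loop_in_ball: "0 < \<epsilon> \<Longrightarrow> \<epsilon> < level_bound \<Longrightarrow> loop \<epsilon> t \<in> ball 0 R"
  using rad_props(2)[of \<epsilon> t] by (simp add: cmod_loop)

lemma loop_nz: "0 < \<epsilon> \<Longrightarrow> \<epsilon> < level_bound \<Longrightarrow> loop \<epsilon> t \<noteq> 0"
  using rad_props(1)[of \<epsilon> t] cmod_loop[of \<epsilon> t] by auto

lemma loop_periodic: "loop \<epsilon> (t + 1) = loop \<epsilon> t"
  by (simp add: loop_def rad_def ray_periodic)

lemma range_loop:
  assumes \<epsilon>: "0 < \<epsilon>" "\<epsilon> < level_bound"
  shows "range (loop \<epsilon>) = {w \<in> ball 0 R. norm (F w) = \<epsilon>}"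
proof
  show "range (loop \<epsilon>) \<subseteq> {w \<in> ball 0 R. norm (F w) = \<epsilon>}"
    using rad_props(3)[OF \<epsilon>] loop_in_ball[OF \<epsilon>] by auto
  show "{w \<in> ball 0 R. norm (F w) = \<epsilon>} \<subseteq> range (loop \<epsilon>)"
  proof
    fix w assume "w \<in> {w \<in> ball 0 R. norm (F w) = \<epsilon>}"
    then have w: "w \<in> ball 0 R" "norm (F w) = \<epsilon>" by auto
    obtain t where t: "w = ray (cmod w) t" using ray_polar by blast
    have "w \<noteq> 0" using w \<epsilon> F_0 by auto
    then have "rad \<epsilon> t = cmod w" using w t by (intro rad_unique) auto
    then show "w \<in> range (loop \<epsilon>)" using t by (metis loop_def rangeI)
  qed
qed

lemma cis_inj_on: "inj_on (\<lambda>t. cis (2 * pi * t)) {0..<1}"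
proof (rule inj_onI)
  fix s t :: real assume s: "s \<in> {0..<1}" and t: "t \<in> {0..<1}" and eq: "cis (2 * pi * s) = cis (2 * pi * t)"
  then obtain n :: int where n: "2 * pi * s = 2 * pi * t + 2 * pi * n"
    unfolding cis_conv_exp exp_eq by (auto simp: complex_eq_iff)
  then have "2 * pi * (s - t - n) = 0" by (simp add: algebra_simps)
  then have "s = t + n" by simp
  moreover from this have "n = 0" using s t by auto
  ultimately show "s = t" by simp
qed

lemma inj_on_loop:
  assumes \<epsilon>: "0 < \<epsilon>" "\<epsilon> < level_bound"
  shows "inj_on (loop \<epsilon>) {0..<1}"
proof (rule inj_onI)
  fix s t assume st: "s \<in> {0..<1}" "t \<in> {0..<1}" and eq: "loop \<epsilon> s = loop \<epsilon> t"
  then have "rad \<epsilon> s = rad \<epsilon> t" using cmod_loop[OF \<epsilon>] by metis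
  then have "cis (2 * pi * s) = cis (2 * pi * t)"
    using eq rad_props(1)[OF \<epsilon>, of t] by (simp add: loop_def ray_def)
  then show "s = t" using cis_inj_on st by (auto dest: inj_onD)
qed

text \<open>
  The implicit function theorem is applied to the squared distance, which is smooth; \<open>rad\<close> is recovered
  by substituting \<open>\<epsilon>\<^sup>2\<close> for the level.
\<close>

lemma smooth_on_rad: "smooth_on ({0<..<level_bound} \<times> UNIV) (\<lambda>x. rad (fst x) (snd x))"
proof -
  let ?P = "{0<..<level_bound\<^sup>2} \<times> (UNIV :: real set)"
  have o: "open ({0<..<level_bound} \<times> (UNIV :: real set))" by (simp add: open_Times)
  have sqrt: "0 < sqrt y \<and> sqrt y < level_bound" if "y \<in> {0<..<level_bound\<^sup>2}" for y
    using that level_bound_pos by (auto simp: real_less_lsqrt)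
  have q: "smooth_on ?P (\<lambda>x. rad (sqrt (fst x)) (snd x))"
  proof (rule smooth_implicit_solution[OF _ smooth_on_sqdist])
    fix x :: "real \<times> real" assume x: "x \<in> {0<..<R} \<times> UNIV"
    obtain \<rho> t where xe: "x = (\<rho>, t)" by force
    have \<rho>: "0 < \<rho>" "\<rho> < R" using x xe by auto
    then have w: "ray \<rho> t \<in> ball 0 R" "ray \<rho> t \<noteq> 0" using cmod_ray[of \<rho> t] by auto
    have 1: "((\<lambda>\<rho>. (\<rho>, t)) has_derivative (\<lambda>h. (h, 0))) (at \<rho>)"
      by (auto intro!: derivative_eq_intros)
    have "(sqdist has_derivative frechet_derivative sqdist (at x)) (at x)"
      by (rule smooth_on_has_derivative[OF smooth_on_sqdist x])
    then have "((\<lambda>\<rho>. sqdist (\<rho>, t)) has_derivative (\<lambda>h. frechet_derivative sqdist (at x) (h, 0))) (at \<rho>)"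
      using has_derivative_compose[OF 1] xe by blast
    from has_derivative_unique[OF this sqdist_radial_derivative[OF \<rho>, unfolded has_field_derivative_def]]
    have "frechet_derivative sqdist (at x) (1, 0) = 2 / \<rho> * (F (ray \<rho> t) \<bullet> DF (ray \<rho> t) (ray \<rho> t))"
      by (simp add: fun_eq_iff)
    moreover have "0 < 2 / \<rho> * (F (ray \<rho> t) \<bullet> DF (ray \<rho> t) (ray \<rho> t))"
      using radial_form(1)[OF w] scale_pos[OF w(2)] \<rho> by (intro mult_pos_pos) auto
    ultimately show "frechet_derivative sqdist (at x) (1, 0) \<noteq> 0" by (metis less_irrefl)
  next
    fix \<rho> t :: real assume "(\<rho>, t) \<in> {0<..<R} \<times> UNIV"
    then show "rad (sqrt (fst (sqdist (\<rho>, t), t))) (snd (sqdist (\<rho>, t), t)) = \<rho>"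
      by (intro rad_unique) (auto simp: sqdist_def norm_eq_sqrt_inner)
  next
    fix y t :: real assume "(y, t) \<in> ?P"
    then have y: "0 < y" "0 < sqrt y" "sqrt y < level_bound" using sqrt by auto
    show "(rad (sqrt (fst (y, t))) (snd (y, t)), t) \<in> {0<..<R} \<times> UNIV \<and>
        sqdist (rad (sqrt (fst (y, t))) (snd (y, t)), t) = y"
      using rad_props[OF y(2,3), of t] y(1) norm_F_eq_iff[OF y(2), of "rad (sqrt y) t" t]
      by (simp add: loop_def)
  qed (simp_all add: open_Times)
  have "smooth_on ({0<..<level_bound} \<times> UNIV)
      (\<lambda>x. (\<lambda>x. rad (sqrt (fst x)) (snd x)) (fst x * fst x, snd x))"
  proof (rule smooth_on_compose[OF o _ _ q])
    show "smooth_on ({0<..<level_bound} \<times> UNIV) (\<lambda>x::real\<times>real. (fst x * fst x, snd x))"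
      by (rule smooth_on_Pair[OF o smooth_on_mult[OF o smooth_on_linear[OF bounded_linear_fst o]
              smooth_on_linear[OF bounded_linear_fst o]] smooth_on_linear[OF bounded_linear_snd o]])
    have "x * x < level_bound\<^sup>2" if "0 < x" "x < level_bound" for x
      unfolding power2_eq_square using that by (intro mult_strict_mono) auto
    then show "(\<lambda>x::real\<times>real. (fst x * fst x, snd x)) ` ({0<..<level_bound} \<times> UNIV) \<subseteq> ?P"
      by auto
  qed
  then show ?thesis
    by (rule smooth_on_cong[rotated]) (auto simp: open_Times)
qed

lemma smooth_on_loop: "smooth_on ({0<..<level_bound} \<times> UNIV) (\<lambda>x. loop (fst x) (snd x))"
proof -
  have o: "open ({0<..<level_bound} \<times> (UNIV :: real set))" by (simp add: open_Times)
  have "smooth_on ({0<..<level_bound} \<times> UNIV)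
      (\<lambda>x. (\<lambda>y. ray (fst y) (snd y)) (rad (fst x) (snd x), snd x))"
    by (rule smooth_on_compose[OF o _ _ smooth_on_ray])
      (auto intro: smooth_on_Pair[OF o smooth_on_rad smooth_on_linear[OF bounded_linear_snd o]])
  then show ?thesis by (simp add: loop_def)
qed

lemma smooth_on_F_loop: "smooth_on ({0<..<level_bound} \<times> UNIV) (\<lambda>x. F (loop (fst x) (snd x)))"
  by (rule smooth_on_compose[OF _ smooth_on_loop _ smooth]) (use loop_in_ball in \<open>auto simp: open_Times\<close>)

lemma smooth_on_slice:
  assumes "0 < \<epsilon>" "\<epsilon> < level_bound"
    and "smooth_on ({0<..<level_bound} \<times> UNIV) (\<lambda>x. h (fst x) (snd x))"
  shows "smooth_on (UNIV :: real set) (h \<epsilon>)"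
proof -
  have "smooth_on UNIV (\<lambda>t. (\<lambda>x. h (fst x) (snd x)) (\<epsilon>, t))"
    by (rule smooth_on_compose[OF _ _ _ assms(3)])
       (use assms(1,2) in \<open>auto intro!: smooth_on_Pair smooth_on_const smooth_on_id\<close>)
  then show ?thesis by simp
qed

text \<open>
  The velocity of the level curve is nearly \<open>2 \<pi> \<i>\<close> times its position: the radial
  component \<open>\<kappa>\<close> is determined by the constancy of the distance, and the radial form dominates.
\<close>

lemma loop_velocity:
  assumes \<epsilon>: "0 < \<epsilon>" "\<epsilon> < level_bound"
  obtains \<kappa> where "\<bar>\<kappa>\<bar> \<le> 1/3"
    and "(loop \<epsilon> has_vector_derivative (of_real (2 * pi) * ((of_real \<kappa> + \<i>) * loop \<epsilon> t))) (at t)"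
    and "\<kappa> * (F (loop \<epsilon> t) \<bullet> DF (loop \<epsilon> t) (loop \<epsilon> t)) + F (loop \<epsilon> t) \<bullet> DF (loop \<epsilon> t) (\<i> * loop \<epsilon> t) = 0"
proof -
  let ?w = "loop \<epsilon> t"
  have w: "?w \<in> ball 0 R" "?w \<noteq> 0" using loop_in_ball[OF \<epsilon>] loop_nz[OF \<epsilon>] by auto
  have "smooth_on UNIV (rad \<epsilon>)" using smooth_on_slice[OF \<epsilon> smooth_on_rad] .
  from smooth_on_has_derivative[OF this, of t]
  obtain D where D: "(rad \<epsilon> has_vector_derivative D) (at t)"
    using differentiable_def vector_derivative_works by blast
  define \<kappa> where "\<kappa> = D / (2 * pi * rad \<epsilon> t)"
  have r: "rad \<epsilon> t > 0" by (rule rad_props[OF \<epsilon>])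
  have Dr: "D = 2 * pi * \<kappa> * rad \<epsilon> t" using r by (simp add: \<kappa>_def)
  have cis: "((\<lambda>t. cis (2 * pi * t)) has_vector_derivative (of_real (2 * pi) * \<i> * cis (2 * pi * t))) (at t)"
  proof -
    have "((\<lambda>t. 2 * pi * t) has_derivative (\<lambda>h. 2 * pi * h)) (at t)" by (auto intro!: derivative_eq_intros)
    from has_derivative_cis[OF this] show ?thesis
      by (simp add: has_vector_derivative_def scaleR_conv_of_real ac_simps)
  qed
  have v: "(loop \<epsilon> has_vector_derivative (of_real (2 * pi) * ((of_real \<kappa> + \<i>) * ?w))) (at t)"
  proof -
    have "((\<lambda>t. rad \<epsilon> t *\<^sub>R cis (2 * pi * t)) has_vector_derivative
        (rad \<epsilon> t *\<^sub>R (of_real (2 * pi) * \<i> * cis (2 * pi * t)) + D *\<^sub>R cis (2 * pi * t))) (at t)"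
      by (rule has_vector_derivative_scaleR[OF D[unfolded has_real_derivative_iff_has_vector_derivative[symmetric]] cis])
    moreover have "rad \<epsilon> t *\<^sub>R (of_real (2 * pi) * \<i> * cis (2 * pi * t)) + D *\<^sub>R cis (2 * pi * t)
        = of_real (2 * pi) * ((of_real \<kappa> + \<i>) * ?w)"
      by (simp add: Dr loop_def ray_def scaleR_conv_of_real algebra_simps)
    moreover have "loop \<epsilon> = (\<lambda>t. rad \<epsilon> t *\<^sub>R cis (2 * pi * t))"
      by (simp add: fun_eq_iff loop_def ray_def scaleR_conv_of_real)
    ultimately show ?thesis by simp
  qed
  have "((\<lambda>t. F (loop \<epsilon> t)) has_derivative (\<lambda>h. DF ?w (h *\<^sub>R (of_real (2 * pi) * ((of_real \<kappa> + \<i>) * ?w))))) (at t)"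
    by (rule has_derivative_compose[OF v[unfolded has_vector_derivative_def] F_deriv[OF w(1)]])
  from has_derivative_inner[OF this this]
  have "((\<lambda>t. F (loop \<epsilon> t) \<bullet> F (loop \<epsilon> t)) has_derivative
      (\<lambda>h. 2 * (F ?w \<bullet> DF ?w (h *\<^sub>R (of_real (2 * pi) * ((of_real \<kappa> + \<i>) * ?w)))))) (at t)"
    by (simp add: inner_commute)
  moreover have "((\<lambda>t. F (loop \<epsilon> t) \<bullet> F (loop \<epsilon> t)) has_derivative (\<lambda>h. 0)) (at t)"
    by (simp add: power2_norm_eq_inner[symmetric] rad_props[OF \<epsilon>])
  ultimately have "(\<lambda>h::real. 2 * (F ?w \<bullet> DF ?w (h *\<^sub>R (of_real (2 * pi) * ((of_real \<kappa> + \<i>) * ?w))))) = (\<lambda>h. 0)"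
    by (rule has_derivative_unique)
  from fun_cong[OF this, of 1]
  have "F ?w \<bullet> DF ?w (1 *\<^sub>R (of_real (2 * pi) * ((of_real \<kappa> + \<i>) * ?w))) = 0" by simp
  moreover have "1 *\<^sub>R (of_real (2 * pi) * ((of_real \<kappa> + \<i>) * ?w)) = (2 * pi) *\<^sub>R (\<kappa> *\<^sub>R ?w + \<i> * ?w)"
    by (simp add: scaleR_conv_of_real algebra_simps)
  ultimately have *: "\<kappa> * (F ?w \<bullet> DF ?w ?w) + F ?w \<bullet> DF ?w (\<i> * ?w) = 0"
    by (simp add: linear_add[OF DF_linear[OF w(1)]] linear_scale[OF DF_linear[OF w(1)]] inner_add_right)
  have "\<bar>\<kappa>\<bar> * (3/4 * scale ?w) \<le> \<bar>\<kappa>\<bar> * (F ?w \<bullet> DF ?w ?w)"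
    using radial_form(1)[OF w] by (intro mult_left_mono) auto
  also have "\<dots> = \<bar>\<kappa> * (F ?w \<bullet> DF ?w ?w)\<bar>"
    using radial_form(1)[OF w] scale_pos[OF w(2)] by (simp add: abs_mult)
  also have "\<dots> = \<bar>F ?w \<bullet> DF ?w (\<i> * ?w)\<bar>" using * by linarith
  also have "\<dots> \<le> 1/3 * (3/4 * scale ?w)" using radial_form(2)[OF w] by simp
  finally have "\<bar>\<kappa>\<bar> \<le> 1/3" using scale_pos[OF w(2)] by (subst (asm) mult_le_cancel_right) auto
  then show thesis using v * that by blast
qed

section \<open>Geometry of the level curves\<close>

lemma smooth_knot_loop:
  assumes \<epsilon>: "0 < \<epsilon>" "\<epsilon> < level_bound"
  shows "smooth_knot (loop \<epsilon>)"
  unfolding smooth_knot_def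
proof (intro conjI allI)
  show "smooth_on UNIV (loop \<epsilon>)" using smooth_on_slice[OF \<epsilon> smooth_on_loop] .
  show "loop \<epsilon> (t + 1) = loop \<epsilon> t" for t by (rule loop_periodic)
  show "inj_on (loop \<epsilon>) {0..<1}" by (rule inj_on_loop[OF \<epsilon>])
  show "vector_derivative (loop \<epsilon>) (at t) \<noteq> 0" for t
  proof (rule loop_velocity[OF \<epsilon>, of t])
    fix \<kappa>
    assume "(loop \<epsilon> has_vector_derivative (of_real (2 * pi) * ((of_real \<kappa> + \<i>) * loop \<epsilon> t))) (at t)"
    moreover have "of_real \<kappa> + \<i> \<noteq> 0" by (simp add: complex_eq_iff)
    ultimately show ?thesis using loop_nz[OF \<epsilon>, of t] by (simp add: vector_derivative_at)
  qed
qed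

lemma sublevel_closure:
  assumes \<epsilon>: "0 < \<epsilon>" "\<epsilon> < level_bound"
  shows "open {w \<in> ball 0 R. norm (F w) < \<epsilon>}"
    and "closure {w \<in> ball 0 R. norm (F w) < \<epsilon>} \<subseteq> {w \<in> ball 0 R. norm (F w) \<le> \<epsilon>}"
proof -
  have cont: "continuous_on (ball 0 R) F" by (rule smooth_on_continuous[OF smooth])
  have "open (ball 0 R \<inter> (\<lambda>w. norm (F w)) -` {..<\<epsilon>})"
    by (rule continuous_open_preimage) (auto intro: continuous_intros cont)
  then show "open {w \<in> ball 0 R. norm (F w) < \<epsilon>}"
    by (simp add: vimage_def Int_def)
  let ?C = "cball 0 (R / 2) \<inter> (\<lambda>w. norm (F w)) -` {..\<epsilon>}"
  have sub: "cball 0 (R / 2) \<subseteq> ball (0 :: complex) R" using R_pos by auto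
  have "closed ?C"
    by (rule continuous_closed_preimage) (auto intro!: continuous_intros continuous_on_subset[OF cont sub])
  moreover have "{w \<in> ball 0 R. norm (F w) < \<epsilon>} \<subseteq> ?C"
  proof
    fix w assume "w \<in> {w \<in> ball 0 R. norm (F w) < \<epsilon>}"
    then have w: "cmod w < R" "norm (F w) < \<epsilon>" by auto
    have "\<not> R / 2 < cmod w"
    proof
      assume "R / 2 < cmod w"
      then have "(R / 2) ^ N \<le> cmod w ^ N" using R_pos by (intro power_mono) auto
      then have "level_bound \<le> 15/16 * cmod a * cmod w ^ N"
        unfolding level_bound_def by (intro mult_left_mono) auto
      then show False using norm_F_bounds(1)[of w] w \<epsilon> by simp
    qed
    then show "w \<in> ?C" using w by simp
  qed
  ultimately have "closure {w \<in> ball 0 R. norm (F w) < \<epsilon>} \<subseteq> ?C" by (rule closure_minimal[rotated])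
  then show "closure {w \<in> ball 0 R. norm (F w) < \<epsilon>} \<subseteq> {w \<in> ball 0 R. norm (F w) \<le> \<epsilon>}"
    using sub by auto
qed

text \<open>
  By \<open>loop_velocity\<close>, the derivative of the squared distance in the direction \<open>v\<close> is \<open>-4 \<pi> (\<kappa>\<^sup>2 + 1)\<close> times
  the radial form, hence negative.
\<close>

lemma inward_normal:
  fixes \<epsilon> t :: real
  assumes \<epsilon>: "0 < \<epsilon>" "\<epsilon> < level_bound"
  defines "v \<equiv> \<i> * vector_derivative (loop \<epsilon>) (at t)"
  shows "\<exists>d>0. \<forall>s. 0 < s \<and> s < d \<longrightarrow>
    loop \<epsilon> t + of_real s * v \<in> ball 0 R \<and> norm (F (loop \<epsilon> t + of_real s * v)) < \<epsilon> \<and>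
    loop \<epsilon> t - of_real s * v \<in> ball 0 R \<and> \<epsilon> < norm (F (loop \<epsilon> t - of_real s * v))"
proof (rule loop_velocity[OF \<epsilon>, of t])
  fix \<kappa>
  let ?w = "loop \<epsilon> t"
  assume vel: "(loop \<epsilon> has_vector_derivative (of_real (2 * pi) * ((of_real \<kappa> + \<i>) * ?w))) (at t)"
    and \<kappa>: "\<kappa> * (F ?w \<bullet> DF ?w ?w) + F ?w \<bullet> DF ?w (\<i> * ?w) = 0"
  have w: "?w \<in> ball 0 R" "?w \<noteq> 0" using loop_in_ball[OF \<epsilon>] loop_nz[OF \<epsilon>] by auto
  have v: "v = (2 * pi) *\<^sub>R (\<kappa> *\<^sub>R (\<i> * ?w) - ?w)"
    unfolding v_def vector_derivative_at[OF vel] by (simp add: scaleR_conv_of_real algebra_simps)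
  have B: "F ?w \<bullet> DF ?w ?w > 0" using radial_form(1)[OF w] scale_pos[OF w(2)] by linarith
  have "F ?w \<bullet> DF ?w v = 2 * pi * (\<kappa> * (F ?w \<bullet> DF ?w (\<i> * ?w)) - F ?w \<bullet> DF ?w ?w)"
    unfolding v by (simp only: linear_scale[OF DF_linear[OF w(1)]] linear_diff[OF DF_linear[OF w(1)]]
        inner_scaleR_right inner_diff_right)
  also have "F ?w \<bullet> DF ?w (\<i> * ?w) = - \<kappa> * (F ?w \<bullet> DF ?w ?w)" using \<kappa> by simp
  also have "2 * pi * (\<kappa> * (- \<kappa> * (F ?w \<bullet> DF ?w ?w)) - F ?w \<bullet> DF ?w ?w)
      = - (2 * pi * (\<kappa>\<^sup>2 + 1) * (F ?w \<bullet> DF ?w ?w))"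
    by (simp add: algebra_simps power2_eq_square)
  also have "\<dots> < 0" using B by (auto intro!: mult_pos_pos add_nonneg_pos)
  finally have neg: "F ?w \<bullet> DF ?w v < 0" .
  define h where "h s = F (?w + of_real s * v) \<bullet> F (?w + of_real s * v)" for s :: real
  have 1: "((\<lambda>s. ?w + of_real s * v) has_derivative (\<lambda>h. h *\<^sub>R v)) (at 0)"
    by (auto intro!: derivative_eq_intros simp: scaleR_conv_of_real)
  have 2: "((\<lambda>s. F (?w + of_real s * v)) has_derivative (\<lambda>h. h *\<^sub>R DF ?w v)) (at 0)"
    using has_derivative_compose[OF 1, of F "DF ?w"] F_deriv[OF w(1)]
    by (simp add: linear_scale[OF DF_linear[OF w(1)]])
  have "(h has_derivative (\<lambda>k. (2 * (F ?w \<bullet> DF ?w v)) * k)) (at 0)"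
    unfolding h_def by (rule has_derivative_eq_rhs, rule has_derivative_inner[OF 2 2])
      (auto simp: fun_eq_iff inner_commute)
  then have h: "(h has_real_derivative (2 * (F ?w \<bullet> DF ?w v))) (at 0)"
    by (simp add: has_field_derivative_def)
  have h0: "h 0 = \<epsilon>\<^sup>2" by (simp add: h_def power2_norm_eq_inner[symmetric] rad_props[OF \<epsilon>])
  obtain d1 where d1: "d1 > 0" "\<And>s. 0 < s \<Longrightarrow> s < d1 \<Longrightarrow> h s < \<epsilon>\<^sup>2"
    using DERIV_neg_dec_right[OF h] neg h0 by auto
  obtain d2 where d2: "d2 > 0" "\<And>s. 0 < s \<Longrightarrow> s < d2 \<Longrightarrow> h (- s) > \<epsilon>\<^sup>2"
    using DERIV_neg_dec_left[OF h] neg h0 by auto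
  obtain e where e: "e > 0" "ball ?w e \<subseteq> ball 0 R"
    using openE[OF open_ball w(1)] by blast
  define d3 where "d3 = e / (cmod v + 1)"
  have "cmod v + 1 > 0" by (simp add: add_nonneg_pos)
  then have d3: "d3 > 0" using e by (simp add: d3_def)
  have in_ball: "?w + of_real s * v \<in> ball 0 R" if "\<bar>s\<bar> < d3" for s
  proof -
    have "\<bar>s\<bar> * cmod v \<le> \<bar>s\<bar> * (cmod v + 1)" by (intro mult_left_mono) auto
    also have "\<dots> < e" using that \<open>cmod v + 1 > 0\<close> by (simp add: d3_def field_simps)
    finally have "?w + of_real s * v \<in> ball ?w e" by (simp add: dist_norm norm_mult)
    then show ?thesis using e by blast
  qed
  show ?thesis
  proof (intro exI[of _ "min (min d1 d2) d3"] conjI allI impI)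
    fix s assume s: "0 < s \<and> s < min (min d1 d2) d3"
    show "?w + of_real s * v \<in> ball 0 R" using in_ball[of s] s by simp
    show "?w - of_real s * v \<in> ball 0 R" using in_ball[of "- s"] s by simp
    have "(norm (F (?w + of_real s * v)))\<^sup>2 < \<epsilon>\<^sup>2" using d1(2)[of s] s by (simp add: h_def power2_norm_eq_inner)
    then show "norm (F (?w + of_real s * v)) < \<epsilon>" by (rule power_less_imp_less_base) (use \<epsilon> in simp)
    have "\<epsilon>\<^sup>2 < (norm (F (?w - of_real s * v)))\<^sup>2" using d2(2)[of s] s by (simp add: h_def power2_norm_eq_inner)
    then show "\<epsilon> < norm (F (?w - of_real s * v))" by (rule power_less_imp_less_base) simp
  qed (use d1 d2 d3 in simp)
qed

lemma oriented_boundary_loop: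
  assumes \<epsilon>: "0 < \<epsilon>" "\<epsilon> < level_bound"
  shows "oriented_boundary {w \<in> ball 0 R. norm (F w) < \<epsilon>} (loop \<epsilon>)"
proof -
  let ?\<Omega> = "{w \<in> ball 0 R. norm (F w) < \<epsilon>}"
  have cl: "closure ?\<Omega> \<subseteq> {w \<in> ball 0 R. norm (F w) \<le> \<epsilon>}" by (rule sublevel_closure[OF \<epsilon>])
  have inward: "\<forall>\<^sub>F s in at_right 0. loop \<epsilon> t + of_real s * \<i> * vector_derivative (loop \<epsilon>) (at t) \<in> ?\<Omega>"
    and outward: "\<forall>\<^sub>F s in at_right 0. loop \<epsilon> t - of_real s * \<i> * vector_derivative (loop \<epsilon>) (at t) \<notin> closure ?\<Omega>" for t
  proof -
    obtain d where d: "d > 0" "\<And>s. 0 < s \<Longrightarrow> s < d \<Longrightarrow>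
        loop \<epsilon> t + of_real s * (\<i> * vector_derivative (loop \<epsilon>) (at t)) \<in> ?\<Omega> \<and>
        \<epsilon> < norm (F (loop \<epsilon> t - of_real s * (\<i> * vector_derivative (loop \<epsilon>) (at t))))"
      using inward_normal[OF \<epsilon>, of t] by auto
    show "\<forall>\<^sub>F s in at_right 0. loop \<epsilon> t + of_real s * \<i> * vector_derivative (loop \<epsilon>) (at t) \<in> ?\<Omega>"
      unfolding eventually_at_right_field using d by (intro exI[of _ d]) (auto simp: mult.assoc)
    show "\<forall>\<^sub>F s in at_right 0. loop \<epsilon> t - of_real s * \<i> * vector_derivative (loop \<epsilon>) (at t) \<notin> closure ?\<Omega>"
      unfolding eventually_at_right_field
    proof (intro exI[of _ d] conjI allI impI d(1))
      fix s :: real assume "0 < s" "s < d"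
      then have "\<epsilon> < norm (F (loop \<epsilon> t - of_real s * (\<i> * vector_derivative (loop \<epsilon>) (at t))))"
        using d(2) by blast
      then show "loop \<epsilon> t - of_real s * \<i> * vector_derivative (loop \<epsilon>) (at t) \<notin> closure ?\<Omega>"
        using cl by (force simp: mult.assoc)
    qed
  qed
  have in_closure: "loop \<epsilon> t \<in> closure ?\<Omega>" for t
  proof (rule Lim_in_closed_set[OF closed_closure])
    let ?g = "\<lambda>s. loop \<epsilon> t + of_real s * \<i> * vector_derivative (loop \<epsilon>) (at t)"
    show "\<forall>\<^sub>F s in at_right 0. ?g s \<in> closure ?\<Omega>"
      by (rule eventually_mono[OF inward[of t]]) (rule subsetD[OF closure_subset])
    have "(?g \<longlongrightarrow> loop \<epsilon> t + of_real 0 * \<i> * vector_derivative (loop \<epsilon>) (at t)) (at_right 0)"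
      by (intro tendsto_intros)
    then show "(?g \<longlongrightarrow> loop \<epsilon> t) (at_right 0)" by simp
    show "at_right (0::real) \<noteq> bot" by (rule trivial_limit_at_right_real)
  qed
  have fr: "frontier ?\<Omega> = closure ?\<Omega> - ?\<Omega>"
    using sublevel_closure(1)[OF \<epsilon>] by (simp add: frontier_def interior_open)
  have "range (loop \<epsilon>) \<subseteq> frontier ?\<Omega>"
    unfolding fr using in_closure rad_props(3)[OF \<epsilon>] by (intro image_subsetI) simp
  moreover have "frontier ?\<Omega> \<subseteq> range (loop \<epsilon>)"
    unfolding fr range_loop[OF \<epsilon>] using cl by force
  ultimately show ?thesis
    unfolding oriented_boundary_def using smooth_knot_loop[OF \<epsilon>] inward outward by blast
qed

lemma F_loop_velocity:
  assumes \<epsilon>: "0 < \<epsilon>" "\<epsilon> < level_bound"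
  obtains V where "((\<lambda>t. F (loop \<epsilon> t)) has_vector_derivative V) (at t)"
    and "J_std (F (loop \<epsilon> t)) \<bullet> V > 0" and "angle_form (F (loop \<epsilon> t)) V > 0"
proof (rule loop_velocity[OF \<epsilon>, of t])
  fix \<kappa>
  let ?w = "loop \<epsilon> t"
  let ?V = "DF ?w (of_real (2 * pi) * ((of_real \<kappa> + \<i>) * ?w))"
  assume vel: "(loop \<epsilon> has_vector_derivative (of_real (2 * pi) * ((of_real \<kappa> + \<i>) * ?w))) (at t)"
    and \<kappa>: "\<bar>\<kappa>\<bar> \<le> 1/3"
  have w: "?w \<in> ball 0 R" "?w \<noteq> 0" using loop_in_ball[OF \<epsilon>] loop_nz[OF \<epsilon>] by auto
  have lin: "linear (DF ?w)" by (rule DF_linear[OF w(1)])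
  have V: "?V = (2 * pi) *\<^sub>R DF ?w ((of_real \<kappa> + \<i>) * ?w)"
    by (metis linear_scale[OF lin] scaleR_conv_of_real)
  have bil: "bilinear angle_form" "bilinear (\<lambda>x y. J_std x \<bullet> y)"
    using unit_form_angle unit_form_J by (auto simp: unit_form_def)
  have "((\<lambda>t. F (loop \<epsilon> t)) has_vector_derivative ?V) (at t)"
    using has_derivative_compose[OF vel[unfolded has_vector_derivative_def] F_deriv[OF w(1)]]
    by (simp only: has_vector_derivative_def linear_scale[OF lin])
  moreover have "J_std (F ?w) \<bullet> ?V > 0" "angle_form (F ?w) ?V > 0"
    using turning_form[OF w disjI1[OF refl] \<kappa>] turning_form[OF w disjI2[OF refl] \<kappa>]
    unfolding V bilinear_rmul[OF bil(1)] inner_scaleR_right by auto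
  ultimately show thesis using that by blast
qed

text \<open>
  An angular coordinate of the first complex coordinate along the level curve: after division by
  \<open>a cis (2 \<pi> N t)\<close> this coordinate stays in the right half plane, where the principal logarithm is smooth.
\<close>

lemma angular_coordinate:
  assumes \<epsilon>: "0 < \<epsilon>" "\<epsilon> < level_bound"
  obtains \<theta> \<theta>' where "\<And>t. cfst (F (loop \<epsilon> t)) = rcis (cmod (cfst (F (loop \<epsilon> t)))) (\<theta> t)"
    and "\<And>t. (\<theta> has_real_derivative \<theta>' t) (at t)" and "\<And>t. \<theta>' t > 0"
    and "\<And>t. \<theta> (t + 1) = \<theta> t + 2 * pi * of_nat N"
proof -
  define w where "w t = cfst (F (loop \<epsilon> t))" for t
  define e where "e t = cis (- (2 * pi * of_nat N * t)) / a" for t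
  define g where "g t = w t * e t" for t
  \<comment> \<open>\<open>g t\<close> is close to the positive number \<open>rad \<epsilon> t ^ N\<close>, so the imaginary part of its logarithm is its argument\<close>
  define \<theta> where "\<theta> t = Arg a + 2 * pi * of_nat N * t + Im (Ln (g t))" for t
  have w_nz: "w t \<noteq> 0" for t unfolding w_def using cfst_F_nz loop_in_ball[OF \<epsilon>] loop_nz[OF \<epsilon>] by blast
  have g_pos: "Re (g t) > 0" for t
  proof -
    let ?c = "loop \<epsilon> t" and ?r = "rad \<epsilon> t"
    have r: "?r > 0" using rad_props[OF \<epsilon>] by blast
    have "(cis (2 * pi * t)) ^ N = cis (2 * pi * of_nat N * t)" by (simp add: Complex.DeMoivre ac_simps)
    then have ce: "(a * ?c ^ N) * e t = of_real (?r ^ N)"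
      using a_nz by (simp add: e_def loop_def ray_def power_mult_distrib cis_mult)
    have ne: "cmod (e t) = 1 / cmod a" by (simp add: e_def norm_divide)
    have "cmod (g t - of_real (?r ^ N)) = cmod (w t - a * ?c ^ N) / cmod a"
      unfolding g_def ce[symmetric] by (simp add: left_diff_distrib[symmetric] norm_mult ne)
    also have "\<dots> \<le> (cmod a / 16 * ?r ^ N) / cmod a"
      using cfst_F_near[OF loop_in_ball[OF \<epsilon>], of t] a_nz cmod_loop[OF \<epsilon>, of t]
      by (intro divide_right_mono) (auto simp: w_def)
    also have "\<dots> < ?r ^ N" using a_nz r by simp
    finally have "\<bar>Re (g t) - ?r ^ N\<bar> < ?r ^ N"
      using abs_Re_le_cmod[of "g t - of_real (?r ^ N)"] by simp
    then show ?thesis by linarith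
  qed
  then have g_nz: "g t \<noteq> 0" for t by (metis less_irrefl zero_complex.simps(1))
  have polar: "w t = rcis (cmod (w t)) (\<theta> t)" for t
  proof -
    have "g t = of_real (cmod (g t)) * cis (Im (Ln (g t)))"
      using rcis_cmod_Arg[of "g t"] Arg_eq_Im_Ln[OF g_nz] by (simp add: rcis_def)
    moreover have "a = of_real (cmod a) * cis (Arg a)" using rcis_cmod_Arg[of a] by (simp add: rcis_def)
    moreover have "w t = g t * a * cis (2 * pi * of_nat N * t)"
      using a_nz by (simp add: g_def e_def cis_mult)
    ultimately have "w t = of_real (cmod (g t)) * cis (Im (Ln (g t))) * (of_real (cmod a) * cis (Arg a)) * cis (2 * pi * of_nat N * t)"
      by simp
    also have "\<dots> = of_real (cmod (g t) * cmod a) * cis (\<theta> t)"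
      by (simp add: \<theta>_def cis_mult[symmetric])
    also have "cmod (g t) * cmod a = cmod (w t)"
      using a_nz by (simp add: g_def e_def norm_mult norm_divide)
    finally show ?thesis by (simp add: rcis_def)
  qed
  have "\<exists>d. (\<theta> has_real_derivative d) (at t) \<and> d > 0" for t
  proof (rule F_loop_velocity[OF \<epsilon>, of t])
    fix V
    assume V: "((\<lambda>t. F (loop \<epsilon> t)) has_vector_derivative V) (at t)" and A: "angle_form (F (loop \<epsilon> t)) V > 0"
    have w': "(w has_vector_derivative cfst V) (at t)"
      unfolding w_def by (rule bounded_linear.has_vector_derivative[OF bounded_linear_cfst V])
    have e': "(e has_vector_derivative (- (2 * pi * of_nat N) * \<i> * e t)) (at t)"
      unfolding e_def has_vector_derivative_def
      by (auto intro!: derivative_eq_intros simp: a_nz scaleR_conv_of_real fun_eq_iff)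
    have g': "(g has_vector_derivative (w t * (- (2 * pi * of_nat N) * \<i> * e t) + cfst V * e t)) (at t)"
      unfolding g_def by (rule has_vector_derivative_mult[OF w' e'])
    have "g t \<notin> \<real>\<^sub>\<le>\<^sub>0" using g_pos[of t] by (auto simp: complex_nonpos_Reals_iff)
    then have "(Ln has_field_derivative inverse (g t)) (at (g t))" by (rule has_field_derivative_Ln)
    from field_vector_diff_chain_at[OF g' this]
    have "((\<lambda>t. Ln (g t)) has_vector_derivative
        ((w t * (- (2 * pi * of_nat N) * \<i> * e t) + cfst V * e t) * inverse (g t))) (at t)"
      by (simp only: o_def)
    moreover have "(w t * (- (2 * pi * of_nat N) * \<i> * e t) + cfst V * e t) * inverse (g t)
        = cfst V / w t - 2 * pi * of_nat N * \<i>"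
      using g_nz[of t] by (auto simp: g_def field_simps)
    ultimately have L: "((\<lambda>t. Ln (g t)) has_vector_derivative (cfst V / w t - 2 * pi * of_nat N * \<i>)) (at t)"
      by simp
    have I: "((\<lambda>t. Im (Ln (g t))) has_real_derivative (Im (cfst V / w t) - 2 * pi * of_nat N)) (at t)"
      using bounded_linear.has_vector_derivative[OF bounded_linear_Im L]
      by (simp add: has_real_derivative_iff_has_vector_derivative)
    have "((\<lambda>t. Arg a + 2 * pi * of_nat N * t) has_real_derivative (2 * pi * of_nat N)) (at t)"
      by (auto intro!: derivative_eq_intros)
    from DERIV_add[OF this I] have "(\<theta> has_real_derivative Im (cfst V / w t)) (at t)"
      by (simp add: \<theta>_def[abs_def])
    moreover have "Im (cfst V / w t) = angle_form (F (loop \<epsilon> t)) V / (cmod (w t))\<^sup>2"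
      by (simp add: angle_form_def w_def complex_div_cnj[of "cfst V"] mult.commute)
    ultimately show ?thesis using A w_nz[of t] by (intro exI[of _ "Im (cfst V / w t)"]) simp
  qed
  then obtain \<theta>' where "\<And>t. (\<theta> has_real_derivative \<theta>' t) (at t) \<and> \<theta>' t > 0" by metis
  moreover have "\<theta> (t + 1) = \<theta> t + 2 * pi * of_nat N" for t
  proof -
    have "cis (- (2 * pi * of_nat N * (t + 1))) = cis (- (2 * pi * of_nat N * t)) * cis (2 * pi * (- of_nat N))"
      by (simp add: cis_mult algebra_simps)
    also have "cis (2 * pi * (- of_nat N)) = 1" by (rule cis_multiple_2pi) simp
    finally have "g (t + 1) = g t" by (simp add: g_def w_def e_def loop_periodic)
    then show ?thesis by (simp add: \<theta>_def algebra_simps)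
  qed
  ultimately show thesis using that[of \<theta> \<theta>'] polar by (auto simp: w_def)
qed

end

section \<open>Counting the crossings with a half plane\<close>

lemma cis_eq_cis_iff: "cis s = cis t \<longleftrightarrow> (\<exists>k::int. s = t + 2 * pi * of_int k)"
proof
  assume "cis s = cis t"
  then obtain n :: int where "s = t + 2 * pi * n"
    unfolding cis_conv_exp exp_eq by (auto simp: complex_eq_iff)
  then show "\<exists>k::int. s = t + 2 * pi * of_int k" by blast
next
  assume "\<exists>k::int. s = t + 2 * pi * of_int k"
  then show "cis s = cis t" by (auto simp: cis_mult[symmetric] cis_multiple_2pi)
qed

text \<open>A strictly increasing angle that grows by \<open>2 \<pi> N\<close> over a period passes \<open>N\<close> times through its initial direction.\<close>

lemma card_angle_crossings:
  fixes \<theta> \<theta>' :: "real \<Rightarrow> real"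
  assumes der: "\<And>t. (\<theta> has_real_derivative \<theta>' t) (at t)" and pos: "\<And>t. \<theta>' t > 0"
    and period: "\<theta> 1 = \<theta> 0 + 2 * pi * of_nat N"
  defines "T \<equiv> {t \<in> {0..<1}. \<exists>k::int. \<theta> t = \<theta> 0 + 2 * pi * of_int k}"
  shows "finite T" "card T = N"
proof -
  have mono: "\<theta> s < \<theta> t" if "s < t" for s t
    by (rule DERIV_pos_imp_increasing[OF that]) (use der pos in blast)
  define j where "j t = (\<theta> t - \<theta> 0) / (2 * pi)" for t
  have "bij_betw j T (real ` {..<N})"
    unfolding bij_betw_def
  proof
    show "inj_on j T"
    proof (rule inj_onI)
      fix s t assume "j s = j t"
      then have "\<theta> s = \<theta> t" by (simp add: j_def)
      then show "s = t" using mono by (metis less_irrefl linorder_neqE_linordered_idom)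
    qed
    show "j ` T = real ` {..<N}"
    proof (intro equalityI subsetI)
      fix x assume "x \<in> j ` T"
      then obtain t k where t: "0 \<le> t" "t < 1" "\<theta> t = \<theta> 0 + 2 * pi * of_int k" and x: "x = j t"
        by (auto simp: T_def)
      have xk: "x = of_int k" using t(3) by (simp add: x j_def)
      have "\<theta> 0 \<le> \<theta> t" using mono[of 0 t] t(1) by (cases "t = 0") auto
      then have "0 \<le> (of_int k :: real)" using t(3) by (simp add: zero_le_mult_iff not_le[THEN iffD2, OF pi_gt_zero])
      then have k0: "0 \<le> k" by simp
      have "\<theta> t < \<theta> 1" using mono t(2) by blast
      then have "(of_int k :: real) < of_nat N" using t(3) period by simp
      then have "nat k < N" using k0 by linarith
      moreover have "x = real (nat k)" using k0 xk by simp
      ultimately show "x \<in> real ` {..<N}" by blast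
    next
      fix x assume "x \<in> real ` {..<N}"
      then obtain n where n: "n < N" "x = real n" by auto
      have "\<exists>t. 0 \<le> t \<and> t \<le> 1 \<and> \<theta> t = \<theta> 0 + 2 * pi * n"
      proof (rule IVT')
        show "continuous_on {0..1} \<theta>"
          using der by (meson DERIV_isCont continuous_at_imp_continuous_on)
      qed (use n period in auto)
      then obtain t where t: "0 \<le> t" "t \<le> 1" "\<theta> t = \<theta> 0 + 2 * pi * n" by blast
      have "t \<noteq> 1" using t(3) period n by auto
      then have "t \<in> T" using t by (auto simp: T_def intro!: exI[of _ "int n"])
      moreover have "x = j t" using t(3) n(2) by (simp add: j_def)
      ultimately show "x \<in> j ` T" by blast
    qed
  qed
  then show "finite T" "card T = N"
    using bij_betw_finite bij_betw_same_card by (blast, fastforce simp: card_image)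
qed

section \<open>A disc bounded by the braid axis\<close>

text \<open>
  Stereographic parametrization of the half great sphere spanned by the second complex coordinate
  and the direction \<open>cis \<alpha>\<close> in the first one. It is smooth across its boundary circle.
\<close>

definition stereo :: "complex \<Rightarrow> real" where
  "stereo z = 2 * inverse (1 + z \<bullet> z)"

definition half_sphere :: "real \<Rightarrow> complex \<Rightarrow> real^4" where
  "half_sphere \<alpha> z = cpair (of_real (stereo z - 1) * cis \<alpha>) (of_real (stereo z) * z)"

text \<open>The differential of \<open>half_sphere \<alpha>\<close> at \<open>z\<close>.\<close>

definition half_sphere_deriv :: "real \<Rightarrow> complex \<Rightarrow> complex \<Rightarrow> real^4" where
  "half_sphere_deriv \<alpha> z h =
     cpair (of_real (- (stereo z)\<^sup>2 * (z \<bullet> h)) * cis \<alpha>)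
       (of_real (- (stereo z)\<^sup>2 * (z \<bullet> h)) * z + of_real (stereo z) * h)"

lemma one_plus_inner_pos: "1 + z \<bullet> z > (0::real)" for z :: complex
  by (simp add: add_pos_nonneg)

lemma stereo_eq: "stereo z * (1 + z \<bullet> z) = 2"
  using one_plus_inner_pos[of z] by (simp add: stereo_def)

lemma stereo_ge_1: "cmod z \<le> 1 \<Longrightarrow> stereo z \<ge> 1"
  using one_plus_inner_pos[of z] by (simp add: stereo_def power2_norm_eq_inner[symmetric] field_simps abs_square_le_1)

lemma smooth_on_stereo: "smooth_on UNIV stereo"
proof -
  have "smooth_on UNIV (\<lambda>z::complex. 2 * inverse (1 + z \<bullet> z))"
    using one_plus_inner_pos
    by (intro smooth_on_mult smooth_on_inverse smooth_on_add smooth_on_inner smooth_on_const smooth_on_id)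
       (auto simp: less_imp_neq[THEN not_sym])
  then show ?thesis by (simp add: stereo_def[abs_def])
qed

lemma smooth_on_half_sphere: "smooth_on UNIV (half_sphere \<alpha>)"
proof -
  have "smooth_on UNIV (\<lambda>z. cpair ((stereo z - 1) *\<^sub>R cis \<alpha>) 0 + cpair 0 (stereo z *\<^sub>R z))"
    by (intro smooth_on_add smooth_on_bounded_linear[OF bounded_linear_cpair1]
        smooth_on_bounded_linear[OF bounded_linear_cpair2] smooth_on_scaleR smooth_on_diff
        smooth_on_const smooth_on_id smooth_on_stereo open_UNIV)
  then show ?thesis
    by (simp add: half_sphere_def[abs_def] cpair_split[symmetric] scaleR_conv_of_real)
qed

lemma stereo_derivative: "(stereo has_derivative (\<lambda>h. - (stereo z)\<^sup>2 * (z \<bullet> h))) (at z)"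
proof -
  have "((\<lambda>z. 1 + z \<bullet> z) has_derivative (\<lambda>h. 0 + (z \<bullet> h + h \<bullet> z))) (at z)"
    by (intro derivative_intros)
  from has_derivative_mult_right[OF Deriv.has_derivative_inverse[OF _ this], of 2]
  have "((\<lambda>z. 2 * inverse (1 + z \<bullet> z)) has_derivative
      (\<lambda>h. 2 * - (inverse (1 + z \<bullet> z) * (0 + (z \<bullet> h + h \<bullet> z)) * inverse (1 + z \<bullet> z)))) (at z)"
    using one_plus_inner_pos[of z] by simp
  moreover have "(\<lambda>h. 2 * - (inverse (1 + z \<bullet> z) * (0 + (z \<bullet> h + h \<bullet> z)) * inverse (1 + z \<bullet> z)))
      = (\<lambda>h. - (stereo z)\<^sup>2 * (z \<bullet> h))"
    by (simp add: fun_eq_iff stereo_def power2_eq_square inner_commute)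
  moreover have "(\<lambda>z. 2 * inverse (1 + z \<bullet> z)) = stereo" by (simp add: fun_eq_iff stereo_def)
  ultimately show ?thesis by (simp only:)
qed

lemma half_sphere_derivative: "(half_sphere \<alpha> has_derivative half_sphere_deriv \<alpha> z) (at z)"
proof -
  have 1: "((\<lambda>z. (stereo z - 1) *\<^sub>R cis \<alpha>) has_derivative (\<lambda>h. (- (stereo z)\<^sup>2 * (z \<bullet> h) - 0) *\<^sub>R cis \<alpha>)) (at z)"
    by (intro has_derivative_scaleR_left has_derivative_diff stereo_derivative has_derivative_const)
  have 2: "((\<lambda>z. stereo z *\<^sub>R z) has_derivative (\<lambda>h. stereo z *\<^sub>R h + (- (stereo z)\<^sup>2 * (z \<bullet> h)) *\<^sub>R z)) (at z)"
    by (intro has_derivative_scaleR stereo_derivative has_derivative_ident)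
  have "((\<lambda>z. cpair ((stereo z - 1) *\<^sub>R cis \<alpha>) 0 + cpair 0 (stereo z *\<^sub>R z)) has_derivative
      (\<lambda>h. cpair ((- (stereo z)\<^sup>2 * (z \<bullet> h) - 0) *\<^sub>R cis \<alpha>) 0
         + cpair 0 (stereo z *\<^sub>R h + (- (stereo z)\<^sup>2 * (z \<bullet> h)) *\<^sub>R z))) (at z)"
    by (intro has_derivative_add bounded_linear.has_derivative[OF bounded_linear_cpair1 1]
        bounded_linear.has_derivative[OF bounded_linear_cpair2 2])
  moreover have "(\<lambda>z. cpair ((stereo z - 1) *\<^sub>R cis \<alpha>) 0 + cpair 0 (stereo z *\<^sub>R z)) = half_sphere \<alpha>"
    by (simp add: half_sphere_def[abs_def] cpair_split[symmetric] scaleR_conv_of_real)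
  moreover have "(\<lambda>h. cpair ((- (stereo z)\<^sup>2 * (z \<bullet> h) - 0) *\<^sub>R cis \<alpha>) 0
         + cpair 0 (stereo z *\<^sub>R h + (- (stereo z)\<^sup>2 * (z \<bullet> h)) *\<^sub>R z)) = half_sphere_deriv \<alpha> z"
    by (simp add: half_sphere_deriv_def[abs_def] cpair_split[symmetric] scaleR_conv_of_real add.commute)
  ultimately show ?thesis by simp
qed

lemma norm_half_sphere: "norm (half_sphere \<alpha> z) = 1"
proof -
  let ?s = "stereo z"
  have "(norm (half_sphere \<alpha> z))\<^sup>2 = (?s - 1)\<^sup>2 + ?s\<^sup>2 * (z \<bullet> z)"
    by (simp add: norm_cfst_csnd half_sphere_def norm_mult power_mult_distrib power2_norm_eq_inner
        del: of_real_diff)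
  also have "\<dots> = ?s * (?s * (1 + z \<bullet> z)) - 2 * ?s + 1" by (simp add: power2_eq_square algebra_simps)
  also have "\<dots> = 1" unfolding stereo_eq by simp
  finally show ?thesis by (simp add: power2_eq_1_iff) (metis norm_ge_zero not_one_le_zero neg_0_le_iff_le)
qed

lemma half_sphere_boundary: "half_sphere \<alpha> (cis t) = cpair 0 (cis t)"
proof -
  have "cis t \<bullet> cis t = 1" by (simp add: power2_norm_eq_inner[symmetric])
  then have "stereo (cis t) = 1" by (simp add: stereo_def)
  then show ?thesis by (simp add: half_sphere_def)
qed

text \<open>
  The half great sphere lies in the hyperplane spanned by \<open>cis \<alpha>\<close> and the second coordinate plane, so only the
  component of \<open>v\<close> normal to this hyperplane matters; the factor \<open>(stereo z)\<^sup>2\<close> is the area distortion of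
  the stereographic projection.
\<close>

lemma orient4_half_sphere:
  "orient4 (half_sphere \<alpha> z) (half_sphere_deriv \<alpha> z 1) (half_sphere_deriv \<alpha> z \<i>) v
    = (stereo z)\<^sup>2 * Im (cnj (cis \<alpha>) * cfst v)"
proof -
  define \<tau> where "\<tau> = stereo z"
  define x where "x = Re z"
  define y where "y = Im z"
  have \<tau>: "\<tau> * (1 + (x * x + y * y)) = 2"
    using stereo_eq[of z] by (simp add: \<tau>_def x_def y_def inner_complex_def)
  have "orient4 (half_sphere \<alpha> z) (half_sphere_deriv \<alpha> z 1) (half_sphere_deriv \<alpha> z \<i>) v
    = (cos \<alpha> * v $ 2 - sin \<alpha> * v $ 1) *
      ((\<tau> - 1) * (\<tau>\<^sup>2 - \<tau>^3 * (x * x + y * y)) + \<tau>^4 * (x * x + y * y))"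
    unfolding half_sphere_def half_sphere_deriv_def orient4_def det_4
    by (simp add: \<tau>_def[symmetric] x_def[symmetric] y_def[symmetric] inner_complex_def
        power2_eq_square power3_eq_cube power4_eq_xxxx algebra_simps)
  also have "(\<tau> - 1) * (\<tau>\<^sup>2 - \<tau>^3 * (x * x + y * y)) + \<tau>^4 * (x * x + y * y) = \<tau>\<^sup>2"
  proof -
    have 1: "\<tau>^3 * (x * x + y * y) = \<tau>\<^sup>2 * (\<tau> * (x * x + y * y))" and 2: "\<tau>^4 * (x * x + y * y) = \<tau>^3 * (\<tau> * (x * x + y * y))"
      by (simp_all add: power2_eq_square power3_eq_cube power4_eq_xxxx)
    have 3: "\<tau> * (x * x + y * y) = 2 - \<tau>" using \<tau> by (simp add: algebra_simps)
    show ?thesis unfolding 1 2 3 by (simp add: power2_eq_square power3_eq_cube algebra_simps)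
  qed
  finally show ?thesis by (simp add: \<tau>_def cfst_def)
qed

section \<open>The knot in the frame of the branch point\<close>

text \<open>The map \<open>f\<close> whose expression in the frame \<open>E\<close>, centered at \<open>f 0\<close>, is the germ \<open>F\<close>.\<close>

locale framed_germ = branched_germ F a N R
  for F :: "complex \<Rightarrow> real^4" and a :: complex and N :: nat and R :: real +
  fixes f :: "complex \<Rightarrow> real^4" and E :: "real^4^4"
  assumes det_pos: "det E > 0" and f_eq: "\<And>w. w \<in> ball 0 R \<Longrightarrow> f w = f 0 + E *v F w"
begin

lemma inv_E [simp]: "matrix_inv E *v (E *v x) = x"
  using det_pos by (simp add: matrix_inv_mult_vector)

lemma E_inj: "E *v x = E *v y \<longleftrightarrow> x = y"
  by (metis inv_E)

lemma g0_E [simp]: "g0 E (E *v x) (E *v y) = x \<bullet> y"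
  by (simp add: g0_def)

lemma J0_E: "J0 E (E *v x) = E *v J_std x"
  by (simp add: J0_def)

lemma in_sphere_iff: "q + E *v x \<in> g0_sphere E q \<epsilon> \<longleftrightarrow> norm x = \<epsilon>"
  by (simp add: g0_sphere_def norm_eq_sqrt_inner)

lemma in_ball_iff: "q + E *v x \<in> g0_ball E q \<epsilon> \<longleftrightarrow> norm x < \<epsilon>"
  by (simp add: g0_ball_def norm_eq_sqrt_inner)

lemma bounded_linear_E: "bounded_linear ((*v) E)"
  by (rule matrix_vector_mul_bounded_linear)

text \<open>The intersection of the disc with the sphere of radius \<open>\<epsilon>\<close>, parametrized by the angle.\<close>

definition knot :: "real \<Rightarrow> real \<Rightarrow> real^4" where
  "knot \<epsilon> = f \<circ> loop \<epsilon>"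

lemma knot_eq: "0 < \<epsilon> \<Longrightarrow> \<epsilon> < level_bound \<Longrightarrow> knot \<epsilon> t = f 0 + E *v F (loop \<epsilon> t)"
  by (simp add: knot_def f_eq[OF loop_in_ball])

text \<open>The scale factor \<open>c\<close> is \<open>1\<close> for the knot itself and \<open>1 / \<epsilon>\<close> for its image on the unit sphere.\<close>

lemma transverse_scaled_knot:
  assumes \<epsilon>: "0 < \<epsilon>" "\<epsilon> < level_bound" and c: "c > 0"
  shows "transverse_knot E (f 0) (c * \<epsilon>) (\<lambda>t. f 0 + E *v (c *\<^sub>R F (loop \<epsilon> t)))"
proof -
  let ?\<gamma> = "\<lambda>t. f 0 + E *v (c *\<^sub>R F (loop \<epsilon> t))"
  have vel: "\<exists>V. (?\<gamma> has_vector_derivative (E *v (c *\<^sub>R V))) (at t) \<and> J_std (F (loop \<epsilon> t)) \<bullet> V > 0" for t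
  proof (rule F_loop_velocity[OF \<epsilon>, of t])
    fix V assume V: "((\<lambda>t. F (loop \<epsilon> t)) has_vector_derivative V) (at t)" "J_std (F (loop \<epsilon> t)) \<bullet> V > 0"
    have "((\<lambda>t. f 0 + E *v (c *\<^sub>R F (loop \<epsilon> t))) has_vector_derivative (0 + E *v (c *\<^sub>R V))) (at t)"
      by (intro has_vector_derivative_add has_vector_derivative_const
          bounded_linear.has_vector_derivative[OF bounded_linear_E]
          bounded_linear.has_vector_derivative[OF bounded_linear_scaleR_right] V)
    then show ?thesis using V(2) by auto
  qed
  have nz: "vector_derivative ?\<gamma> (at t) \<noteq> 0"
    and transverse: "vector_derivative ?\<gamma> (at t) \<notin> contact_plane E (f 0) (?\<gamma> t)" for t
  proof -
    obtain V where V: "(?\<gamma> has_vector_derivative (E *v (c *\<^sub>R V))) (at t)" "J_std (F (loop \<epsilon> t)) \<bullet> V > 0"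
      using vel by blast
    have "g0 E (E *v (c *\<^sub>R V)) (J0 E (E *v (c *\<^sub>R F (loop \<epsilon> t)))) = c * c * (J_std (F (loop \<epsilon> t)) \<bullet> V)"
      unfolding J0_E g0_E linear_scale[OF linear_J_std] by (simp add: inner_commute)
    then have pos: "g0 E (E *v (c *\<^sub>R V)) (J0 E (E *v (c *\<^sub>R F (loop \<epsilon> t)))) > 0"
      using V(2) c by simp
    then show "vector_derivative ?\<gamma> (at t) \<notin> contact_plane E (f 0) (?\<gamma> t)"
      unfolding vector_derivative_at[OF V(1)] contact_plane_def by simp
    have "V \<noteq> 0" using V(2) by auto
    then have "E *v (c *\<^sub>R V) \<noteq> E *v 0" unfolding E_inj using c by simp
    then show "vector_derivative ?\<gamma> (at t) \<noteq> 0"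
      unfolding vector_derivative_at[OF V(1)] by simp
  qed
  have "smooth_on UNIV (\<lambda>t. F (loop \<epsilon> t))"
    using smooth_on_slice[OF \<epsilon>, of "\<lambda>\<epsilon> t. F (loop \<epsilon> t)"] smooth_on_F_loop by simp
  then have "smooth_on UNIV ?\<gamma>"
    by (intro smooth_on_add smooth_on_const smooth_on_bounded_linear[OF bounded_linear_E]
        smooth_on_scaleR_left open_UNIV)
  moreover have "?\<gamma> (t + 1) = ?\<gamma> t" for t by (simp add: loop_periodic)
  moreover have "inj_on ?\<gamma> {0..<1}"
  proof (rule inj_onI)
    fix s t :: real assume st: "s \<in> {0..<1}" "t \<in> {0..<1}" and "?\<gamma> s = ?\<gamma> t"
    then have "F (loop \<epsilon> s) = F (loop \<epsilon> t)" using c by (simp add: E_inj)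
    then have "loop \<epsilon> s = loop \<epsilon> t" using inj loop_in_ball[OF \<epsilon>] by (auto dest: inj_onD)
    then show "s = t" using inj_on_loop[OF \<epsilon>] st by (auto dest: inj_onD)
  qed
  moreover have "range ?\<gamma> \<subseteq> g0_sphere E (f 0) (c * \<epsilon>)"
    using c by (auto simp: in_sphere_iff rad_props[OF \<epsilon>])
  ultimately show ?thesis
    unfolding transverse_knot_def knot_in_sphere_def smooth_knot_def using nz transverse by blast
qed

lemma knot_in_sphere_knot:
  assumes \<epsilon>: "0 < \<epsilon>" "\<epsilon> < level_bound"
  shows "knot_in_sphere E (f 0) \<epsilon> (knot \<epsilon>)"
proof -
  have "knot \<epsilon> = (\<lambda>t. f 0 + E *v (1 *\<^sub>R F (loop \<epsilon> t)))" by (simp add: fun_eq_iff knot_eq[OF \<epsilon>])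
  then show ?thesis using transverse_scaled_knot[OF \<epsilon>, of 1] by (simp add: transverse_knot_def)
qed

lemma is_branch_knot_knot:
  assumes \<epsilon>: "0 < \<epsilon>" "\<epsilon> < level_bound"
  shows "is_branch_knot E f R \<epsilon> (knot \<epsilon>)"
proof -
  have f_sphere: "f w \<in> g0_sphere E (f 0) \<epsilon> \<longleftrightarrow> norm (F w) = \<epsilon>"
    and f_ball: "f w \<in> g0_ball E (f 0) \<epsilon> \<longleftrightarrow> norm (F w) < \<epsilon>" if "w \<in> ball 0 R" for w
    unfolding f_eq[OF that] by (rule in_sphere_iff in_ball_iff)+
  have "branch_knot_set E f R \<epsilon> = f ` {w \<in> ball 0 R. norm (F w) = \<epsilon>}"
    unfolding branch_knot_set_def using f_sphere by blast
  also have "\<dots> = range (knot \<epsilon>)"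
    unfolding range_loop[OF \<epsilon>, symmetric] knot_def by (simp add: image_comp)
  finally have "range (knot \<epsilon>) = branch_knot_set E f R \<epsilon>" ..
  moreover have "{z \<in> ball 0 R. f z \<in> g0_ball E (f 0) \<epsilon>} = {w \<in> ball 0 R. norm (F w) < \<epsilon>}"
    using f_ball by blast
  moreover have "range (loop \<epsilon>) \<subseteq> ball 0 R" using loop_in_ball[OF \<epsilon>] by blast
  ultimately show ?thesis
    using knot_in_sphere_knot[OF \<epsilon>] oriented_boundary_loop[OF \<epsilon>]
    unfolding is_branch_knot_def knot_in_sphere_def by (auto simp: knot_def)
qed

text \<open>
  The isotopy runs through the rescaled knots for the radii between \<open>\<epsilon>\<close> and \<open>\<epsilon>'\<close>. The affine path of radii stays
  admissible for times slightly outside \<open>{0..1}\<close>, which gives the open domain of smoothness.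
\<close>

lemma same_transverse_type_knot:
  assumes \<epsilon>: "0 < \<epsilon>" "\<epsilon> < level_bound" and \<epsilon>': "0 < \<epsilon>'" "\<epsilon>' < level_bound"
  shows "same_transverse_type E (f 0) \<epsilon> (knot \<epsilon>) \<epsilon>' (knot \<epsilon>')"
proof -
  define e where "e s = \<epsilon> + s * (\<epsilon>' - \<epsilon>)" for s :: real
  define W where "W = {x :: real \<times> real. 0 < e (fst x) \<and> e (fst x) < level_bound}"
  define H where "H s t = f 0 + E *v ((1 / e s) *\<^sub>R F (loop (e s) t))" for s t
  have e: "0 < e s" "e s < level_bound" if "s \<in> {0..1}" for s
  proof -
    have "e s = (1 - s) * \<epsilon> + s * \<epsilon>'" by (simp add: e_def algebra_simps)
    moreover have "(1 - s) * \<epsilon> + s * \<epsilon>' \<le> max \<epsilon> \<epsilon>'"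
      using that by (intro convex_bound_le) simp_all
    moreover have "(1 - s) * - \<epsilon> + s * - \<epsilon>' \<le> max (- \<epsilon>) (- \<epsilon>')"
      using that by (intro convex_bound_le) simp_all
    ultimately show "0 < e s" "e s < level_bound" using \<epsilon> \<epsilon>' by auto
  qed
  have "open W" unfolding W_def e_def
    by (intro open_Collect_conj open_Collect_less continuous_intros)
  moreover have "{0..1} \<times> UNIV \<subseteq> W" using e by (auto simp: W_def)
  moreover have "smooth_on W (\<lambda>(s, t). H s t)"
  proof -
    have fst: "smooth_on W (fst :: real \<times> real \<Rightarrow> real)"
      by (rule smooth_on_linear[OF bounded_linear_fst \<open>open W\<close>])
    have snd: "smooth_on W (snd :: real \<times> real \<Rightarrow> real)"
      by (rule smooth_on_linear[OF bounded_linear_snd \<open>open W\<close>])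
    have es: "smooth_on W (\<lambda>x. e (fst x))"
      unfolding e_def by (intro smooth_on_add smooth_on_mult smooth_on_const fst \<open>open W\<close>)
    have "smooth_on W (\<lambda>x. (\<lambda>y. F (loop (fst y) (snd y))) (e (fst x), snd x))"
      by (rule smooth_on_compose[OF \<open>open W\<close> smooth_on_Pair[OF \<open>open W\<close> es snd] _ smooth_on_F_loop])
         (auto simp: W_def)
    then have Fl: "smooth_on W (\<lambda>x. F (loop (e (fst x)) (snd x)))" by simp
    have "smooth_on W (\<lambda>x. inverse (e (fst x)))"
      by (rule smooth_on_inverse[OF \<open>open W\<close> es]) (auto simp: W_def)
    then have "smooth_on W (\<lambda>x. f 0 + E *v (inverse (e (fst x)) *\<^sub>R F (loop (e (fst x)) (snd x))))"
      by (intro smooth_on_add smooth_on_const smooth_on_bounded_linear[OF bounded_linear_E]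
          smooth_on_scaleR Fl \<open>open W\<close>)
    then show ?thesis by (simp add: H_def case_prod_unfold divide_inverse)
  qed
  moreover have "transverse_knot E (f 0) 1 (H s)" if "s \<in> {0..1}" for s
    using transverse_scaled_knot[OF e[OF that], of "1 / e s"] e(1)[OF that] by (simp add: H_def[abs_def])
  moreover have "H 0 = rescale_knot (f 0) \<epsilon> (knot \<epsilon>)" "H 1 = rescale_knot (f 0) \<epsilon>' (knot \<epsilon>')"
    by (simp_all add: fun_eq_iff H_def e_def rescale_knot_def knot_eq \<epsilon> \<epsilon>'
        linear_scale[OF bounded_linear.linear[OF bounded_linear_E]])
  ultimately show ?thesis
    unfolding same_transverse_type_def transverse_isotopic_def by blast
qed

text \<open>The great circle in the second coordinate plane.\<close>

abbreviation axis :: "real \<Rightarrow> real \<Rightarrow> real^4" where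
  "axis \<epsilon> \<equiv> great_circle (f 0) \<epsilon> (E *v cpair 0 1) (E *v cpair 0 \<i>)"

lemma axis_eq: "axis \<epsilon> t = f 0 + E *v (cpair 0 (of_real \<epsilon> * cis (2 * pi * t)))"
proof -
  have "cpair 0 (of_real \<epsilon> * cis (2 * pi * t)) =
      \<epsilon> *\<^sub>R (cos (2 * pi * t) *\<^sub>R cpair 0 1 + sin (2 * pi * t) *\<^sub>R cpair 0 \<i>)"
    by (simp add: vec_eq_iff forall_4)
  then show ?thesis
    by (simp add: great_circle_def linear_scale[OF bounded_linear.linear[OF bounded_linear_E]]
        linear_add[OF bounded_linear.linear[OF bounded_linear_E]])
qed

lemma knot_in_sphere_axis:
  assumes \<epsilon>: "\<epsilon> > 0"
  shows "knot_in_sphere E (f 0) \<epsilon> (axis \<epsilon>)"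
proof -
  have axis: "axis \<epsilon> = (\<lambda>t. f 0 + E *v (cpair 0 (\<epsilon> *\<^sub>R cis ((2 * pi) *\<^sub>R t))))"
    by (simp add: fun_eq_iff axis_eq scaleR_conv_of_real)
  have "smooth_on UNIV (axis \<epsilon>)" unfolding axis
    by (intro smooth_on_add smooth_on_const smooth_on_bounded_linear[OF bounded_linear_E]
        smooth_on_bounded_linear[OF bounded_linear_cpair2] smooth_on_scaleR_left smooth_on_cis
        smooth_on_id open_UNIV)
  moreover have "axis \<epsilon> (t + 1) = axis \<epsilon> t" for t
    unfolding axis_eq by (simp add: distrib_left cis_mult[symmetric])
  moreover have "inj_on (axis \<epsilon>) {0..<1}"
  proof (rule inj_onI)
    fix s t :: real assume st: "s \<in> {0..<1}" "t \<in> {0..<1}" and "axis \<epsilon> s = axis \<epsilon> t"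
    then have "cpair 0 (of_real \<epsilon> * cis (2 * pi * s)) = cpair 0 (of_real \<epsilon> * cis (2 * pi * t))"
      by (simp add: axis_eq E_inj)
    from arg_cong[OF this, of csnd] have "cis (2 * pi * s) = cis (2 * pi * t)" using \<epsilon> by simp
    then show "s = t" using cis_inj_on st by (auto dest: inj_onD)
  qed
  moreover have "vector_derivative (axis \<epsilon>) (at t) \<noteq> 0" for t
  proof -
    have 1: "((\<lambda>t. \<epsilon> *\<^sub>R cis ((2 * pi) *\<^sub>R t)) has_vector_derivative (\<epsilon> *\<^sub>R ((2 * pi) *\<^sub>R (\<i> * cis ((2 * pi) *\<^sub>R t))))) (at t)"
    proof -
      have "((\<lambda>t::real. (2 * pi) *\<^sub>R t) has_derivative (\<lambda>h. (2 * pi) *\<^sub>R h)) (at t)"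
        by (auto intro!: derivative_eq_intros)
      from has_derivative_scaleR_right[OF has_derivative_cis[OF this], of \<epsilon>] show ?thesis
        by (simp add: has_vector_derivative_def ac_simps)
    qed
    have "((\<lambda>t. f 0 + E *v (cpair 0 (\<epsilon> *\<^sub>R cis ((2 * pi) *\<^sub>R t)))) has_vector_derivative
        (0 + E *v (cpair 0 (\<epsilon> *\<^sub>R ((2 * pi) *\<^sub>R (\<i> * cis ((2 * pi) *\<^sub>R t))))))) (at t)"
      by (intro has_vector_derivative_add has_vector_derivative_const
          bounded_linear.has_vector_derivative[OF bounded_linear_E]
          bounded_linear.has_vector_derivative[OF bounded_linear_cpair2] 1)
    then have vd: "vector_derivative (axis \<epsilon>) (at t) =
        E *v (cpair 0 (\<epsilon> *\<^sub>R ((2 * pi) *\<^sub>R (\<i> * cis ((2 * pi) *\<^sub>R t)))))"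
      unfolding axis using vector_derivative_at by fastforce
    have "cpair 0 (\<epsilon> *\<^sub>R ((2 * pi) *\<^sub>R (\<i> * cis ((2 * pi) *\<^sub>R t)))) \<noteq> 0"
      using \<epsilon> by (metis csnd_cpair cis_neq_zero complex_i_not_zero less_irrefl linear_0
          bounded_linear.linear[OF bounded_linear_csnd] mult_eq_0_iff pi_neq_zero scaleR_eq_0_iff zero_neq_numeral)
    then show ?thesis unfolding vd by (metis E_inj matrix_vector_mult_0_right)
  qed
  moreover have "range (axis \<epsilon>) \<subseteq> g0_sphere E (f 0) \<epsilon>"
  proof clarify
    fix t
    have "(norm (cpair 0 (of_real \<epsilon> * cis (2 * pi * t))))\<^sup>2 = \<epsilon>\<^sup>2"
      by (simp add: norm_cfst_csnd norm_mult)
    then show "axis \<epsilon> t \<in> g0_sphere E (f 0) \<epsilon>"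
      unfolding axis_eq in_sphere_iff using \<epsilon> by (simp add: power2_eq_iff_nonneg)
  qed
  ultimately show ?thesis unfolding knot_in_sphere_def smooth_knot_def by blast
qed

lemma knot_axis_disjoint:
  assumes \<epsilon>: "0 < \<epsilon>" "\<epsilon> < level_bound"
  shows "range (knot \<epsilon>) \<inter> range (axis \<epsilon>) = {}"
proof -
  have "knot \<epsilon> s \<noteq> axis \<epsilon> t" for s t
  proof
    assume "knot \<epsilon> s = axis \<epsilon> t"
    then have "cfst (F (loop \<epsilon> s)) = 0" by (simp add: knot_eq[OF \<epsilon>] axis_eq E_inj)
    then show False using cfst_F_nz[OF loop_in_ball[OF \<epsilon>] loop_nz[OF \<epsilon>]] by simp
  qed
  then show ?thesis by auto
qed

text \<open>
  The bounding disc is the half great sphere in the initial direction \<open>\<alpha> = \<theta> 0\<close> of the angular coordinate. It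
  meets the knot exactly at the parameters in \<open>T\<close>, where the argument is \<open>\<alpha>\<close> modulo \<open>2 \<pi>\<close>, and there the
  sign of the crossing is the sign of the angular velocity.
\<close>

lemma linking_number_axis:
  assumes \<epsilon>: "0 < \<epsilon>" "\<epsilon> < level_bound"
  shows "has_linking_number E (f 0) \<epsilon> (knot \<epsilon>) (axis \<epsilon>) (real N)"
proof (rule angular_coordinate[OF \<epsilon>])
  fix \<theta> \<theta>'
  define K where "K t = F (loop \<epsilon> t)" for t
  define s where "s t = cmod (cfst (K t))" for t
  assume \<theta>: "\<And>t. cfst (F (loop \<epsilon> t)) = rcis (cmod (cfst (F (loop \<epsilon> t)))) (\<theta> t)"
    and \<theta>': "\<And>t. (\<theta> has_real_derivative \<theta>' t) (at t)" "\<And>t. \<theta>' t > 0"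
    and per: "\<And>t. \<theta> (t + 1) = \<theta> t + 2 * pi * of_nat N"
  have K: "cfst (K t) = of_real (s t) * cis (\<theta> t)" for t using \<theta>[of t] by (simp add: K_def s_def rcis_def)
  have s_pos: "s t > 0" for t using cfst_F_nz[OF loop_in_ball[OF \<epsilon>] loop_nz[OF \<epsilon>]] by (simp add: s_def K_def)
  have sphere: "(s t)\<^sup>2 + csnd (K t) \<bullet> csnd (K t) = \<epsilon>\<^sup>2" for t
    using norm_cfst_csnd[of "K t"] rad_props(3)[OF \<epsilon>, of t] by (simp add: K_def s_def power2_norm_eq_inner)
  define \<alpha> where "\<alpha> = \<theta> 0"
  define T where "T = {t \<in> {0..<1}. \<exists>k::int. \<theta> t = \<theta> 0 + 2 * pi * of_int k}"
  have T: "finite T" "card T = N"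
    using card_angle_crossings[OF \<theta>', of N] per[of 0] by (simp_all add: T_def)
  have T_iff: "t \<in> T \<longleftrightarrow> t \<in> {0..<1} \<and> cis (\<theta> t) = cis \<alpha>" for t
    by (simp add: T_def cis_eq_cis_iff \<alpha>_def)
  define u where "u z = f 0 + E *v (\<epsilon> *\<^sub>R half_sphere \<alpha> z)" for z
  \<comment> \<open>the inverse of the stereographic parametrization at the points of the half great sphere\<close>
  define Z where "Z t = csnd (K t) / of_real (\<epsilon> + s t)" for t
  define I where "I = {(t, z). t \<in> {0..<1} \<and> z \<in> cball 0 1 \<and> knot \<epsilon> t = u z}"
  have meet: "knot \<epsilon> t = u z \<longleftrightarrow> K t = \<epsilon> *\<^sub>R half_sphere \<alpha> z" for t z
    by (simp add: knot_eq[OF \<epsilon>] u_def E_inj K_def)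
  have hs: "cfst (\<epsilon> *\<^sub>R half_sphere \<alpha> z) = of_real (\<epsilon> * (stereo z - 1)) * cis \<alpha>"
    "csnd (\<epsilon> *\<^sub>R half_sphere \<alpha> z) = of_real (\<epsilon> * stereo z) * z" for z
    unfolding half_sphere_def linear_scale[OF bounded_linear.linear[OF bounded_linear_cfst]]
      linear_scale[OF bounded_linear.linear[OF bounded_linear_csnd]]
    by (simp_all add: scaleR_conv_of_real)
  have crossing: "t \<in> T \<and> z = Z t" if "(t, z) \<in> I" for t z
  proof -
    have t: "t \<in> {0..<1}" and z: "cmod z \<le> 1" and eq: "K t = \<epsilon> *\<^sub>R half_sphere \<alpha> z"
      using that meet by (auto simp: I_def)
    have 1: "cfst (K t) = of_real (\<epsilon> * (stereo z - 1)) * cis \<alpha>" and 2: "csnd (K t) = of_real (\<epsilon> * stereo z) * z"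
      unfolding eq hs by simp_all
    have "s t = \<bar>\<epsilon> * (stereo z - 1)\<bar>"
      unfolding s_def 1 by (simp only: norm_mult norm_of_real norm_cis mult_1_right)
    then have st: "s t = \<epsilon> * (stereo z - 1)" using stereo_ge_1[OF z] \<epsilon> by simp
    have "of_real (s t) * cis (\<theta> t) = of_real (s t) * cis \<alpha>"
      using K[of t] 1 by (simp only: st)
    then have "cis (\<theta> t) = cis \<alpha>"
      using s_pos[of t] by (metis less_irrefl mult_left_cancel of_real_eq_0_iff)
    then have "t \<in> T" using t T_iff by blast
    moreover have "\<epsilon> + s t = \<epsilon> * stereo z" by (simp add: st algebra_simps)
    then have "Z t = z" using stereo_ge_1[OF z] \<epsilon> by (simp add: Z_def 2)
    ultimately show ?thesis by simp
  qed
  have at_Z: "(t, Z t) \<in> I" if t: "t \<in> T" for t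
  proof -
    have pos: "\<epsilon> + s t > 0" using s_pos[of t] \<epsilon> by simp
    have ZZ: "Z t \<bullet> Z t = (\<epsilon>\<^sup>2 - (s t)\<^sup>2) / (\<epsilon> + s t)\<^sup>2"
      using sphere[of t] pos
      by (simp add: Z_def power2_norm_eq_inner[symmetric] norm_divide power_divide del: of_real_add)
    also have "\<dots> = (\<epsilon> - s t) / (\<epsilon> + s t)"
      using pos by (simp add: power2_eq_square square_diff_square_factored)
    finally have ZZ': "Z t \<bullet> Z t = (\<epsilon> - s t) / (\<epsilon> + s t)" .
    then have "Z t \<bullet> Z t \<le> 1" using pos s_pos[of t] by simp
    then have "cmod (Z t) \<le> 1" by (simp add: norm_eq_sqrt_inner)
    moreover have st: "stereo (Z t) = (\<epsilon> + s t) / \<epsilon>"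
      unfolding stereo_def ZZ' using pos \<epsilon> by (simp add: field_simps)
    have "K t = \<epsilon> *\<^sub>R half_sphere \<alpha> (Z t)"
    proof -
      have 1: "\<epsilon> * (stereo (Z t) - 1) = s t" and 2: "\<epsilon> * stereo (Z t) = \<epsilon> + s t"
        unfolding st using \<epsilon> by (simp_all add: field_simps)
      have "csnd (K t) = of_real (\<epsilon> + s t) * Z t"
        unfolding Z_def using pos by (simp del: of_real_add)
      then show ?thesis unfolding real4_eq_iff hs 1 2 using K[of t] t T_iff by simp
    qed
    ultimately show ?thesis using meet t T_iff by (simp add: I_def)
  qed
  have I: "I = (\<lambda>t. (t, Z t)) ` T" using crossing at_Z by auto
  have card: "card I = N" unfolding I using T by (subst card_image) (auto simp: inj_on_def)
  have finI: "finite I" unfolding I using T by simp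
  have sign: "crossing_det (f 0) (knot \<epsilon>) u t z > 0" if "(t, z) \<in> I" for t z
  proof (rule F_loop_velocity[OF \<epsilon>, of t])
    fix V assume V: "((\<lambda>t. F (loop \<epsilon> t)) has_vector_derivative V) (at t)" and A: "angle_form (F (loop \<epsilon> t)) V > 0"
    have z: "cmod z \<le> 1" and meets: "K t = \<epsilon> *\<^sub>R half_sphere \<alpha> z" using that meet by (auto simp: I_def)
    have t: "t \<in> T" using crossing[OF that] by simp
    have "((\<lambda>t. f 0 + E *v F (loop \<epsilon> t)) has_vector_derivative (0 + E *v V)) (at t)"
      by (intro has_vector_derivative_add has_vector_derivative_const
          bounded_linear.has_vector_derivative[OF bounded_linear_E] V)
    moreover have "(\<lambda>t. f 0 + E *v F (loop \<epsilon> t)) = knot \<epsilon>" by (simp add: fun_eq_iff knot_eq[OF \<epsilon>])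
    ultimately have "(knot \<epsilon> has_vector_derivative (E *v V)) (at t)" by simp
    then have \<gamma>': "vector_derivative (knot \<epsilon>) (at t) = E *v V" by (rule vector_derivative_at)
    have "(u has_derivative (\<lambda>h. 0 + E *v (\<epsilon> *\<^sub>R half_sphere_deriv \<alpha> z h))) (at z)"
      unfolding u_def by (intro has_derivative_add has_derivative_const
          bounded_linear.has_derivative[OF bounded_linear_E] has_derivative_scaleR_right half_sphere_derivative)
    then have u': "frechet_derivative u (at z) = (\<lambda>h. E *v (\<epsilon> *\<^sub>R half_sphere_deriv \<alpha> z h))"
      using frechet_derivative_eqI by fastforce
    have scal: "orient4 (c *\<^sub>R x) (c *\<^sub>R y) (c *\<^sub>R w) v = c ^ 3 * orient4 x y w v" for c x y w v
      by (simp add: orient4_def det_4 power3_eq_cube algebra_simps)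
    have "crossing_det (f 0) (knot \<epsilon>) u t z
        = det E * (\<epsilon> ^ 3 * ((stereo z)\<^sup>2 * Im (cnj (cis \<alpha>) * cfst V)))"
      unfolding crossing_det_def \<gamma>' u' knot_eq[OF \<epsilon>] using meets[unfolded K_def]
      by (simp add: orient4_matrix_mult scal orient4_half_sphere)
    moreover have "angle_form (F (loop \<epsilon> t)) V = s t * Im (cnj (cis \<alpha>) * cfst V)"
      using K[of t] t T_iff by (simp add: angle_form_def K_def algebra_simps)
    then have "Im (cnj (cis \<alpha>) * cfst V) > 0" using A s_pos[of t] by (simp add: zero_less_mult_iff)
    ultimately show ?thesis using det_pos \<epsilon> stereo_ge_1[OF z] by simp
  qed
  have nz: "\<forall>(t, z)\<in>I. crossing_det (f 0) (knot \<epsilon>) u t z \<noteq> 0" using sign by fastforce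
  have "smooth_on UNIV u" unfolding u_def
    by (intro smooth_on_add smooth_on_const smooth_on_bounded_linear[OF bounded_linear_E]
        smooth_on_scaleR_left smooth_on_half_sphere open_UNIV)
  moreover have "u ` cball 0 1 \<subseteq> g0_sphere E (f 0) \<epsilon>"
    using \<epsilon> by (auto simp: u_def in_sphere_iff norm_half_sphere)
  moreover have "u (cis (2 * pi * t)) = axis \<epsilon> t" for t
  proof -
    have "\<epsilon> *\<^sub>R cpair 0 (cis (2 * pi * t)) = cpair 0 (of_real \<epsilon> * cis (2 * pi * t))"
      by (simp add: vec_eq_iff forall_4)
    then show ?thesis by (simp add: u_def axis_eq half_sphere_boundary)
  qed
  moreover have "real N = (\<Sum>(t, z)\<in>I. sgn (crossing_det (f 0) (knot \<epsilon>) u t z))"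
  proof -
    have "(\<Sum>(t, z)\<in>I. sgn (crossing_det (f 0) (knot \<epsilon>) u t z)) = (\<Sum>x\<in>I. 1)"
      using sign by (intro sum.cong) auto
    then show ?thesis by (simp add: card)
  qed
  ultimately have "\<exists>T u. open T \<and> cball 0 1 \<subseteq> T \<and> smooth_on T u \<and> u ` cball 0 1 \<subseteq> g0_sphere E (f 0) \<epsilon>
        \<and> (\<forall>t. u (cis (2 * pi * t)) = axis \<epsilon> t)
        \<and> (let I = {(t, z). t \<in> {0..<1} \<and> z \<in> cball 0 1 \<and> knot \<epsilon> t = u z} in
             finite I \<and> (\<forall>(t, z)\<in>I. crossing_det (f 0) (knot \<epsilon>) u t z \<noteq> 0)
             \<and> real N = (\<Sum>(t, z)\<in>I. sgn (crossing_det (f 0) (knot \<epsilon>) u t z)))"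
    by (intro exI[of _ UNIV] exI[of _ u], unfold Let_def I_def[symmetric], intro conjI allI)
       (assumption | rule finI nz | simp)+
  then show ?thesis
    unfolding has_linking_number_def
    using knot_in_sphere_knot[OF \<epsilon>] knot_in_sphere_axis[OF \<epsilon>(1)] knot_axis_disjoint[OF \<epsilon>] by blast
qed

lemma closed_braid_knot:
  assumes \<epsilon>: "0 < \<epsilon>" "\<epsilon> < level_bound"
  shows "closed_braid_of_index E (f 0) \<epsilon> (knot \<epsilon>) N"
proof -
  let ?a = "E *v cpair 0 1" and ?b = "E *v cpair 0 \<i>" and ?c = "E *v cpair 1 0" and ?d = "E *v cpair \<i> 0"
  have orth: "g0_orthonormal E [?a, ?b, ?c, ?d]" "g0_orthonormal E [?a, ?b]"
    by (auto simp: g0_orthonormal_def less_Suc_eq inner_cfst_csnd inner_complex_def nth_Cons')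
  have "orient4 (cpair 0 1) (cpair 0 \<i>) (cpair 1 0) (cpair \<i> 0) = 1"
    by (simp add: orient4_def det_4)
  then have pos: "orient4 ?a ?b ?c ?d > 0" by (simp add: orient4_matrix_mult det_pos)
  have "\<exists>\<rho> \<theta> \<theta>'. \<forall>t. \<rho> t > 0
           \<and> Complex (g0 E (knot \<epsilon> t - f 0) ?c) (g0 E (knot \<epsilon> t - f 0) ?d) = rcis (\<rho> t) (\<theta> t)
           \<and> (\<theta> has_real_derivative \<theta>' t) (at t) \<and> \<theta>' t > 0"
  proof (rule angular_coordinate[OF \<epsilon>])
    fix \<theta> \<theta>'
    assume \<theta>: "\<And>t. cfst (F (loop \<epsilon> t)) = rcis (cmod (cfst (F (loop \<epsilon> t)))) (\<theta> t)"
      "\<And>t. (\<theta> has_real_derivative \<theta>' t) (at t)" "\<And>t. \<theta>' t > 0"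
    have "Complex (g0 E (knot \<epsilon> t - f 0) ?c) (g0 E (knot \<epsilon> t - f 0) ?d) = cfst (F (loop \<epsilon> t))" for t
      by (simp add: knot_eq[OF \<epsilon>] inner_cfst_csnd inner_complex_def complex_eq_iff)
    then show ?thesis
      using \<theta> cfst_F_nz[OF loop_in_ball[OF \<epsilon>] loop_nz[OF \<epsilon>]]
      by (intro exI[of _ "\<lambda>t. cmod (cfst (F (loop \<epsilon> t)))"] exI[of _ \<theta>] exI[of _ \<theta>']) auto
  qed
  then have "braid_axis E (f 0) \<epsilon> ?a ?b (knot \<epsilon>)"
    unfolding braid_axis_def using knot_axis_disjoint[OF \<epsilon>] orth(1) pos by blast
  then show ?thesis
    unfolding closed_braid_of_index_def
    using knot_in_sphere_knot[OF \<epsilon>] orth(2) linking_number_axis[OF \<epsilon>] by blast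
qed

end

section \<open>The leading term in an adapted frame\<close>

text \<open>
  Changing the sign of the fourth basis vector composes the coordinates with an isometry that
  fixes the first two of them, hence the leading term.
\<close>

lemma positive_basis_frame:
  assumes "det C \<noteq> 0"
  defines "E \<equiv> positive_basis C"
  shows "det E > 0" "norm (matrix_inv E *v (C *v x)) = norm x"
    "matrix_inv E *v (C *v cpair u 0) = cpair u 0"
proof -
  have "det E > 0 \<and> norm (matrix_inv E *v (C *v x)) = norm x \<and>
    matrix_inv E *v (C *v cpair u 0) = cpair u 0"
  proof (cases "det C > 0")
    case True
    then have "E = C" by (simp add: E_def positive_basis_def)
    then show ?thesis using True by (simp add: matrix_inv_mult_vector)
  next
    case False
    have E: "E = (\<chi> i j. if j = 4 then - (C $ i $ j) else C $ i $ j)"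
      using False by (simp add: E_def positive_basis_def)
    have "det E = - det C" unfolding E det_4 by (simp add: algebra_simps)
    then have pos: "det E > 0" using False assms(1) by simp
    have "C *v y = E *v cpair (cfst y) (cnj (csnd y))" for y
      unfolding E by (simp add: vec_eq_iff matrix_vector_mult_def sum_4 cfst_def csnd_def)
    then have flip: "matrix_inv E *v (C *v y) = cpair (cfst y) (cnj (csnd y))" for y
      using pos by (simp add: matrix_inv_mult_vector)
    have "(norm (cpair (cfst x) (cnj (csnd x))))\<^sup>2 = (norm x)\<^sup>2" by (simp add: norm_cfst_csnd)
    then show ?thesis unfolding flip using pos by (simp add: power2_eq_iff_nonneg)
  qed
  then show "det E > 0" "norm (matrix_inv E *v (C *v x)) = norm x"
    "matrix_inv E *v (C *v cpair u 0) = cpair u 0" by auto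
qed

lemma linear_complex_bound:
  fixes M :: "complex \<Rightarrow> 'a::real_normed_vector"
  assumes "linear M" "norm (M 1) \<le> k / 2" "norm (M \<i>) \<le> k / 2"
  shows "norm (M u) \<le> k * cmod u"
proof -
  have "u = Re u *\<^sub>R 1 + Im u *\<^sub>R \<i>" by (simp add: complex_eq_iff)
  then have "M u = Re u *\<^sub>R M 1 + Im u *\<^sub>R M \<i>"
    using linear_add[OF assms(1)] linear_scale[OF assms(1)] by metis
  then have "norm (M u) \<le> \<bar>Re u\<bar> * norm (M 1) + \<bar>Im u\<bar> * norm (M \<i>)"
    using norm_triangle_ineq[of "Re u *\<^sub>R M 1" "Im u *\<^sub>R M \<i>"] by simp
  also have "\<dots> \<le> cmod u * (k / 2) + cmod u * (k / 2)"
    using assms abs_Re_le_cmod abs_Im_le_cmod by (intro add_mono mult_mono) auto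
  finally show ?thesis by (simp add: mult.commute)
qed

lemma smooth_on_derivative_close:
  fixes g :: "'a::euclidean_space \<Rightarrow> 'b::real_normed_vector"
  assumes g: "smooth_on S g" and S: "open S" "p \<in> S" and e: "e > 0"
  shows "\<forall>\<^sub>F y in nhds p. \<forall>x. norm (frechet_derivative g (at y) x - frechet_derivative g (at p) x) \<le> e * norm x"
proof -
  define d where "d = e / real (card (Basis :: 'a set))"
  have d: "d > 0" using e by (simp add: d_def)
  have "\<forall>\<^sub>F y in nhds p. norm (frechet_derivative g (at y) b - frechet_derivative g (at p) b) < d" for b
  proof -
    have "continuous_on S (\<lambda>y. frechet_derivative g (at y) b)"
      by (rule smooth_on_continuous[OF smooth_on_derivative[OF g]])
    then have "isCont (\<lambda>y. frechet_derivative g (at y) b) p" using S by (simp add: continuous_on_eq_continuous_at)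
    then have "((\<lambda>y. frechet_derivative g (at y) b) \<longlongrightarrow> frechet_derivative g (at p) b) (nhds p)"
      unfolding isCont_def by (rule tendsto_at_iff_tendsto_nhds[THEN iffD1])
    from tendstoD[OF this d] show ?thesis by (simp add: dist_norm)
  qed
  then have "\<forall>\<^sub>F y in nhds p. \<forall>b\<in>Basis. norm (frechet_derivative g (at y) b - frechet_derivative g (at p) b) < d"
    by (intro eventually_ball_finite) auto
  moreover have "\<forall>\<^sub>F y in nhds p. y \<in> S" using S by (rule eventually_nhds_in_open)
  ultimately show ?thesis
  proof eventually_elim
    case (elim y)
    define M where "M x = frechet_derivative g (at y) x - frechet_derivative g (at p) x" for x
    have "linear (frechet_derivative g (at y))" "linear (frechet_derivative g (at p))"
      using smooth_on_has_derivative[OF g] elim(2) S(2) has_derivative_linear by blast+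
    then have M: "linear M" unfolding M_def by (rule linear_compose_sub)
    have "norm (M x) \<le> e * norm x" for x
    proof -
      have "M x = M (\<Sum>b\<in>Basis. (x \<bullet> b) *\<^sub>R b)" by (simp add: euclidean_representation)
      also have "\<dots> = (\<Sum>b\<in>Basis. (x \<bullet> b) *\<^sub>R M b)" by (simp add: linear_sum[OF M] linear_scale[OF M])
      finally have "norm (M x) \<le> (\<Sum>b\<in>Basis. norm ((x \<bullet> b) *\<^sub>R M b))" using norm_sum by metis
      also have "\<dots> \<le> (\<Sum>b\<in>(Basis::'a set). norm x * d)"
      proof (rule sum_mono)
        fix b :: 'a assume b: "b \<in> Basis"
        then have "norm (M b) \<le> d" using elim(1) by (simp add: M_def less_imp_le)
        then show "norm ((x \<bullet> b) *\<^sub>R M b) \<le> norm x * d"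
          unfolding norm_scaleR using Basis_le_norm[OF b, of x] by (intro mult_mono) auto
      qed
      also have "\<dots> = e * norm x" by (simp add: d_def)
      finally show ?thesis .
    qed
    then show ?case by (simp add: M_def)
  qed
qed

text \<open>The four component conditions on the chart expression, combined into one estimate on its differential.\<close>

lemma chart_expression_derivative:
  fixes Y :: "complex \<Rightarrow> real^4"
  assumes Y: "\<forall>\<^sub>F z in at 0. Y differentiable (at z)"
    and o: "little_o1 N (\<lambda>z. Y z $ 1 - Re (z ^ N))" "little_o1 N (\<lambda>z. Y z $ 2 - Im (z ^ N))"
      "little_o1 N (\<lambda>z. Y z $ 3)" "little_o1 N (\<lambda>z. Y z $ 4)"
    and e: "e > 0"
  shows "\<forall>\<^sub>F z in at 0. \<forall>u. norm (frechet_derivative Y (at z) u - cpair (of_nat N * z ^ (N - 1) * u) 0)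
      \<le> e * cmod z ^ (N - 1) * cmod u"
proof -
  let ?h = "\<lambda>i z. (Y z - cpair (z ^ N) 0) $ i"
  have o': "(\<lambda>z. frechet_derivative (?h i) (at z) u) \<in> o[at 0](\<lambda>z. cmod z ^ (N - 1))" for i u
    using exhaust_4[of i] o unfolding little_o1_def by auto
  have ev: "\<forall>\<^sub>F z in at 0. \<bar>frechet_derivative (?h i) (at z) u\<bar> \<le> e / 8 * cmod z ^ (N - 1)" for i u
    using landau_o.smallD[OF o'[of i u], of "e / 8"] e by simp
  have "\<forall>\<^sub>F z in at 0. \<forall>i\<in>UNIV. \<bar>frechet_derivative (?h i) (at z) 1\<bar> \<le> e / 8 * cmod z ^ (N - 1)"
    "\<forall>\<^sub>F z in at 0. \<forall>i\<in>UNIV. \<bar>frechet_derivative (?h i) (at z) \<i>\<bar> \<le> e / 8 * cmod z ^ (N - 1)"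
    using ev by (intro eventually_ball_finite; simp)+
  then show ?thesis using Y
  proof eventually_elim
    case (elim z)
    define M where "M u = frechet_derivative Y (at z) u - cpair (of_nat N * z ^ (N - 1) * u) 0" for u
    have DY: "(Y has_derivative frechet_derivative Y (at z)) (at z)"
      using elim(3) by (simp add: frechet_derivative_works)
    have Dz: "((\<lambda>z. z ^ N) has_derivative (\<lambda>u. of_nat N * z ^ (N - 1) * u)) (at z)"
      by (auto intro!: derivative_eq_intros simp: fun_eq_iff)
    have DM: "((\<lambda>z. Y z - cpair (z ^ N) 0) has_derivative M) (at z)"
      unfolding M_def by (intro has_derivative_diff DY bounded_linear.has_derivative[OF bounded_linear_cpair1 Dz])
    have Di: "frechet_derivative (?h i) (at z) u = M u $ i" for i u
      by (rule fun_cong[OF frechet_derivative_eqI[OF bounded_linear.has_derivative[OF bounded_linear_vec_nth DM]]])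
    have bound: "norm (M u) \<le> e * cmod z ^ (N - 1) / 2" if "\<And>i. \<bar>M u $ i\<bar> \<le> e / 8 * cmod z ^ (N - 1)" for u
    proof -
      have "norm (M u) \<le> (\<Sum>i\<in>UNIV. \<bar>M u $ i\<bar>)" by (rule norm_le_l1_cart)
      then show ?thesis using that[of 1] that[of 2] that[of 3] that[of 4] by (simp add: sum_4)
    qed
    have "linear M" using DM has_derivative_linear by blast
    moreover have "norm (M 1) \<le> e * cmod z ^ (N - 1) / 2"
      by (rule bound) (use elim(1)[unfolded Di] in simp)
    moreover have "norm (M \<i>) \<le> e * cmod z ^ (N - 1) / 2"
      by (rule bound) (use elim(2)[unfolded Di] in simp)
    ultimately show ?case using linear_complex_bound[of M "e * cmod z ^ (N - 1)"] by (simp add: M_def)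
  qed
qed

lemma matrix_works_linear:
  fixes g :: "real^'n \<Rightarrow> real^'m"
  shows "linear g \<Longrightarrow> matrix g *v x = g x"
  by (rule matrix_works) (simp add: linear_matrix_vector_mul_eq)

lemma coord_basis_invertible:
  assumes X: "smooth_chart U X" and p: "p \<in> U"
  shows "det (coord_basis U X p) \<noteq> 0"
    and "coord_basis U X p *v x = frechet_derivative (inv_into U X) (at (X p)) x"
proof -
  let ?Y = "inv_into U X"
  have Y: "(?Y has_derivative frechet_derivative ?Y (at (X p))) (at (X p))"
    using X p by (intro smooth_on_has_derivative) (auto simp: smooth_chart_def)
  have DX: "(X has_derivative frechet_derivative X (at p)) (at p)"
    using X p by (intro smooth_on_has_derivative) (auto simp: smooth_chart_def)
  have "((\<lambda>x. x) has_derivative (\<lambda>v. frechet_derivative ?Y (at (X p)) (frechet_derivative X (at p) v))) (at p)"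
    by (rule has_derivative_transform_within_open[OF has_derivative_compose[OF DX Y]])
       (use X p in \<open>auto simp: smooth_chart_def\<close>)
  from has_derivative_unique[OF this has_derivative_ident]
  have id: "frechet_derivative ?Y (at (X p)) (frechet_derivative X (at p) v) = v" for v by meson
  have lin: "linear (frechet_derivative ?Y (at (X p)))" "linear (frechet_derivative X (at p))"
    using Y DX has_derivative_linear by blast+
  then show C: "coord_basis U X p *v x = frechet_derivative ?Y (at (X p)) x" for x
    by (simp add: coord_basis_def matrix_works_linear)
  have "(coord_basis U X p ** matrix (frechet_derivative X (at p))) *v v = mat 1 *v v" for v
    by (simp add: matrix_vector_mul_assoc[symmetric] C matrix_works_linear[OF lin(2)] id)
  then have "coord_basis U X p ** matrix (frechet_derivative X (at p)) = mat 1"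
    by (simp add: matrix_eq)
  then have "det (coord_basis U X p) * det (matrix (frechet_derivative X (at p))) = 1"
    by (metis det_I det_mul)
  then show "det (coord_basis U X p) \<noteq> 0" by auto
qed

text \<open>
  In the frame \<open>E\<close> the map \<open>f\<close> has the leading term \<open>a w\<^sup>N\<close> in the original coordinate \<open>w\<close>, where
  \<open>a\<close> is the \<open>N\<close>-th power of the derivative at \<open>0\<close> of the holomorphic coordinate \<open>\<phi>\<close>. With \<open>Y\<close> the expression of \<open>f\<close>
  in the chart and in the coordinate \<open>\<phi>\<close>, and \<open>Xi\<close> the inverse chart, the estimate follows from
  \<open>f = Xi \<circ> Y \<circ> \<phi>\<close>: the differential of \<open>Xi\<close> is close to the coordinate basis \<open>C\<close>, and that of \<open>Y\<close> to the
  differential of the monomial.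
\<close>

lemma leading_term:
  fixes f :: "complex \<Rightarrow> real^4"
  assumes N: "N \<ge> 1" and r: "r > 0" and f: "smooth_on (ball 0 r) f"
    and chart: "branched_in_chart (ball 0 r) f N U X"
    and E: "E = adapted_basis U X (f 0)"
  shows "det E > 0 \<and> (\<exists>a. a \<noteq> 0 \<and> (\<forall>e>0. \<forall>\<^sub>F w in at 0. \<forall>v.
    norm (matrix_inv E *v frechet_derivative f (at w) v - cpair (of_nat N * a * w ^ (N - 1) * v) 0)
      \<le> e * cmod w ^ (N - 1) * cmod v))"
proof -
  obtain V \<psi> where X: "smooth_chart U X" "f 0 \<in> U" "X (f 0) = 0"
    and V: "open V" "0 \<in> V" and \<psi>: "\<psi> holomorphic_on V" "inj_on \<psi> V" "\<psi> 0 = 0"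
    and \<psi>V: "\<psi> ` V \<subseteq> ball 0 r" "f ` \<psi> ` V \<subseteq> U"
    and o: "little_o1 N (\<lambda>z. X (f (\<psi> z)) $ 1 - Re (z ^ N))" "little_o1 N (\<lambda>z. X (f (\<psi> z)) $ 2 - Im (z ^ N))"
      "little_o1 N (\<lambda>z. X (f (\<psi> z)) $ 3)" "little_o1 N (\<lambda>z. X (f (\<psi> z)) $ 4)"
    using chart unfolding branched_in_chart_def by blast
  define Xi where "Xi = inv_into U X"
  define Y where "Y z = X (f (\<psi> z))" for z
  define C where "C = coord_basis U X (f 0)"
  define A where "A = matrix_inv E"
  have C: "det C \<noteq> 0" "\<And>x. C *v x = frechet_derivative Xi (at 0) x"
    using coord_basis_invertible[OF X(1,2)] X(3) by (simp_all add: C_def Xi_def)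
  have EC: "E = positive_basis C" by (simp add: E C_def adapted_basis_def)
  have frame: "det E > 0" "\<And>x. norm (A *v (C *v x)) = norm x" "\<And>u. A *v (C *v cpair u 0) = cpair u 0"
    using positive_basis_frame[OF C(1)] by (simp_all add: EC A_def)
  have Xs: "open U" "inj_on X U" "smooth_on U X" "open (X ` U)" "smooth_on (X ` U) Xi"
    using X(1) by (auto simp: smooth_chart_def Xi_def)

  obtain \<phi> where \<phi>: "\<phi> holomorphic_on (\<psi> ` V)" "\<And>z. z \<in> V \<Longrightarrow> deriv \<psi> z * deriv \<phi> (\<psi> z) = 1"
    "\<And>z. z \<in> V \<Longrightarrow> \<phi> (\<psi> z) = z"
    using holomorphic_has_inverse[OF \<psi>(1) V(1) \<psi>(2)] by metis
  have open\<psi>V: "open (\<psi> ` V)" by (rule open_mapping_thm3[OF \<psi>(1) V(1) \<psi>(2)])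
  have in0: "0 \<in> \<psi> ` V" using V(2) \<psi>(3) by force
  have \<phi>0: "\<phi> 0 = 0" using \<phi>(3)[OF V(2)] \<psi>(3) by simp
  define \<alpha> where "\<alpha> = deriv \<phi> 0"
  have \<alpha>: "\<alpha> \<noteq> 0" using \<phi>(2)[OF V(2)] \<psi>(3) by (auto simp: \<alpha>_def)
  have D\<phi>: "(\<phi> has_field_derivative deriv \<phi> w) (at w)" if "w \<in> \<psi> ` V" for w
    by (rule holomorphic_derivI[OF \<phi>(1) open\<psi>V that])
  have \<phi>_quot: "((\<lambda>w. \<phi> w / w) \<longlongrightarrow> \<alpha>) (at 0)"
    using D\<phi>[OF in0] \<phi>0 by (simp add: has_field_derivative_iff \<alpha>_def)
  have \<phi>_deriv: "(deriv \<phi> \<longlongrightarrow> \<alpha>) (at 0)"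
  proof -
    have "continuous_on (\<psi> ` V) (deriv \<phi>)"
      by (intro holomorphic_on_imp_continuous_on holomorphic_deriv \<phi>(1) open\<psi>V)
    then have "isCont (deriv \<phi>) 0" using continuous_on_eq_continuous_at[OF open\<psi>V] in0 by blast
    then show ?thesis by (simp add: isCont_def \<alpha>_def)
  qed
  have \<phi>_lim: "(\<phi> \<longlongrightarrow> 0) (at 0)"
    using DERIV_isCont[OF D\<phi>[OF in0]] \<phi>0 by (simp add: isCont_def)

  have DY: "(Y has_derivative frechet_derivative Y (at z)) (at z)" if "z \<in> V" for z
  proof -
    have "\<psi> z \<in> ball 0 r" "f (\<psi> z) \<in> U" using \<psi>V that by auto
    then have "f differentiable (at (\<psi> z))" "X differentiable (at (f (\<psi> z)))"
      using smooth_on_has_derivative[OF f] smooth_on_has_derivative[OF Xs(3)] differentiable_def by blast+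
    moreover have "\<psi> differentiable (at z)"
      using holomorphic_derivI[OF \<psi>(1) V(1) that] by (auto simp: has_field_derivative_def differentiable_def)
    ultimately have "(\<lambda>z. X (f (\<psi> z))) differentiable (at z)"
      using differentiable_chain_at[of \<psi> z f] differentiable_chain_at[of "f \<circ> \<psi>" z X] by (simp add: o_def)
    then show ?thesis by (simp add: Y_def[abs_def] frechet_derivative_works)
  qed
  have Df: "frechet_derivative f (at w) v =
      frechet_derivative Xi (at (Y (\<phi> w))) (frechet_derivative Y (at (\<phi> w)) (deriv \<phi> w * v))"
    if w: "w \<in> \<psi> ` V" for w v
  proof -
    have z: "\<phi> w \<in> V" using w \<phi>(3) by auto
    have "f (\<psi> (\<phi> w)) \<in> U" using z \<psi>V by blast
    then have YU: "Y (\<phi> w) \<in> X ` U" by (simp add: Y_def)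
    have "((\<lambda>w. Y (\<phi> w)) has_derivative (\<lambda>v. frechet_derivative Y (at (\<phi> w)) (deriv \<phi> w * v))) (at w)"
      by (rule has_derivative_compose[OF D\<phi>[OF w, unfolded has_field_derivative_def] DY[OF z]])
    from has_derivative_compose[OF this smooth_on_has_derivative[OF Xs(5) YU]]
    have "(f has_derivative (\<lambda>v. frechet_derivative Xi (at (Y (\<phi> w))) (frechet_derivative Y (at (\<phi> w)) (deriv \<phi> w * v)))) (at w)"
    proof (rule has_derivative_transform_within_open[OF _ open\<psi>V w])
      fix x assume "x \<in> \<psi> ` V"
      then obtain z where "z \<in> V" "x = \<psi> z" by auto
      moreover from this have "f x \<in> U" using \<psi>V by auto
      ultimately show "Xi (Y (\<phi> x)) = f x" using \<phi>(3) Xs(2) by (simp add: Y_def Xi_def)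
    qed
    then show ?thesis by (simp add: frechet_derivative_eqI)
  qed

  define a where "a = \<alpha> ^ N"
  have est: "\<forall>\<^sub>F w in at 0. \<forall>v.
    norm (A *v frechet_derivative f (at w) v - cpair (of_nat N * a * w ^ (N - 1) * v) 0)
      \<le> e * cmod w ^ (N - 1) * cmod v" if e: "e > 0" for e
  proof -
    obtain K where K: "K > 0" "\<And>x. norm (A *v x) \<le> norm x * K"
      using bounded_linear.pos_bounded[OF matrix_vector_mul_bounded_linear[of A]] by blast
    define B where "B = (K * (real N + 1) + 1) * (2 * cmod \<alpha>) ^ N"
    have "K * (real N + 1) + 1 > 0" using mult_nonneg_nonneg[of K "real N + 1"] K by linarith
    then have B: "B > 0" unfolding B_def using \<alpha> by (intro mult_pos_pos) auto
    \<comment> \<open>\<open>e1\<close> is the relative error allowed for the differentials of \<open>Y\<close> and \<open>Xi\<close>, and \<open>e2\<close> the error allowed for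
      replacing \<open>\<phi>\<close> by its linear part; each of them contributes \<open>e / 2\<close>\<close>
    define e1 where "e1 = min 1 (e / (2 * B))"
    define e2 where "e2 = e / (2 * real N)"
    have e1: "e1 > 0" "e1 \<le> 1" "e1 * B \<le> e / 2"
      using e B by (auto simp: e1_def min_def field_simps)
    have e2: "e2 > 0" "real N * e2 = e / 2" using e N by (auto simp: e2_def)
    have ev1: "\<forall>\<^sub>F w in at 0. w \<in> \<psi> ` V \<and> w \<noteq> 0"
      using eventually_at_in_open[OF open\<psi>V in0] by simp
    have ev2: "\<forall>\<^sub>F w in at 0. \<forall>u. norm (frechet_derivative Y (at (\<phi> w)) u - cpair (of_nat N * \<phi> w ^ (N - 1) * u) 0)
      \<le> e1 * cmod (\<phi> w) ^ (N - 1) * cmod u"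
    proof -
      have "\<forall>\<^sub>F z in at 0. z \<in> V" using V eventually_at_in_open' by blast
      then have "\<forall>\<^sub>F z in at 0. Y differentiable (at z)"
        by eventually_elim (use DY in \<open>auto simp: differentiable_def\<close>)
      from chart_expression_derivative[OF this _ _ _ _ e1(1), of N]
      have "\<forall>\<^sub>F z in at 0. \<forall>u. norm (frechet_derivative Y (at z) u - cpair (of_nat N * z ^ (N - 1) * u) 0)
        \<le> e1 * cmod z ^ (N - 1) * cmod u"
        using o unfolding Y_def by blast
      moreover have "filterlim \<phi> (at 0) (at 0)"
      proof (rule filterlim_atI[OF \<phi>_lim])
        show "\<forall>\<^sub>F w in at 0. \<phi> w \<noteq> 0"
          using ev1
        proof eventually_elim
          case (elim w)
          then obtain z where z: "z \<in> V" "w = \<psi> z" by auto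
          then have "z \<noteq> 0" using elim \<psi>(3) by auto
          then show ?case using z \<phi>(3) by simp
        qed
      qed
      ultimately show ?thesis by (rule eventually_compose_filterlim)
    qed
    have ev3: "\<forall>\<^sub>F w in at 0. \<forall>x. norm (frechet_derivative Xi (at (Y (\<phi> w))) x - frechet_derivative Xi (at 0) x) \<le> e1 * norm x"
    proof -
      have "0 \<in> X ` U" using X by force
      from smooth_on_derivative_close[OF Xs(5,4) this e1(1)]
      have "\<forall>\<^sub>F y in nhds 0. \<forall>x. norm (frechet_derivative Xi (at y) x - frechet_derivative Xi (at 0) x) \<le> e1 * norm x" .
      moreover have "filterlim (\<lambda>w. Y (\<phi> w)) (nhds 0) (at 0)"
      proof -
        have "isCont Y 0" using has_derivative_continuous[OF DY[OF V(2)]] .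
        moreover have "Y 0 = 0" using X(3) \<psi>(3) by (simp add: Y_def)
        ultimately show ?thesis using isCont_tendsto_compose[OF _ \<phi>_lim, of Y] by simp
      qed
      ultimately show ?thesis by (rule eventually_compose_filterlim)
    qed
    have ev4: "\<forall>\<^sub>F w in at 0. cmod (\<phi> w / w) < 2 * cmod \<alpha>"
      using tendsto_norm[OF \<phi>_quot] by (rule order_tendstoD(2)) (use \<alpha> in simp)
    have ev5: "\<forall>\<^sub>F w in at 0. cmod (deriv \<phi> w) < 2 * cmod \<alpha>"
      using tendsto_norm[OF \<phi>_deriv] by (rule order_tendstoD(2)) (use \<alpha> in simp)
    have ev6: "\<forall>\<^sub>F w in at 0. cmod ((\<phi> w / w) ^ (N - 1) * deriv \<phi> w - a) < e2"
    proof -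
      have "((\<lambda>w. (\<phi> w / w) ^ (N - 1) * deriv \<phi> w) \<longlongrightarrow> \<alpha> ^ (N - 1) * \<alpha>) (at 0)"
        by (intro tendsto_intros \<phi>_quot \<phi>_deriv)
      moreover have "\<alpha> ^ (N - 1) * \<alpha> = a" using N by (cases N) (auto simp: a_def)
      ultimately have "((\<lambda>w. (\<phi> w / w) ^ (N - 1) * deriv \<phi> w) \<longlongrightarrow> a) (at 0)" by simp
      from tendstoD[OF this e2(1)] show ?thesis by (simp add: dist_norm)
    qed
    show ?thesis using ev1 ev2 ev3 ev4 ev5 ev6
    proof eventually_elim
      case (elim w)
      then have w: "w \<in> \<psi> ` V" "w \<noteq> 0" by auto
      show ?case
      proof
        fix v
        define z where "z = \<phi> w"
        define u where "u = deriv \<phi> w * v"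
        define y where "y = frechet_derivative Y (at z) u"
        define m where "m = cpair (of_nat N * z ^ (N - 1) * u) 0"
        define k where "k = cmod z ^ (N - 1) * cmod u"
        have k0: "k \<ge> 0" by (simp add: k_def)
        have y: "norm (y - m) \<le> e1 * k" using elim(2) by (simp add: y_def m_def z_def k_def mult.assoc)
        have nm: "norm m = real N * k" by (simp add: m_def k_def norm_mult norm_power)
        have "e1 * k \<le> 1 * k" using e1 k0 by (intro mult_right_mono) auto
        then have ny: "norm y \<le> (real N + 1) * k"
          using y nm norm_triangle_sub[of y m] by (simp add: algebra_simps)
        have "A *v frechet_derivative f (at w) v
            = A *v (frechet_derivative Xi (at (Y z)) y - C *v y) + A *v (C *v (y - m)) + m"
        proof -
          have "A *v (C *v (y - m)) = A *v (C *v y) - m"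
            using frame(3) by (simp add: matrix_vector_mult_diff_distrib m_def)
          then show ?thesis
            using Df[OF w(1), of v] by (simp add: y_def u_def z_def matrix_vector_mult_diff_distrib)
        qed
        then have "norm (A *v frechet_derivative f (at w) v - m)
            \<le> norm (A *v (frechet_derivative Xi (at (Y z)) y - C *v y)) + norm (A *v (C *v (y - m)))"
          using norm_triangle_ineq by (metis add_diff_cancel_right')
        also have "\<dots> \<le> (e1 * ((real N + 1) * k)) * K + e1 * k"
        proof (intro add_mono)
          have "norm (frechet_derivative Xi (at (Y z)) y - C *v y) \<le> e1 * norm y"
            using elim(3) by (simp add: z_def C(2))
          also have "\<dots> \<le> e1 * ((real N + 1) * k)" using ny e1 by (intro mult_left_mono) auto
          finally show "norm (A *v (frechet_derivative Xi (at (Y z)) y - C *v y)) \<le> (e1 * ((real N + 1) * k)) * K"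
            using K by (meson mult_right_mono less_imp_le order_trans)
          show "norm (A *v (C *v (y - m))) \<le> e1 * k" unfolding frame(2) by (rule y)
        qed
        also have "\<dots> = e1 * (K * (real N + 1) + 1) * k" by (simp add: algebra_simps)
        also have "\<dots> \<le> e1 * (K * (real N + 1) + 1) * ((2 * cmod \<alpha>) ^ N * cmod w ^ (N - 1) * cmod v)"
        proof (rule mult_left_mono)
          have "cmod z \<le> 2 * cmod \<alpha> * cmod w"
            using elim(4) w(2) by (simp add: z_def norm_divide field_simps)
          moreover have "cmod u \<le> 2 * cmod \<alpha> * cmod v"
            unfolding u_def norm_mult using elim(5) by (intro mult_right_mono) auto
          ultimately have "k \<le> (2 * cmod \<alpha> * cmod w) ^ (N - 1) * (2 * cmod \<alpha> * cmod v)"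
            unfolding k_def by (intro mult_mono power_mono) auto
          also have "\<dots> = (2 * cmod \<alpha>) ^ N * cmod w ^ (N - 1) * cmod v"
            using N by (cases N) (auto simp: power_mult_distrib)
          finally show "k \<le> (2 * cmod \<alpha>) ^ N * cmod w ^ (N - 1) * cmod v" .
        qed (use e1 K in auto)
        also have "\<dots> = (e1 * B) * (cmod w ^ (N - 1) * cmod v)" by (simp add: B_def)
        also have "\<dots> \<le> e / 2 * (cmod w ^ (N - 1) * cmod v)" using e1(3) by (intro mult_right_mono) auto
        finally have 1: "norm (A *v frechet_derivative f (at w) v - m) \<le> e / 2 * (cmod w ^ (N - 1) * cmod v)" .
        have "of_nat N * z ^ (N - 1) * u - of_nat N * a * w ^ (N - 1) * v
            = of_nat N * ((\<phi> w / w) ^ (N - 1) * deriv \<phi> w - a) * (w ^ (N - 1) * v)"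
          using w(2) by (simp add: z_def u_def power_divide field_simps)
        then have "cmod (of_nat N * z ^ (N - 1) * u - of_nat N * a * w ^ (N - 1) * v)
            = real N * cmod ((\<phi> w / w) ^ (N - 1) * deriv \<phi> w - a) * (cmod w ^ (N - 1) * cmod v)"
          by (simp only: norm_mult norm_power norm_of_nat)
        also have "\<dots> \<le> real N * e2 * (cmod w ^ (N - 1) * cmod v)"
          using elim(6) by (intro mult_right_mono mult_left_mono) auto
        finally have "cmod (of_nat N * z ^ (N - 1) * u - of_nat N * a * w ^ (N - 1) * v)
            \<le> e / 2 * (cmod w ^ (N - 1) * cmod v)" by (simp only: e2(2))
        moreover have "m - cpair (of_nat N * a * w ^ (N - 1) * v) 0
            = cpair (of_nat N * z ^ (N - 1) * u - of_nat N * a * w ^ (N - 1) * v) 0"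
          unfolding m_def by (rule linear_diff[OF bounded_linear.linear[OF bounded_linear_cpair1], symmetric])
        ultimately have 2: "norm (m - cpair (of_nat N * a * w ^ (N - 1) * v) 0) \<le> e / 2 * (cmod w ^ (N - 1) * cmod v)"
          by (simp only: norm_cpair_0)
        have "norm (A *v frechet_derivative f (at w) v - cpair (of_nat N * a * w ^ (N - 1) * v) 0)
            \<le> e / 2 * (cmod w ^ (N - 1) * cmod v) + e / 2 * (cmod w ^ (N - 1) * cmod v)"
          using norm_triangle_le[OF add_mono[OF 1 2]] by simp
        then show "norm (A *v frechet_derivative f (at w) v - cpair (of_nat N * a * w ^ (N - 1) * v) 0)
            \<le> e * cmod w ^ (N - 1) * cmod v"
          by (simp only: distrib_right[symmetric] field_sum_of_halves mult.assoc)
      qed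
    qed
  qed
  have "a \<noteq> 0" using \<alpha> by (simp add: a_def)
  then show ?thesis using frame(1) est unfolding A_def by blast
qed

section \<open>The branch knot\<close>

theorem proposition3:
  fixes f :: "complex \<Rightarrow> real^4" and r :: real and N :: nat
    and U :: "(real^4) set" and X :: "real^4 \<Rightarrow> real^4" and E :: "real^4^4"
  assumes "r > 0"
    and "N \<ge> 2"
    and "branched_disc (ball 0 r) f N"
    and "branched_in_chart (ball 0 r) f N U X"
    and "E = adapted_basis U X (f 0)"
    and "\<exists>V. open V \<and> 0 \<in> V \<and> V \<subseteq> ball 0 r \<and> embedding_map (top_of_set V) euclidean f"
  shows "\<exists>R. 0 < R \<and> R < 1 \<and> ball 0 R \<subseteq> (ball 0 r :: complex set) \<and>
    (\<exists>\<epsilon>\<^sub>0>0.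
       (\<forall>\<epsilon>. 0 < \<epsilon> \<and> \<epsilon> < \<epsilon>\<^sub>0 \<longrightarrow>
          (\<exists>\<gamma>. is_branch_knot E f R \<epsilon> \<gamma> \<and> closed_braid_of_index E (f 0) \<epsilon> \<gamma> N)) \<and>
       (\<forall>\<epsilon> \<epsilon>'. 0 < \<epsilon> \<and> \<epsilon> < \<epsilon>\<^sub>0 \<and> 0 < \<epsilon>' \<and> \<epsilon>' < \<epsilon>\<^sub>0 \<longrightarrow>
          (\<exists>\<gamma> \<gamma>'. is_branch_knot E f R \<epsilon> \<gamma> \<and> is_branch_knot E f R \<epsilon>' \<gamma>'
             \<and> same_transverse_type E (f 0) \<epsilon> \<gamma> \<epsilon>' \<gamma>')))"
proof -
  have f: "smooth_on (ball 0 r) f" using assms(3) by (simp add: branched_disc_def)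
  obtain V where V: "open V" "0 \<in> V" "V \<subseteq> ball 0 r" "embedding_map (top_of_set V) euclidean f"
    using assms(6) by blast
  have inj: "inj_on f V"
    using V(4) homeomorphic_imp_injective_map unfolding embedding_map_def by fastforce
  obtain a where det: "det E > 0" and a: "a \<noteq> 0" and est: "\<And>e. e > 0 \<Longrightarrow> \<forall>\<^sub>F w in at 0. \<forall>v.
      norm (matrix_inv E *v frechet_derivative f (at w) v - cpair (of_nat N * a * w ^ (N - 1) * v) 0)
        \<le> e * cmod w ^ (N - 1) * cmod v"
    using leading_term[OF _ assms(1) f assms(4,5)] assms(2) by auto
  obtain d where d: "d > 0" "\<And>w v. w \<noteq> 0 \<Longrightarrow> cmod w < d \<Longrightarrow>
      norm (matrix_inv E *v frechet_derivative f (at w) v - cpair (of_nat N * a * w ^ (N - 1) * v) 0)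
        \<le> cmod a / 16 * cmod w ^ (N - 1) * cmod v"
    using est[of "cmod a / 16"] a unfolding eventually_at by auto
  obtain \<rho> where \<rho>: "\<rho> > 0" "ball 0 \<rho> \<subseteq> V" using V(1,2) by (meson openE)
  define R where "R = min (min d \<rho>) (1/2)"
  have R: "0 < R" "R < 1" "R \<le> d" "ball 0 R \<subseteq> V" using d \<rho> by (auto simp: R_def)
  define F where "F w = matrix_inv E *v (f w - f 0)" for w
  have f_eq: "f w = f 0 + E *v F w" for w
  proof -
    have "invertible E" using det by (simp add: invertible_det_nz)
    then have "E ** matrix_inv E = mat 1"
      unfolding invertible_def matrix_inv_def by (rule someI2_ex) simp
    then show ?thesis by (simp add: F_def matrix_vector_mul_assoc)
  qed
  have bl: "bounded_linear ((*v) (matrix_inv E))" by (rule matrix_vector_mul_bounded_linear)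
  have fR: "smooth_on (ball 0 R) f" using f R(4) V(3) smooth_on_subset by blast
  interpret framed_germ F a N R f E
  proof
    show "smooth_on (ball 0 R) F" unfolding F_def
      by (intro smooth_on_bounded_linear[OF bl] smooth_on_diff smooth_on_const fR open_ball)
    show "inj_on F (ball 0 R)"
    proof (rule inj_onI)
      fix x y assume "x \<in> ball 0 R" "y \<in> ball 0 R" "F x = F y"
      then show "x = y" using f_eq[of x] f_eq[of y] inj R(4) by (metis inj_onD subsetD)
    qed
    fix w v :: complex assume w: "w \<in> ball 0 R" "w \<noteq> 0"
    have "((\<lambda>w. matrix_inv E *v (f w - f 0)) has_derivative (\<lambda>v. matrix_inv E *v (frechet_derivative f (at w) v - 0))) (at w)"
      by (intro bounded_linear.has_derivative[OF bl] has_derivative_diff has_derivative_const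
          smooth_on_has_derivative[OF fR w(1)])
    then have "frechet_derivative F (at w) v = matrix_inv E *v frechet_derivative f (at w) v"
      unfolding F_def[abs_def] by (simp add: frechet_derivative_eqI)
    then show "norm (frechet_derivative F (at w) v - cpair (of_nat N * a * w ^ (N - 1) * v) 0)
        \<le> cmod a / 16 * cmod w ^ (N - 1) * cmod v"
      using d(2)[OF w(2), of v] w(1) R(3) by simp
  qed (use R a det assms(2) f_eq in \<open>auto simp: F_def\<close>)
  show ?thesis
  proof (rule exI[of _ R], intro conjI exI[of _ level_bound] allI impI)
    show "ball 0 R \<subseteq> (ball 0 r :: complex set)" using R(4) V(3) by blast
    show "\<exists>\<gamma>. is_branch_knot E f R \<epsilon> \<gamma> \<and> closed_braid_of_index E (f 0) \<epsilon> \<gamma> N"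
      if "0 < \<epsilon> \<and> \<epsilon> < level_bound" for \<epsilon>
      using is_branch_knot_knot closed_braid_knot that by blast
    show "\<exists>\<gamma> \<gamma>'. is_branch_knot E f R \<epsilon> \<gamma> \<and> is_branch_knot E f R \<epsilon>' \<gamma>'
        \<and> same_transverse_type E (f 0) \<epsilon> \<gamma> \<epsilon>' \<gamma>'"
      if "0 < \<epsilon> \<and> \<epsilon> < level_bound \<and> 0 < \<epsilon>' \<and> \<epsilon>' < level_bound" for \<epsilon> \<epsilon>'
      using is_branch_knot_knot same_transverse_type_knot that by blast
  qed (use R level_bound_pos in auto)
qed

end
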